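(* Let $d\ge 1$ and let $\mathcal H$ be a Hilbert space which is continuously embedded in $\mathscr S'(\mathbb R^d)$, and suppose there is a constant $C_0\ge 1$ such that for every $f\in\mathcal H$ and $x,\xi\in\mathbb R^d$ the distribution $e^{i\langle\cdot,\xi\rangle}f(\cdot-x)$ belongs to $\mathcal H$ and $$\|e^{i\langle\cdot,\xi\rangle}f(\cdot-x)\|_{\mathcal H}\le C_0\|f\|_{\mathcal H}.$$ If $\mathcal H\neq\{0\}$, then $\mathcal H=L^2(\mathbb R^d)$, and there is a constant $C>0$, independent of $f$, such that $$C_0^{-1}C\|f\|_{L^2(\mathbb R^d)}\le\|f\|_{\mathcal H}\le C_0C\|f\|_{L^2(\mathbb R^d)},\qquad f\in\mathcal H=L^2(\mathbb R^d).$$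
   Context: $\mathscr S'(\mathbb R^d)$ denotes the space of tempered distributions on $\mathbb R^d$, and $\langle\cdot,\cdot\rangle$ the standard inner product on $\mathbb R^d$. *)

theory Defs
  imports "HOL-Analysis.Analysis"
begin

text \<open>Functions on R^d are modelled on an abstract Euclidean space 'a (d = DIM('a) \<ge> 1).\<close>

fun pderivs :: "'a::euclidean_space list \<Rightarrow> ('a \<Rightarrow> complex) \<Rightarrow> 'a \<Rightarrow> complex" where
  "pderivs [] f = f"
| "pderivs (b # bs) f = (\<lambda>x. vector_derivative (\<lambda>t::real. pderivs bs f (x + t *\<^sub>R b)) (at 0))"

definition schwartz :: "('a::euclidean_space \<Rightarrow> complex) \<Rightarrow> bool" where
  "schwartz \<phi> \<longleftrightarrow>
     (\<forall>bs. set bs \<subseteq> Basis \<longrightarrow>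
        (\<forall>b\<in>Basis. \<forall>x. (\<lambda>t::real. pderivs bs \<phi> (x + t *\<^sub>R b)) differentiable (at 0)) \<and>
        continuous_on UNIV (pderivs bs \<phi>) \<and>
        (\<forall>n::nat. \<exists>C. \<forall>x. (1 + norm x) ^ n * norm (pderivs bs \<phi> x) \<le> C))"

definition schwartz_seminorm :: "nat \<Rightarrow> ('a::euclidean_space \<Rightarrow> complex) \<Rightarrow> real" where
  "schwartz_seminorm N \<phi> =
     (\<Sum>bs\<in>{bs. set bs \<subseteq> (Basis::'a set) \<and> length bs \<le> N}.
        (SUP x. (1 + norm x) ^ N * norm (pderivs bs \<phi> x)))"

text \<open>Tempered distributions: continuous linear functionals on the Schwartz space
  (continuity = bounded by a finite Schwartz seminorm). Canonical representative: value 0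
  outside the Schwartz space, so equality of distributions is equality of functions.\<close>
definition tempered :: "(('a::euclidean_space \<Rightarrow> complex) \<Rightarrow> complex) \<Rightarrow> bool" where
  "tempered T \<longleftrightarrow>
     (\<forall>\<phi>. \<not> schwartz \<phi> \<longrightarrow> T \<phi> = 0) \<and>
     (\<forall>\<phi> \<psi>. schwartz \<phi> \<longrightarrow> schwartz \<psi> \<longrightarrow> T (\<lambda>x. \<phi> x + \<psi> x) = T \<phi> + T \<psi>) \<and>
     (\<forall>\<phi> c. schwartz \<phi> \<longrightarrow> T (\<lambda>x. c * \<phi> x) = c * T \<phi>) \<and>
     (\<exists>C N. \<forall>\<phi>. schwartz \<phi> \<longrightarrow> norm (T \<phi>) \<le> C * schwartz_seminorm N \<phi>)"

text \<open>The distribution e^{i<.,xi>} T(. - x):  phi \<mapsto> T(z \<mapsto> e^{i<z+x,xi>} phi(z+x)).\<close>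
definition modtrans :: "'a::euclidean_space \<Rightarrow> 'a \<Rightarrow> (('a \<Rightarrow> complex) \<Rightarrow> complex) \<Rightarrow> ('a \<Rightarrow> complex) \<Rightarrow> complex" where
  "modtrans x \<xi> T = (\<lambda>\<phi>. if schwartz \<phi>
      then T (\<lambda>z. exp (\<i> * complex_of_real (inner (z + x) \<xi>)) * \<phi> (z + x)) else 0)"

definition L2 :: "('a::euclidean_space \<Rightarrow> complex) set" where
  "L2 = {f. f \<in> borel_measurable lebesgue \<and> integrable lebesgue (\<lambda>x. (norm (f x))\<^sup>2)}"

definition L2_norm :: "('a::euclidean_space \<Rightarrow> complex) \<Rightarrow> real" where
  "L2_norm f = sqrt (integral\<^sup>L lebesgue (\<lambda>x. (norm (f x))\<^sup>2))"

definition regdist :: "('a::euclidean_space \<Rightarrow> complex) \<Rightarrow> ('a \<Rightarrow> complex) \<Rightarrow> complex" where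
  "regdist f = (\<lambda>\<phi>. if schwartz \<phi> then integral\<^sup>L lebesgue (\<lambda>y. f y * \<phi> y) else 0)"

definition dzero :: "('a \<Rightarrow> complex) \<Rightarrow> complex" where
  "dzero = (\<lambda>\<phi>. 0)"

definition dadd :: "(('a \<Rightarrow> complex) \<Rightarrow> complex) \<Rightarrow> (('a \<Rightarrow> complex) \<Rightarrow> complex) \<Rightarrow> ('a \<Rightarrow> complex) \<Rightarrow> complex" where
  "dadd T S = (\<lambda>\<phi>. T \<phi> + S \<phi>)"

definition dscale :: "complex \<Rightarrow> (('a \<Rightarrow> complex) \<Rightarrow> complex) \<Rightarrow> ('a \<Rightarrow> complex) \<Rightarrow> complex" where
  "dscale c T = (\<lambda>\<phi>. c * T \<phi>)"

text \<open>A (complex) Hilbert space continuously embedded in S'(R^d), identified with its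
  image Hs \<subseteq> S'(R^d) and carrying the inner product ip; its norm is hnorm ip.\<close>
definition hnorm :: "((('a \<Rightarrow> complex) \<Rightarrow> complex) \<Rightarrow> (('a \<Rightarrow> complex) \<Rightarrow> complex) \<Rightarrow> complex)
    \<Rightarrow> (('a \<Rightarrow> complex) \<Rightarrow> complex) \<Rightarrow> real" where
  "hnorm ip T = sqrt (Re (ip T T))"

definition hilbert_embedded :: "(('a::euclidean_space \<Rightarrow> complex) \<Rightarrow> complex) set
    \<Rightarrow> ((('a \<Rightarrow> complex) \<Rightarrow> complex) \<Rightarrow> (('a \<Rightarrow> complex) \<Rightarrow> complex) \<Rightarrow> complex) \<Rightarrow> bool" where
  "hilbert_embedded Hs ip \<longleftrightarrow>
     \<comment> \<open>a complex linear subspace of S'\<close>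
     Hs \<subseteq> {T. tempered T} \<and> dzero \<in> Hs \<and>
     (\<forall>T\<in>Hs. \<forall>S\<in>Hs. dadd T S \<in> Hs) \<and> (\<forall>c. \<forall>T\<in>Hs. dscale c T \<in> Hs) \<and>
     \<comment> \<open>inner product\<close>
     (\<forall>T\<in>Hs. \<forall>S\<in>Hs. \<forall>R\<in>Hs. ip (dadd T S) R = ip T R + ip S R) \<and>
     (\<forall>c. \<forall>T\<in>Hs. \<forall>S\<in>Hs. ip (dscale c T) S = c * ip T S) \<and>
     (\<forall>T\<in>Hs. \<forall>S\<in>Hs. ip T S = cnj (ip S T)) \<and>
     (\<forall>T\<in>Hs. Re (ip T T) \<ge> 0) \<and>
     (\<forall>T\<in>Hs. ip T T = 0 \<longrightarrow> T = dzero) \<and>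
     \<comment> \<open>completeness\<close>
     (\<forall>X. (\<forall>n. X n \<in> Hs) \<and>
          (\<forall>e>0. \<exists>N. \<forall>m\<ge>N. \<forall>n\<ge>N. hnorm ip (dadd (X m) (dscale (-1) (X n))) < e)
        \<longrightarrow> (\<exists>T\<in>Hs. (\<lambda>n. hnorm ip (dadd (X n) (dscale (-1) T))) \<longlonglongrightarrow> 0)) \<and>
     \<comment> \<open>continuity of the embedding into S' (weak-* topology)\<close>
     (\<forall>\<phi>. schwartz \<phi> \<longrightarrow> (\<exists>K. \<forall>T\<in>Hs. norm (T \<phi>) \<le> K * hnorm ip T))"

end

theory Submission
  imports Defs
begin

text \<open>
  The phase-space shifts \<open>e^{i<.,xi>} f(. - x)\<close> form an abelian group up to unimodular factors. Averaging the
  inner product over this group, by means of Foelner lists and Tychonoff's theorem, gives an equivalent inner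
  product that is invariant; this costs the factor \<open>C0\<close> on either side. For the invariant inner product, Riesz
  representation of the evaluations \<open>T \<mapsto> T \<phi>\<close> by elements \<open>rep \<phi>\<close> yields a hermitian form
  \<open>B(\<phi>, \<psi>) = rep \<psi> \<phi>\<close> on Schwartz functions which is invariant under all phase-space shifts.
  Differentiating the invariance, multiplication by \<open>x_j\<close> is symmetric and \<open>\<partial>_j\<close> is skew with respect
  to \<open>B\<close>, so \<open>T = B(., g_s)\<close> with \<open>g_s(x) = exp(-s|x|^2/2)\<close> satisfies \<open>T((s x_j - \<partial>_j) q) = 0\<close> for Gaussians
  \<open>q\<close>. Along a path of Gaussians this is a linear differential equation, which determines \<open>B\<close> on Gaussians
  up to a constant. As the span of the Gaussians is dense among Schwartz functions, \<open>B\<close> is a multiple \<open>c\<close> of the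
  \<open>L^2\<close> product. Hence \<open>rep \<psi>\<close> is the function \<open>c cnj \<psi>\<close>, and the Hilbert space and
  \<open>L^2\<close> are completions of the same space for proportional norms.
\<close>

section \<open>Schwartz functions\<close>

text \<open>That an invariant form is a multiple of the L^2 product is Schur's lemma for the
  Schroedinger representation, obtained here without Fourier analysis. Neither joint continuity of
  the form nor continuity of the action on the Hilbert space in \<open>x\<close> and
  \<open>\<xi>\<close> is given, and this shapes the proof. Each \<open>B(., \<psi>)\<close> is a
  tempered distribution, so density of the Gaussians is applied to one argument at a time, and
  derivatives of \<open>B\<close> are only taken along families of Gaussians, where a remainder
  bounded in every Schwartz seminorm is available. Since the action may be discontinuous, the group
  is averaged as a discrete one, over finite lists, and not by integration. As for the constant: a
  shift and its inverse each cost a factor \<open>C0\<close>, so the averaged functions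
  \<open>z \<mapsto> ip(T_z, T_z)\<close>, with \<open>T_z\<close> the shifted \<open>T\<close>, lie
  between \<open>C0\<close> to the power -2 and \<open>C0\<close> to the power 2 times the squared
  norm; both bounds survive averaging and limits, and the square root leaves \<open>C0\<close> on
  either side.\<close>

definition has_pd :: "'a::euclidean_space \<Rightarrow> ('a \<Rightarrow> complex) \<Rightarrow> ('a \<Rightarrow> complex) \<Rightarrow> bool" where
  "has_pd b f g \<longleftrightarrow> (\<forall>x. ((\<lambda>t::real. f (x + t *\<^sub>R b)) has_vector_derivative g x) (at 0))"

lemma pderivs_Cons_eq: "has_pd b (pderivs bs f) g \<Longrightarrow> pderivs (b # bs) f = g"
  by (auto simp: has_pd_def intro!: ext vector_derivative_at)

lemma pderivs_append: "pderivs (bs @ cs) f = pderivs bs (pderivs cs f)"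
  by (induction bs) auto

lemma has_pd_pderivs:
  assumes "schwartz \<phi>" "set bs \<subseteq> Basis" "b \<in> Basis"
  shows "has_pd b (pderivs bs \<phi>) (pderivs (b # bs) \<phi>)"
  using assms by (auto simp: schwartz_def has_pd_def vector_derivative_works)

lemma has_pd_schwartz:
  assumes "schwartz \<phi>" "b \<in> Basis"
  shows "has_pd b \<phi> (pderivs [b] \<phi>)"
  using has_pd_pderivs[OF assms(1), of "[]" b] assms by simp

lemma has_pd_const: "has_pd b (\<lambda>x. c) (\<lambda>x. 0)"
  by (simp add: has_pd_def)

lemma has_pd_add:
  "has_pd b f f' \<Longrightarrow> has_pd b g g' \<Longrightarrow> has_pd b (\<lambda>x. f x + g x) (\<lambda>x. f' x + g' x)"
  by (auto simp: has_pd_def intro!: derivative_intros)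

lemma has_pd_mult:
  assumes "has_pd b f f'" "has_pd b g g'"
  shows "has_pd b (\<lambda>x. f x * g x) (\<lambda>x. f' x * g x + f x * g' x)"
  unfolding has_pd_def
proof
  fix x
  show "((\<lambda>t. f (x + t *\<^sub>R b) * g (x + t *\<^sub>R b)) has_vector_derivative f' x * g x + f x * g' x) (at 0)"
    using has_vector_derivative_mult[OF assms(1)[unfolded has_pd_def, rule_format, of x]
        assms(2)[unfolded has_pd_def, rule_format, of x]]
    by (simp add: add.commute)
qed

lemma has_pd_cmult: "has_pd b f f' \<Longrightarrow> has_pd b (\<lambda>x. c * f x) (\<lambda>x. c * f' x)"
  using has_pd_mult[OF has_pd_const, of b f f' c] by simp

lemma has_pd_exp:
  assumes "has_pd b f f'"
  shows "has_pd b (\<lambda>x. exp (f x)) (\<lambda>x. f' x * exp (f x))"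
  unfolding has_pd_def
proof
  fix x
  have "((exp \<circ> (\<lambda>t. f (x + t *\<^sub>R b))) has_vector_derivative f' x * exp (f (x + 0 *\<^sub>R b))) (at 0)"
    by (intro field_vector_diff_chain_at DERIV_exp) (use assms in \<open>auto simp: has_pd_def\<close>)
  then show "((\<lambda>t. exp (f (x + t *\<^sub>R b))) has_vector_derivative f' x * exp (f x)) (at 0)"
    by (simp add: o_def)
qed

lemma has_pd_inner:
  "has_pd b (\<lambda>x. complex_of_real (x \<bullet> c)) (\<lambda>x. complex_of_real (b \<bullet> c))"
  unfolding has_pd_def
proof
  fix x :: 'a
  have "((\<lambda>t. (x + t *\<^sub>R b) \<bullet> c) has_real_derivative b \<bullet> c) (at 0)"
    by (auto simp: inner_simps intro!: derivative_eq_intros)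
  then show "((\<lambda>t. complex_of_real ((x + t *\<^sub>R b) \<bullet> c)) has_vector_derivative complex_of_real (b \<bullet> c)) (at 0)"
    by (rule has_vector_derivative_of_real[unfolded has_real_derivative_iff_has_vector_derivative[symmetric]])
qed

lemma has_pd_shift: "has_pd b f f' \<Longrightarrow> has_pd b (\<lambda>x. f (x + a)) (\<lambda>x. f' (x + a))"
  unfolding has_pd_def add.assoc add.commute[of _ a] unfolding add.assoc[symmetric] by blast

text \<open>\<open>has_pd\<close> only speaks of the parameter 0, but at every base point.
  Recentring the line at \<open>x + s *\<^sub>R b\<close> therefore yields every parameter, as the
  mean value estimate in \<open>conv_has_pd\<close> requires.\<close>

lemma has_pd_line:
  assumes "has_pd b f f'"
  shows "((\<lambda>t. f (x + t *\<^sub>R b)) has_vector_derivative f' (x + s *\<^sub>R b)) (at s within S)"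
proof -
  have "((\<lambda>t. f ((x + s *\<^sub>R b) + t *\<^sub>R b)) has_vector_derivative f' (x + s *\<^sub>R b)) (at (s + - s))"
    using assms by (simp add: has_pd_def)
  then have "((\<lambda>t. f ((x + s *\<^sub>R b) + t *\<^sub>R b)) \<circ> (\<lambda>t. t + - s) has_vector_derivative 1 *\<^sub>R f' (x + s *\<^sub>R b)) (at s)"
    by (intro vector_diff_chain_at) (auto intro!: derivative_eq_intros)
  then have "((\<lambda>t. f (x + t *\<^sub>R b)) has_vector_derivative f' (x + s *\<^sub>R b)) (at s)"
    by (simp add: o_def algebra_simps)
  then show ?thesis by (rule has_vector_derivative_at_within)
qed

section \<open>Families closed under differentiation\<close>

definition rapid_family :: "'i set \<Rightarrow> ('i \<Rightarrow> 'a::euclidean_space \<Rightarrow> complex) \<Rightarrow> bool" where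
  "rapid_family I \<Phi> \<longleftrightarrow> (\<forall>n. \<exists>C. \<forall>i\<in>I. \<forall>x. (1 + norm x) ^ n * norm (\<Phi> i x) \<le> C)"

text \<open>The derivative family \<open>\<Psi>\<close> is chosen before the index, so the decay
  constants of all iterated derivatives are uniform in \<open>i\<close>. With a one-point index set
  this is the invariant of a coinduction for single Schwartz functions.\<close>

definition derivative_closed :: "'i set \<Rightarrow> ('i \<Rightarrow> 'a::euclidean_space \<Rightarrow> complex) set \<Rightarrow> bool" where
  "derivative_closed I X \<longleftrightarrow> (\<forall>\<Phi>\<in>X. (\<forall>i\<in>I. continuous_on UNIV (\<Phi> i)) \<and> rapid_family I \<Phi> \<and>
     (\<forall>b\<in>Basis. \<exists>\<Psi>\<in>X. \<forall>i\<in>I. has_pd b (\<Phi> i) (\<Psi> i)))"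

lemma derivative_closed_pderivs:
  assumes "derivative_closed I X" "\<Phi> \<in> X" "set bs \<subseteq> Basis"
  shows "\<exists>\<Psi>\<in>X. \<forall>i\<in>I. pderivs bs (\<Phi> i) = \<Psi> i"
  using assms(3)
proof (induction bs)
  case Nil
  then show ?case using assms(2) by auto
next
  case (Cons b bs)
  then obtain \<Psi> where \<Psi>: "\<Psi> \<in> X" "\<And>i. i \<in> I \<Longrightarrow> pderivs bs (\<Phi> i) = \<Psi> i" by auto
  then obtain \<Psi>' where \<Psi>': "\<Psi>' \<in> X" "\<And>i. i \<in> I \<Longrightarrow> has_pd b (\<Psi> i) (\<Psi>' i)"
    using assms(1) Cons.prems unfolding derivative_closed_def by fastforce
  then have "pderivs (b # bs) (\<Phi> i) = \<Psi>' i" if "i \<in> I" for i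
    using \<Psi> that by (intro pderivs_Cons_eq) auto
  then show ?case using \<Psi>' by blast
qed

lemma derivative_closed_schwartz:
  fixes X :: "('i \<Rightarrow> 'a::euclidean_space \<Rightarrow> complex) set"
  assumes X: "derivative_closed I X" and \<Phi>: "\<Phi> \<in> X" and i: "i \<in> I"
  shows "schwartz (\<Phi> i)"
  unfolding schwartz_def
proof (intro allI impI)
  fix bs :: "'a list" assume "set bs \<subseteq> Basis"
  from derivative_closed_pderivs[OF X \<Phi> this] obtain \<Psi> where
    \<Psi>: "\<Psi> \<in> X" "pderivs bs (\<Phi> i) = \<Psi> i" using i by blast
  have "(\<lambda>t. \<Psi> i (x + t *\<^sub>R b)) differentiable at 0" if "b \<in> Basis" for b x
  proof -
    obtain \<Psi>' where "has_pd b (\<Psi> i) (\<Psi>' i)"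
      using X \<Psi>(1) i \<open>b \<in> Basis\<close> unfolding derivative_closed_def by blast
    then show ?thesis by (auto simp: has_pd_def intro: differentiableI_vector)
  qed
  moreover have "continuous_on UNIV (\<Psi> i)" "rapid_family I \<Psi>"
    using X \<Psi>(1) i unfolding derivative_closed_def by blast+
  ultimately show "(\<forall>b\<in>Basis. \<forall>x. (\<lambda>t. pderivs bs (\<Phi> i) (x + t *\<^sub>R b)) differentiable at 0) \<and>
       continuous_on UNIV (pderivs bs (\<Phi> i)) \<and>
       (\<forall>n. \<exists>C. \<forall>x. (1 + norm x) ^ n * norm (pderivs bs (\<Phi> i) x) \<le> C)"
    using i unfolding \<Psi>(2) rapid_family_def by blast
qed

abbreviation multi_indices :: "nat \<Rightarrow> 'a::euclidean_space list set" where
  "multi_indices N \<equiv> {bs. set bs \<subseteq> (Basis::'a set) \<and> length bs \<le> N}"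

lemma schwartz_seminorm_le:
  fixes \<phi> :: "'a::euclidean_space \<Rightarrow> complex"
  assumes "\<And>bs x. bs \<in> multi_indices N \<Longrightarrow> (1 + norm x) ^ N * norm (pderivs bs \<phi> x) \<le> C bs"
  shows "schwartz_seminorm N \<phi> \<le> (\<Sum>bs\<in>multi_indices N. C bs)"
  unfolding schwartz_seminorm_def
  by (rule sum_mono) (use assms in \<open>auto intro!: cSUP_least\<close>)

lemma schwartz_rapid:
  assumes "schwartz \<phi>" "set bs \<subseteq> Basis"
  shows "\<exists>C>0. \<forall>x. (1 + norm x) ^ n * norm (pderivs bs \<phi> x) \<le> C"
proof -
  obtain C where "\<forall>x. (1 + norm x) ^ n * norm (pderivs bs \<phi> x) \<le> C"
    using assms unfolding schwartz_def by blast
  then show ?thesis by (intro exI[of _ "\<bar>C\<bar> + 1"]) (auto intro: order_trans[where y = C])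
qed

lemma norm_pderivs_le_seminorm:
  fixes \<phi> :: "'a::euclidean_space \<Rightarrow> complex"
  assumes "schwartz \<phi>" "bs \<in> multi_indices N"
  shows "(1 + norm x) ^ N * norm (pderivs bs \<phi> x) \<le> schwartz_seminorm N \<phi>"
proof -
  \<comment> \<open>A real \<open>SUP\<close> dominates its values only over a bounded range, which
    the decay of Schwartz functions supplies.\<close>
  have bdd: "bdd_above (range (\<lambda>x. (1 + norm x) ^ N * norm (pderivs cs \<phi> x)))"
    if cs: "cs \<in> multi_indices N" for cs
  proof -
    obtain C where "\<forall>x. (1 + norm x) ^ N * norm (pderivs cs \<phi> x) \<le> C"
      using schwartz_rapid[OF assms(1), of cs N] cs by blast
    then show ?thesis by (intro bdd_aboveI[of _ C]) auto
  qed
  have "(1 + norm x) ^ N * norm (pderivs bs \<phi> x) \<le> (SUP x. (1 + norm x) ^ N * norm (pderivs bs \<phi> x))"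
    by (rule cSUP_upper[OF UNIV_I bdd[OF assms(2)]])
  also have "\<dots> \<le> schwartz_seminorm N \<phi>"
    unfolding schwartz_seminorm_def
  proof (rule member_le_sum[OF assms(2)])
    fix cs :: "'a list" assume "cs \<in> multi_indices N - {bs}"
    then show "0 \<le> (SUP x. (1 + norm x) ^ N * norm (pderivs cs \<phi> x))"
      by (intro cSUP_upper2[OF bdd UNIV_I]) auto
  qed (use finite_lists_length_le[OF finite_Basis] in auto)
  finally show ?thesis .
qed

lemma derivative_closed_seminorm_bounded:
  fixes X :: "('i \<Rightarrow> 'a::euclidean_space \<Rightarrow> complex) set"
  assumes X: "derivative_closed I X" and \<Phi>: "\<Phi> \<in> X"
  shows "\<exists>C. \<forall>i\<in>I. schwartz_seminorm N (\<Phi> i) \<le> C"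
proof -
  have "\<exists>C. \<forall>i\<in>I. \<forall>x. (1 + norm x) ^ N * norm (pderivs bs (\<Phi> i) x) \<le> C"
    if bs: "bs \<in> multi_indices N" for bs
  proof -
    obtain \<Psi> where \<Psi>: "\<Psi> \<in> X" "\<And>i. i \<in> I \<Longrightarrow> pderivs bs (\<Phi> i) = \<Psi> i"
      using derivative_closed_pderivs[OF X \<Phi>, of bs] bs by blast
    then have "rapid_family I \<Psi>" using X unfolding derivative_closed_def by blast
    then show ?thesis using \<Psi>(2) unfolding rapid_family_def by simp
  qed
  then have "\<forall>bs\<in>multi_indices N. \<exists>C. \<forall>i\<in>I. \<forall>x. (1 + norm x) ^ N * norm (pderivs bs (\<Phi> i) x) \<le> C"
    by blast
  from bchoice[OF this] obtain C where C: "\<forall>bs\<in>multi_indices N. \<forall>i\<in>I. \<forall>x.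
      (1 + norm x) ^ N * norm (pderivs bs (\<Phi> i) x) \<le> C bs" ..
  then have "\<forall>i\<in>I. schwartz_seminorm N (\<Phi> i) \<le> (\<Sum>bs\<in>multi_indices N. C bs)"
    by (intro ballI schwartz_seminorm_le) auto
  then show ?thesis by blast
qed

text \<open>Differentiation stays inside \<open>P\<close>, so continuity and decay have to be
  checked for undifferentiated members only; no formula for iterated derivatives is ever written
  down.\<close>

lemma schwartz_coinduct:
  fixes \<phi> :: "'a::euclidean_space \<Rightarrow> complex"
  assumes "P \<phi>" and cont: "\<And>f. P f \<Longrightarrow> continuous_on UNIV f"
    and rapid: "\<And>f n. P f \<Longrightarrow> \<exists>C. \<forall>x. (1 + norm x) ^ n * norm (f x) \<le> C"
    and pd: "\<And>f b. P f \<Longrightarrow> b \<in> Basis \<Longrightarrow> \<exists>g. P g \<and> has_pd b f g"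
  shows "schwartz \<phi>"
proof -
  have "derivative_closed {()} {\<Phi>. P (\<Phi> ())}"
    unfolding derivative_closed_def rapid_family_def
  proof (safe, goal_cases)
    case (3 \<Phi> b)
    then obtain g where "P g" "has_pd b (\<Phi> ()) g" using pd by blast
    then show ?case by (intro bexI[of _ "\<lambda>_. g"]) auto
  qed (use cont rapid in auto)
  from derivative_closed_schwartz[OF this, of "\<lambda>_. \<phi>" "()"] assms(1) show ?thesis by simp
qed

lemma schwartz_continuous: "schwartz \<phi> \<Longrightarrow> continuous_on UNIV \<phi>"
  unfolding schwartz_def by (drule spec[of _ "[]"]) simp

lemma schwartz_bound:
  assumes "schwartz \<phi>"
  shows "\<exists>C>0. \<forall>x. (1 + norm x) ^ n * norm (\<phi> x) \<le> C"
  using schwartz_rapid[OF assms, of "[]" n] by auto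

section \<open>Closure properties of the Schwartz space\<close>

lemma schwartz_pderivs: "schwartz \<phi> \<Longrightarrow> set bs \<subseteq> Basis \<Longrightarrow> schwartz (pderivs bs \<phi>)"
  unfolding schwartz_def pderivs_append[symmetric] by auto

lemma schwartz_pd:
  assumes "schwartz \<phi>" "b \<in> Basis"
  shows "\<exists>\<phi>'. schwartz \<phi>' \<and> has_pd b \<phi> \<phi>'"
proof -
  have "schwartz (pderivs [b] \<phi>)" using schwartz_pderivs[OF assms(1), of "[b]"] assms(2) by simp
  then show ?thesis using has_pd_schwartz[OF assms] by blast
qed

lemma schwartz_zero: "schwartz (\<lambda>x. 0)"
  by (rule schwartz_coinduct[where P = "\<lambda>f. f = (\<lambda>x. 0)"]) (auto simp: has_pd_const)

lemma schwartz_add: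
  assumes "schwartz \<phi>" "schwartz \<psi>"
  shows "schwartz (\<lambda>x. \<phi> x + \<psi> x)"
proof (rule schwartz_coinduct[where P = "\<lambda>f. \<exists>\<phi> \<psi>. schwartz \<phi> \<and> schwartz \<psi> \<and> f = (\<lambda>x. \<phi> x + \<psi> x)"])
  fix f :: "'a \<Rightarrow> complex" and n assume "\<exists>\<phi> \<psi>. schwartz \<phi> \<and> schwartz \<psi> \<and> f = (\<lambda>x. \<phi> x + \<psi> x)"
  then obtain \<phi> \<psi> where f: "schwartz \<phi>" "schwartz \<psi>" "f = (\<lambda>x. \<phi> x + \<psi> x)" by blast
  obtain C D where CD: "\<And>x. (1 + norm x) ^ n * norm (\<phi> x) \<le> C" "\<And>x. (1 + norm x) ^ n * norm (\<psi> x) \<le> D"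
    using schwartz_bound[OF f(1), of n] schwartz_bound[OF f(2), of n] by blast
  have "(1 + norm x) ^ n * norm (f x) \<le> C + D" for x
  proof -
    have "(1 + norm x) ^ n * norm (f x) \<le> (1 + norm x) ^ n * (norm (\<phi> x) + norm (\<psi> x))"
      unfolding f by (intro mult_left_mono norm_triangle_ineq) auto
    also have "\<dots> \<le> C + D" using CD by (simp add: ring_distribs add_mono)
    finally show ?thesis .
  qed
  then show "\<exists>C. \<forall>x. (1 + norm x) ^ n * norm (f x) \<le> C" by blast
next
  fix f :: "'a \<Rightarrow> complex" and b :: 'a
  assume "\<exists>\<phi> \<psi>. schwartz \<phi> \<and> schwartz \<psi> \<and> f = (\<lambda>x. \<phi> x + \<psi> x)" and b: "b \<in> Basis"
  then obtain \<phi> \<psi> where f: "schwartz \<phi>" "schwartz \<psi>" "f = (\<lambda>x. \<phi> x + \<psi> x)" by blast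
  obtain \<phi>' where p: "schwartz \<phi>'" "has_pd b \<phi> \<phi>'" using schwartz_pd[OF f(1) b] by blast
  obtain \<psi>' where q: "schwartz \<psi>'" "has_pd b \<psi> \<psi>'" using schwartz_pd[OF f(2) b] by blast
  show "\<exists>g. (\<exists>\<phi> \<psi>. schwartz \<phi> \<and> schwartz \<psi> \<and> g = (\<lambda>x. \<phi> x + \<psi> x)) \<and> has_pd b f g"
    using p(1) q(1) has_pd_add[OF p(2) q(2)] f(3) by blast
qed (use assms in \<open>auto intro!: continuous_intros intro: schwartz_continuous\<close>)

text \<open>For operators commuting with differentiation the image of the Schwartz space is itself a
  coinduction invariant. Serves multiples, translations and conjugation.\<close>

lemma schwartz_image:
  fixes F :: "('a::euclidean_space \<Rightarrow> complex) \<Rightarrow> 'a \<Rightarrow> complex"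
  assumes "schwartz \<phi>"
    and cont: "\<And>\<phi>. continuous_on UNIV \<phi> \<Longrightarrow> continuous_on UNIV (F \<phi>)"
    and rapid: "\<And>\<phi> n C. C > 0 \<Longrightarrow> (\<And>x. (1 + norm x) ^ n * norm (\<phi> x) \<le> C) \<Longrightarrow>
      \<exists>D. \<forall>x. (1 + norm x) ^ n * norm (F \<phi> x) \<le> D"
    and pd: "\<And>\<phi> \<phi>' b. has_pd b \<phi> \<phi>' \<Longrightarrow> has_pd b (F \<phi>) (F \<phi>')"
  shows "schwartz (F \<phi>)"
proof (rule schwartz_coinduct[where P = "\<lambda>f. \<exists>\<phi>. schwartz \<phi> \<and> f = F \<phi>"])
  fix f n assume "\<exists>\<phi>. schwartz \<phi> \<and> f = F \<phi>"
  then obtain \<phi> where f: "schwartz \<phi>" "f = F \<phi>" by blast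
  show "continuous_on UNIV f" using f cont schwartz_continuous by blast
  obtain C where "C > 0" "\<And>x. (1 + norm x) ^ n * norm (\<phi> x) \<le> C"
    using schwartz_bound[OF f(1), of n] by blast
  then show "\<exists>C. \<forall>x. (1 + norm x) ^ n * norm (f x) \<le> C" unfolding f by (rule rapid)
next
  fix f and b :: 'a assume "\<exists>\<phi>. schwartz \<phi> \<and> f = F \<phi>" and b: "b \<in> Basis"
  then obtain \<phi> where f: "schwartz \<phi>" "f = F \<phi>" by blast
  obtain \<phi>' where "schwartz \<phi>'" "has_pd b \<phi> \<phi>'" using schwartz_pd[OF f(1) b] by blast
  then show "\<exists>g. (\<exists>\<phi>. schwartz \<phi> \<and> g = F \<phi>) \<and> has_pd b f g"
    using pd f(2) by blast
qed (use assms(1) in blast)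

lemma schwartz_cmult: "schwartz \<phi> \<Longrightarrow> schwartz (\<lambda>x. c * \<phi> x)"
proof (erule schwartz_image[where F = "\<lambda>\<phi> x. c * \<phi> x"], goal_cases)
  case (2 \<phi> n C)
  then have "norm c * ((1 + norm x) ^ n * norm (\<phi> x)) \<le> norm c * C" for x
    by (intro mult_left_mono) auto
  then show ?case by (intro exI[of _ "norm c * C"]) (simp add: norm_mult mult_ac)
qed (intro continuous_intros has_pd_cmult, assumption)+

lemma schwartz_diff:
  assumes "schwartz \<phi>" "schwartz \<psi>"
  shows "schwartz (\<lambda>x. \<phi> x - \<psi> x)"
  using schwartz_add[OF assms(1) schwartz_cmult[OF assms(2), of "-1"]] by simp

lemma schwartz_sum: "(\<And>i. i \<in> A \<Longrightarrow> schwartz (f i)) \<Longrightarrow> schwartz (\<lambda>x. \<Sum>i\<in>A. f i x)"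
  by (induction A rule: infinite_finite_induct) (auto simp: schwartz_zero schwartz_add)

text \<open>Products are not closed under differentiation, but finite sums of products are. Taking
  these as the invariant \<open>Q\<close> replaces the Leibniz formula.\<close>

lemma schwartz_mult:
  assumes "schwartz \<phi>" "schwartz \<psi>"
  shows "schwartz (\<lambda>x. \<phi> x * \<psi> x)"
proof -
  define Q where "Q f \<longleftrightarrow> (\<exists>L. (\<forall>(p,q)\<in>set L. schwartz p \<and> schwartz q) \<and> f = (\<lambda>x. \<Sum>(p,q)\<leftarrow>L. p x * q x))"
    for f :: "'a \<Rightarrow> complex"
  have Q_induct: "R f" if "Q f" and z: "R (\<lambda>x. 0)"
    and a: "\<And>p q g. schwartz p \<Longrightarrow> schwartz q \<Longrightarrow> Q g \<Longrightarrow> R g \<Longrightarrow> R (\<lambda>x. p x * q x + g x)"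
    for R :: "('a \<Rightarrow> complex) \<Rightarrow> bool" and f
  proof -
    have "R (\<lambda>x. \<Sum>(p,q)\<leftarrow>L. p x * q x)" if "\<forall>(p,q)\<in>set L. schwartz p \<and> schwartz q" for L
      using that
    proof (induction L)
      case (Cons pq L)
      then have "Q (\<lambda>x. \<Sum>(p,q)\<leftarrow>L. p x * q x)" unfolding Q_def by auto
      with Cons show ?case using a[of "fst pq" "snd pq"] by (cases pq) auto
    qed (use z in auto)
    then show ?thesis using \<open>Q f\<close> unfolding Q_def by blast
  qed
  have Q_Cons: "Q (\<lambda>x. p x * q x + g x)" if pq: "schwartz p" "schwartz q" and "Q g" for p q g :: "'a \<Rightarrow> complex"
  proof -
    obtain L where L: "\<forall>(p,q)\<in>set L. schwartz p \<and> schwartz q" "g = (\<lambda>x. \<Sum>(p,q)\<leftarrow>L. p x * q x)"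
      using \<open>Q g\<close> unfolding Q_def by blast
    then show ?thesis unfolding Q_def by (intro exI[of _ "(p,q) # L"]) (use pq in auto)
  qed
  have Q0: "Q (\<lambda>x. 0)" unfolding Q_def by (intro exI[of _ "[]"]) auto
  show ?thesis
  proof (rule schwartz_coinduct[where P = Q])
    show "Q (\<lambda>x. \<phi> x * \<psi> x)"
      using Q_Cons[OF assms Q0] by simp
    show "continuous_on UNIV f" if "Q f" for f
      using that by (rule Q_induct) (auto intro!: continuous_on_add continuous_on_mult intro: schwartz_continuous)
    show "\<exists>C. \<forall>x. (1 + norm x) ^ n * norm (f x) \<le> C" if "Q f" for f n
      using that
    proof (rule Q_induct)
      fix p q g :: "'a \<Rightarrow> complex" assume pq: "schwartz p" "schwartz q" and "\<exists>C. \<forall>x. (1 + norm x) ^ n * norm (g x) \<le> C"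
      then obtain C where C: "\<And>x. (1 + norm x) ^ n * norm (g x) \<le> C" by blast
      obtain D where D: "D > 0" "\<And>x. (1 + norm x) ^ n * norm (p x) \<le> D" using schwartz_bound[OF pq(1), of n] by blast
      obtain E where E: "E > 0" "\<And>x. (1 + norm x) ^ 0 * norm (q x) \<le> E" using schwartz_bound[OF pq(2), of 0] by blast
      have "(1 + norm x) ^ n * norm (p x * q x + g x) \<le> D * E + C" for x
      proof -
        have "(1 + norm x) ^ n * norm (p x * q x + g x) \<le> (1 + norm x) ^ n * (norm (p x * q x) + norm (g x))"
          by (intro mult_left_mono norm_triangle_ineq) auto
        also have "\<dots> = ((1 + norm x) ^ n * norm (p x)) * norm (q x) + (1 + norm x) ^ n * norm (g x)"
          by (simp add: norm_mult ring_distribs)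
        also have "\<dots> \<le> D * E + C" using C D E by (intro add_mono mult_mono) auto
        finally show ?thesis .
      qed
      then show "\<exists>C. \<forall>x. (1 + norm x) ^ n * norm (p x * q x + g x) \<le> C" by blast
    qed auto
    show "\<exists>g. Q g \<and> has_pd b f g" if f: "Q f" and b: "b \<in> Basis" for f b
      using f
    proof (rule Q_induct)
      show "\<exists>g. Q g \<and> has_pd b (\<lambda>x. 0) g" using Q0 has_pd_const by blast
      fix p q g :: "'a \<Rightarrow> complex" assume pq: "schwartz p" "schwartz q" and "\<exists>h. Q h \<and> has_pd b g h"
      then obtain h where h: "Q h" "has_pd b g h" by blast
      obtain p' where p': "schwartz p'" "has_pd b p p'" using schwartz_pd[OF pq(1) b] by blast
      obtain q' where q': "schwartz q'" "has_pd b q q'" using schwartz_pd[OF pq(2) b] by blast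
      have "has_pd b (\<lambda>x. p x * q x + g x) (\<lambda>x. p' x * q x + (p x * q' x + h x))"
        using has_pd_add[OF has_pd_mult[OF p'(2) q'(2)] h(2)] by (simp add: add.assoc)
      then show "\<exists>h. Q h \<and> has_pd b (\<lambda>x. p x * q x + g x) h"
        by (intro exI conjI) (rule Q_Cons[OF p'(1) pq(2) Q_Cons[OF pq(1) q'(1) h(1)]])
    qed
  qed
qed

text \<open>Submultiplicativity of the weight: it moves from one point to another at the price of a
  weight in their difference. The shift and convolution estimates rest on this.\<close>

lemma weight_shift: "(1 + norm x) ^ n \<le> (1 + norm y) ^ n * (1 + norm (x - y :: 'a::real_normed_vector)) ^ n"
proof -
  have "1 + norm x \<le> 1 + norm y + norm (x - y)"
    using norm_triangle_sub[of x y] by simp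
  also have "\<dots> \<le> (1 + norm y) * (1 + norm (x - y))" by (simp add: ring_distribs)
  finally show ?thesis
    unfolding power_mult_distrib[symmetric] by (intro power_mono) auto
qed

lemma schwartz_shift: "schwartz \<phi> \<Longrightarrow> schwartz (\<lambda>x. \<phi> (x + a))"
proof (erule schwartz_image[where F = "\<lambda>\<phi> x. \<phi> (x + a)"], goal_cases)
  case (1 \<phi>)
  then show ?case by (rule continuous_on_compose2) (auto intro: continuous_intros)
next
  case (2 \<phi> n C)
  have "(1 + norm x) ^ n * norm (\<phi> (x + a)) \<le> C * (1 + norm a) ^ n" for x
  proof -
    have "(1 + norm x) ^ n * norm (\<phi> (x + a)) \<le> ((1 + norm (x + a)) ^ n * (1 + norm a) ^ n) * norm (\<phi> (x + a))"
      using weight_shift[of x n "x + a"] by (intro mult_right_mono) auto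
    also have "\<dots> \<le> C * (1 + norm a) ^ n"
      using mult_right_mono[OF 2(2), of "(1 + norm a) ^ n" "x + a"] by (simp add: mult_ac)
    finally show ?thesis .
  qed
  then show ?case by blast
qed (rule has_pd_shift)

text \<open>Differentiating \<open>?e x * \<phi> x\<close> reproduces the unimodular factor
  \<open>?e\<close>, so the products with this fixed factor form the invariant.\<close>

lemma schwartz_modulate:
  assumes "schwartz \<phi>"
  shows "schwartz (\<lambda>x. exp (\<i> * complex_of_real (x \<bullet> \<xi>)) * \<phi> x)"
proof -
  let ?e = "\<lambda>x. exp (\<i> * complex_of_real (x \<bullet> \<xi>))"
  show ?thesis
  proof (rule schwartz_coinduct[where P = "\<lambda>f. \<exists>\<phi>. schwartz \<phi> \<and> f = (\<lambda>x. ?e x * \<phi> x)"])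
    fix f :: "'a \<Rightarrow> complex" and n assume "\<exists>\<phi>. schwartz \<phi> \<and> f = (\<lambda>x. ?e x * \<phi> x)"
    then obtain \<phi> where f: "schwartz \<phi>" "f = (\<lambda>x. ?e x * \<phi> x)" by blast
    obtain C where "\<And>x. (1 + norm x) ^ n * norm (\<phi> x) \<le> C" using schwartz_bound[OF f(1), of n] by blast
    then show "\<exists>C. \<forall>x. (1 + norm x) ^ n * norm (f x) \<le> C"
      unfolding f by (auto simp: norm_mult)
  next
    fix f :: "'a \<Rightarrow> complex" and b :: 'a
    assume "\<exists>\<phi>. schwartz \<phi> \<and> f = (\<lambda>x. ?e x * \<phi> x)" and b: "b \<in> Basis"
    then obtain \<phi> where f: "schwartz \<phi>" "f = (\<lambda>x. ?e x * \<phi> x)" by blast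
    have "has_pd b f (\<lambda>x. ?e x * ((\<i> * complex_of_real (b \<bullet> \<xi>)) * \<phi> x + pderivs [b] \<phi> x))"
      using has_pd_mult[OF has_pd_exp[OF has_pd_cmult[OF has_pd_inner, of b \<i> \<xi>]] has_pd_schwartz[OF f(1) b]]
      by (simp add: f(2) algebra_simps)
    moreover have "schwartz (\<lambda>x. (\<i> * complex_of_real (b \<bullet> \<xi>)) * \<phi> x + pderivs [b] \<phi> x)"
      using b by (intro schwartz_add schwartz_cmult schwartz_pderivs f) auto
    ultimately show "\<exists>g. (\<exists>\<phi>. schwartz \<phi> \<and> g = (\<lambda>x. ?e x * \<phi> x)) \<and> has_pd b f g"
      by blast
  qed (use assms in \<open>auto intro!: continuous_intros intro: schwartz_continuous\<close>)
qed

lemma has_pd_cnj: "has_pd b f f' \<Longrightarrow> has_pd b (\<lambda>x. cnj (f x)) (\<lambda>x. cnj (f' x))"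
  by (auto simp: has_pd_def intro: has_vector_derivative_cnj)

lemma schwartz_cnj: "schwartz \<phi> \<Longrightarrow> schwartz (\<lambda>x. cnj (\<phi> x))"
  by (erule schwartz_image[where F = "\<lambda>\<phi> x. cnj (\<phi> x)"]) (auto intro: has_pd_cnj continuous_on_cnj)

section \<open>Iterated partial derivatives of sums, multiples and translates\<close>

lemma pderivs_add:
  assumes "schwartz \<phi>" "schwartz \<psi>" "set bs \<subseteq> Basis"
  shows "pderivs bs (\<lambda>x. \<phi> x + \<psi> x) = (\<lambda>x. pderivs bs \<phi> x + pderivs bs \<psi> x)"
  using assms(3)
proof (induction bs)
  case (Cons b bs)
  then show ?case
    using has_pd_add[OF has_pd_pderivs[OF assms(1), of bs b] has_pd_pderivs[OF assms(2), of bs b]]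
    by (intro pderivs_Cons_eq) auto
qed auto

lemma pderivs_cmult:
  assumes "schwartz \<phi>" "set bs \<subseteq> Basis"
  shows "pderivs bs (\<lambda>x. c * \<phi> x) = (\<lambda>x. c * pderivs bs \<phi> x)"
  using assms(2)
proof (induction bs)
  case (Cons b bs)
  then show ?case
    using has_pd_cmult[OF has_pd_pderivs[OF assms(1), of bs b], of c]
    by (intro pderivs_Cons_eq) auto
qed auto

lemma pderivs_diff:
  assumes "schwartz \<phi>" "schwartz \<psi>" "set bs \<subseteq> Basis"
  shows "pderivs bs (\<lambda>x. \<phi> x - \<psi> x) = (\<lambda>x. pderivs bs \<phi> x - pderivs bs \<psi> x)"
  using pderivs_add[OF assms(1) schwartz_cmult[OF assms(2), of "-1"] assms(3)]
    pderivs_cmult[OF assms(2,3), of "-1"] by simp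

lemma pderivs_zero: "pderivs bs (\<lambda>x. 0) = (\<lambda>x. 0)"
  by (induction bs) (auto intro!: pderivs_Cons_eq simp del: pderivs.simps(2) simp: has_pd_const)

lemma pderivs_sum:
  assumes "\<And>i. i \<in> A \<Longrightarrow> schwartz (f i)" "set bs \<subseteq> Basis"
  shows "pderivs bs (\<lambda>x. \<Sum>i\<in>A. f i x) = (\<lambda>x. \<Sum>i\<in>A. pderivs bs (f i) x)"
  using assms
  by (induction A rule: infinite_finite_induct) (auto simp: pderivs_zero pderivs_add schwartz_sum)

lemma pderivs_shift:
  assumes "schwartz \<phi>" "set bs \<subseteq> Basis"
  shows "pderivs bs (\<lambda>x. \<phi> (x + a)) = (\<lambda>x. pderivs bs \<phi> (x + a))"
  using assms(2)
proof (induction bs)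
  case (Cons b bs)
  then show ?case
    using has_pd_shift[OF has_pd_pderivs[OF assms(1), of bs b], of a]
    by (intro pderivs_Cons_eq) auto
qed auto

section \<open>Tempered distributions along Gaussian families\<close>

text \<open>Polynomials in \<open>x\<close> whose coefficients are bounded functions of the index,
  which keeps all growth bounds uniform. The factor \<open>t\<close> that appears on differentiating
  \<open>exp (t A)\<close> counts as such a coefficient.\<close>

inductive poly_family :: "'i set \<Rightarrow> ('i \<Rightarrow> 'a::euclidean_space \<Rightarrow> complex) \<Rightarrow> bool" for I where
  const: "(\<And>i. i \<in> I \<Longrightarrow> norm (c i) \<le> C) \<Longrightarrow> poly_family I (\<lambda>i x. c i)"
| coord: "poly_family I (\<lambda>i x. complex_of_real (x \<bullet> v))"
| add: "poly_family I p \<Longrightarrow> poly_family I q \<Longrightarrow> poly_family I (\<lambda>i x. p i x + q i x)"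
| mult: "poly_family I p \<Longrightarrow> poly_family I q \<Longrightarrow> poly_family I (\<lambda>i x. p i x * q i x)"

text \<open>The dummy index set is the whole real line, so \<open>poly_family_mono\<close> restricts
  a fixed polynomial to the parameter set \<open>I\<close> of \<open>exp_family\<close>.\<close>

abbreviation polyfun :: "('a::euclidean_space \<Rightarrow> complex) \<Rightarrow> bool" where
  "polyfun p \<equiv> poly_family (UNIV :: real set) (\<lambda>_. p)"

lemma poly_family_mono: "poly_family J p \<Longrightarrow> I \<subseteq> J \<Longrightarrow> poly_family I p"
  by (induction rule: poly_family.induct) (auto intro!: poly_family.intros)

lemma poly_family_constant: "poly_family I (\<lambda>i x. c)"
  by (rule poly_family.const[where C = "norm c"]) simp

lemma poly_family_sum: "(\<And>j. j \<in> A \<Longrightarrow> poly_family I (p j)) \<Longrightarrow> poly_family I (\<lambda>i x. \<Sum>j\<in>A. p j i x)"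
proof (induction A rule: infinite_finite_induct)
  case (insert j A)
  then show ?case using poly_family.add[of I "p j" "\<lambda>i x. \<Sum>j\<in>A. p j i x"] by simp
qed (auto intro: poly_family_constant)

lemma poly_family_continuous: "poly_family I p \<Longrightarrow> continuous_on UNIV (p i)"
  by (induction rule: poly_family.induct) (auto intro!: continuous_intros)

lemma poly_family_growth:
  "poly_family I p \<Longrightarrow> \<exists>C n. C \<ge> 0 \<and> (\<forall>i\<in>I. \<forall>x. norm (p i x) \<le> C * (1 + norm x) ^ n)"
proof (induction rule: poly_family.induct)
  case (const c C)
  then have "norm (c i) \<le> \<bar>C\<bar>" if "i \<in> I" for i using that by (metis abs_ge_self order_trans)
  then show ?case by (intro exI[of _ "\<bar>C\<bar>"] exI[of _ 0]) auto
next
  case (coord v)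
  have "\<bar>x \<bullet> v\<bar> \<le> norm v * (1 + norm x) ^ 1" for x
    using Cauchy_Schwarz_ineq2[of x v] by (simp add: algebra_simps add_increasing)
  then show ?case by (intro exI[of _ "norm v"] exI[of _ 1]) auto
next
  case (add p q)
  then obtain C n D m where CD: "C \<ge> 0" "D \<ge> 0" "\<And>i x. i \<in> I \<Longrightarrow> norm (p i x) \<le> C * (1 + norm x) ^ n"
    "\<And>i x. i \<in> I \<Longrightarrow> norm (q i x) \<le> D * (1 + norm x) ^ m" by blast
  have "norm (p i x + q i x) \<le> (C + D) * (1 + norm x) ^ (n + m)" if "i \<in> I" for i x
  proof -
    have "norm (p i x + q i x) \<le> C * (1 + norm x) ^ n + D * (1 + norm x) ^ m"
      by (intro norm_triangle_mono CD that)
    also have "\<dots> \<le> C * (1 + norm x) ^ (n + m) + D * (1 + norm x) ^ (n + m)"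
      by (intro add_mono mult_left_mono power_increasing CD) auto
    finally show ?thesis by (simp add: ring_distribs)
  qed
  then show ?case using CD by (intro exI[of _ "C + D"] exI[of _ "n + m"]) auto
next
  case (mult p q)
  then obtain C n D m where CD: "C \<ge> 0" "D \<ge> 0" "\<And>i x. i \<in> I \<Longrightarrow> norm (p i x) \<le> C * (1 + norm x) ^ n"
    "\<And>i x. i \<in> I \<Longrightarrow> norm (q i x) \<le> D * (1 + norm x) ^ m" by blast
  have "norm (p i x * q i x) \<le> (C * D) * (1 + norm x) ^ (n + m)" if "i \<in> I" for i x
    using mult_mono[OF CD(3)[OF that, of x] CD(4)[OF that, of x]] CD
    by (simp add: norm_mult power_add mult_ac)
  then show ?case using CD by (intro exI[of _ "C * D"] exI[of _ "n + m"]) auto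
qed

lemma poly_family_pd:
  "poly_family I p \<Longrightarrow> \<exists>q. poly_family I q \<and> (\<forall>i. has_pd b (p i) (q i))"
proof (induction rule: poly_family.induct)
  case (const c C)
  show ?case by (intro exI[of _ "\<lambda>i x. 0"]) (auto intro: has_pd_const poly_family_constant)
next
  case (coord v)
  show ?case
    by (intro exI[of _ "\<lambda>i x. complex_of_real (b \<bullet> v)"]) (auto intro: has_pd_inner poly_family_constant)
next
  case (add p q)
  then obtain p' q' where "poly_family I p'" "poly_family I q'"
    "\<And>i. has_pd b (p i) (p' i)" "\<And>i. has_pd b (q i) (q' i)" by blast
  then show ?case
    by (intro exI[of _ "\<lambda>i x. p' i x + q' i x"] conjI allI has_pd_add poly_family.add)
next
  case (mult p q)
  then obtain p' q' where "poly_family I p'" "poly_family I q'"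
    "\<And>i. has_pd b (p i) (p' i)" "\<And>i. has_pd b (q i) (q' i)" by blast
  with mult.hyps show ?case
    by (intro exI[of _ "\<lambda>i x. p' i x * q i x + p i x * q' i x"] conjI allI has_pd_mult poly_family.add poly_family.mult)
qed

section \<open>Linearity and continuity of tempered distributions\<close>

lemma tempered_add: "tempered T \<Longrightarrow> schwartz \<phi> \<Longrightarrow> schwartz \<psi> \<Longrightarrow> T (\<lambda>x. \<phi> x + \<psi> x) = T \<phi> + T \<psi>"
  by (simp add: tempered_def)

lemma tempered_cmult: "tempered T \<Longrightarrow> schwartz \<phi> \<Longrightarrow> T (\<lambda>x. c * \<phi> x) = c * T \<phi>"
  by (simp add: tempered_def)

lemma tempered_diff:
  assumes "tempered T" "schwartz \<phi>" "schwartz \<psi>"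
  shows "T (\<lambda>x. \<phi> x - \<psi> x) = T \<phi> - T \<psi>"
  using tempered_add[OF assms(1,2) schwartz_cmult[OF assms(3), of "-1"]] tempered_cmult[OF assms(1,3), of "-1"]
  by simp

lemma tempered_zero: "tempered T \<Longrightarrow> T (\<lambda>x. 0) = 0"
  using tempered_cmult[OF _ schwartz_zero, of T 0] by simp

lemma tempered_sum:
  assumes "tempered T" "\<And>i. i \<in> A \<Longrightarrow> schwartz (f i)"
  shows "T (\<lambda>x. \<Sum>i\<in>A. f i x) = (\<Sum>i\<in>A. T (f i))"
  using assms(2)
proof (induction A rule: infinite_finite_induct)
  case (insert j A)
  then show ?case by (simp add: tempered_add[OF assms(1)] schwartz_sum)
qed (auto simp: tempered_zero[OF assms(1)])

lemma schwartz_seminorm_nonneg: "schwartz \<phi> \<Longrightarrow> 0 \<le> schwartz_seminorm N \<phi>"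
  using norm_pderivs_le_seminorm[of \<phi> "[]" N 0] by (auto intro: order_trans[rotated])

lemma tempered_bound:
  assumes "tempered T"
  obtains C N where "C > 0" "\<And>\<phi>. schwartz \<phi> \<Longrightarrow> norm (T \<phi>) \<le> C * schwartz_seminorm N \<phi>"
proof -
  obtain C N where CN: "\<And>\<phi>. schwartz \<phi> \<Longrightarrow> norm (T \<phi>) \<le> C * schwartz_seminorm N \<phi>"
    using assms unfolding tempered_def by blast
  have "norm (T \<phi>) \<le> (\<bar>C\<bar> + 1) * schwartz_seminorm N \<phi>" if "schwartz \<phi>" for \<phi>
    using CN[OF that] mult_right_mono[OF _ schwartz_seminorm_nonneg[OF that], of C "\<bar>C\<bar> + 1" N]
    by linarith
  then show ?thesis by (intro that[of "\<bar>C\<bar> + 1" N]) auto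
qed

lemma norm_exp_minus_one_le: "norm (exp z - 1) \<le> norm z * exp (norm z)" for z :: complex
  using Taylor_exp_field[of z 0] by (simp add: mult.commute)

lemma norm_exp_minus_linear_le: "norm (exp z - 1 - z) \<le> (norm z)\<^sup>2 * exp (norm z)" for z :: complex
  using Taylor_exp_field[of z 1] by (simp add: power2_eq_square algebra_simps)

lemma has_vector_derivative_at_0_iff:
  fixes f :: "real \<Rightarrow> 'b::real_normed_vector"
  shows "(f has_vector_derivative L) (at 0) \<longleftrightarrow> ((\<lambda>t. (f t - f 0) /\<^sub>R t) \<longlongrightarrow> L) (at 0)"
proof -
  have "norm (f t - f 0 - t *\<^sub>R L) / \<bar>t\<bar> = norm ((f t - f 0) /\<^sub>R t - L)" if "t \<noteq> 0" for t
  proof -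
    have "(f t - f 0) /\<^sub>R t - L = (f t - f 0 - t *\<^sub>R L) /\<^sub>R t" using that by (simp add: scaleR_diff_right)
    then show ?thesis by (simp add: divide_inverse mult.commute)
  qed
  then have "((\<lambda>t. norm (f t - f 0 - t *\<^sub>R L) / \<bar>t\<bar>) \<longlongrightarrow> 0) (at 0) \<longleftrightarrow>
      ((\<lambda>t. norm ((f t - f 0) /\<^sub>R t - L)) \<longlongrightarrow> 0) (at 0)"
    by (intro filterlim_cong) (auto simp: eventually_at_filter)
  then show ?thesis
    by (simp add: has_vector_derivative_def has_derivative_iff_norm bounded_linear_scaleR_left
        tendsto_norm_zero_iff LIM_zero_iff)
qed

text \<open>The functions \<open>exp (t A)\<close> and its first two difference quotients \<open>E1\<close>, \<open>E2\<close>, times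
  \<open>exp Q\<close> and with polynomial coefficients, are closed under partial derivatives, which makes \<open>E2\<close> bounded in
  every Schwartz seminorm uniformly in \<open>t\<close>.\<close>
locale exp_family =
  fixes A Q :: "'a::euclidean_space \<Rightarrow> complex" and t0 :: real
  assumes A: "polyfun A" and Q: "polyfun Q" and t0: "t0 > 0"
    and decay: "\<And>n. \<exists>C. \<forall>x. (1 + norm x) ^ n * (norm (exp (Q x)) * exp (t0 * norm (A x))) \<le> C"
begin

text \<open>Zero is excluded because \<open>E1\<close> and \<open>E2\<close> divide by powers of
  \<open>t\<close>; the bound \<open>t0\<close> is what \<open>decay\<close> can absorb.\<close>

definition I :: "real set" where "I = {t. 0 < \<bar>t\<bar> \<and> \<bar>t\<bar> < t0}"
definition E0 :: "real \<Rightarrow> 'a \<Rightarrow> complex" where "E0 t x = exp (of_real t * A x)"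
definition E1 :: "real \<Rightarrow> 'a \<Rightarrow> complex" where "E1 t x = (exp (of_real t * A x) - 1) / of_real t"
definition E2 :: "real \<Rightarrow> 'a \<Rightarrow> complex" where
  "E2 t x = (exp (of_real t * A x) - 1 - of_real t * A x) / (of_real t)\<^sup>2"

definition Fam :: "(real \<Rightarrow> 'a \<Rightarrow> complex) \<Rightarrow> (real \<Rightarrow> 'a \<Rightarrow> complex) \<Rightarrow> (real \<Rightarrow> 'a \<Rightarrow> complex) \<Rightarrow> real \<Rightarrow> 'a \<Rightarrow> complex"
  where "Fam p0 p1 p2 = (\<lambda>t x. (p0 t x * E0 t x + p1 t x * E1 t x + p2 t x * E2 t x) * exp (Q x))"

definition X :: "(real \<Rightarrow> 'a \<Rightarrow> complex) set" where
  "X = {Fam p0 p1 p2 | p0 p1 p2. poly_family I p0 \<and> poly_family I p1 \<and> poly_family I p2}"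

lemma contA: "continuous_on UNIV A" and contQ: "continuous_on UNIV Q"
  using poly_family_continuous[OF A] poly_family_continuous[OF Q] by auto

lemma rapid_product:
  assumes p: "poly_family I p" and q: "poly_family I q" and E: "\<And>t x. t \<in> I \<Longrightarrow> norm (E t x) \<le> norm (q t x) * exp (t0 * norm (A x))"
  shows "\<exists>C. \<forall>t\<in>I. \<forall>x. (1 + norm x) ^ n * norm (p t x * E t x * exp (Q x)) \<le> C"
proof -
  obtain C m where C: "C \<ge> 0" "\<And>t x. t \<in> I \<Longrightarrow> norm (p t x * q t x) \<le> C * (1 + norm x) ^ m"
    using poly_family_growth[OF poly_family.mult[OF p q]] by blast
  obtain D where D: "\<And>x. (1 + norm x) ^ (n + m) * (norm (exp (Q x)) * exp (t0 * norm (A x))) \<le> D"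
    using decay by blast
  have "(1 + norm x) ^ n * norm (p t x * E t x * exp (Q x)) \<le> C * D" if "t \<in> I" for t x
  proof -
    have "norm (p t x * E t x * exp (Q x)) \<le> norm (p t x) * (norm (q t x) * exp (t0 * norm (A x))) * norm (exp (Q x))"
      unfolding norm_mult by (intro mult_right_mono mult_left_mono E that) auto
    also have "\<dots> = norm (p t x * q t x) * (norm (exp (Q x)) * exp (t0 * norm (A x)))"
      by (simp add: norm_mult)
    also have "\<dots> \<le> C * (1 + norm x) ^ m * (norm (exp (Q x)) * exp (t0 * norm (A x)))"
      by (intro mult_right_mono C that) auto
    finally have "(1 + norm x) ^ n * norm (p t x * E t x * exp (Q x)) \<le>
        (1 + norm x) ^ n * (C * (1 + norm x) ^ m * (norm (exp (Q x)) * exp (t0 * norm (A x))))"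
      by (intro mult_left_mono) auto
    also have "\<dots> = C * ((1 + norm x) ^ (n + m) * (norm (exp (Q x)) * exp (t0 * norm (A x))))"
      by (simp add: power_add mult_ac)
    also have "\<dots> \<le> C * D" by (intro mult_left_mono D C)
    finally show ?thesis .
  qed
  then show ?thesis by blast
qed

lemma exp_tA_le: "t \<in> I \<Longrightarrow> exp (norm (of_real t * A x)) \<le> exp (t0 * norm (A x))"
  by (auto simp: I_def norm_mult intro!: mult_right_mono)

lemma E0_le: "t \<in> I \<Longrightarrow> norm (E0 t x) \<le> norm (1::complex) * exp (t0 * norm (A x))"
  using exp_tA_le[of t x] norm_exp[of "of_real t * A x"] by (simp add: E0_def)

lemma E1_le: assumes "t \<in> I" shows "norm (E1 t x) \<le> norm (A x) * exp (t0 * norm (A x))"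
proof -
  have "norm (E1 t x) \<le> (norm (of_real t * A x) * exp (norm (of_real t * A x))) / \<bar>t\<bar>"
    unfolding E1_def norm_divide using norm_exp_minus_one_le by (auto intro!: divide_right_mono)
  also have "\<dots> = norm (A x) * exp (norm (of_real t * A x))"
    using assms by (simp add: I_def norm_mult)
  also have "\<dots> \<le> norm (A x) * exp (t0 * norm (A x))"
    by (intro mult_left_mono exp_tA_le assms) auto
  finally show ?thesis .
qed

lemma E2_le: assumes "t \<in> I" shows "norm (E2 t x) \<le> norm (A x * A x) * exp (t0 * norm (A x))"
proof -
  have "norm (E2 t x) \<le> ((norm (of_real t * A x))\<^sup>2 * exp (norm (of_real t * A x))) / \<bar>t\<bar>\<^sup>2"
    unfolding E2_def norm_divide using norm_exp_minus_linear_le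
    by (auto intro!: divide_right_mono simp: norm_power)
  also have "\<dots> = norm (A x * A x) * exp (norm (of_real t * A x))"
    using assms by (simp add: I_def norm_mult power_mult_distrib) (simp add: power2_eq_square)
  also have "\<dots> \<le> norm (A x * A x) * exp (t0 * norm (A x))"
    by (intro mult_left_mono exp_tA_le assms) auto
  finally show ?thesis .
qed

text \<open>The reason for using three functions: \<open>E0' = t A' E0\<close>,
  \<open>E1' = A' E0\<close> and \<open>E2' = A' E1\<close>. Differentiation lowers the order of the
  quotient and creates no negative power of \<open>t\<close>, so all coefficients stay bounded on
  \<open>I\<close>.\<close>

lemma derivative_closed_X: "derivative_closed I X"
  unfolding derivative_closed_def
proof (intro ballI conjI)
  fix \<Phi> assume "\<Phi> \<in> X"
  then obtain p0 p1 p2 where \<Phi>: "\<Phi> = Fam p0 p1 p2"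
    and p: "poly_family I p0" "poly_family I p1" "poly_family I p2" unfolding X_def by blast
  have AI: "poly_family I (\<lambda>_. A)" and QI: "poly_family I (\<lambda>_. Q)"
    using poly_family_mono A Q by blast+
  show "continuous_on UNIV (\<Phi> t)" if "t \<in> I" for t
    unfolding \<Phi> Fam_def E0_def E1_def E2_def
    using that p[THEN poly_family_continuous] contA contQ
    by (auto simp: I_def intro!: continuous_intros)
  show "rapid_family I \<Phi>"
    unfolding rapid_family_def
  proof
    fix n
    obtain C0 where C0: "\<forall>t\<in>I. \<forall>x. (1 + norm x) ^ n * norm (p0 t x * E0 t x * exp (Q x)) \<le> C0"
      using rapid_product[OF p(1) poly_family_constant[of I 1], of E0 n] E0_le by blast
    obtain C1 where C1: "\<forall>t\<in>I. \<forall>x. (1 + norm x) ^ n * norm (p1 t x * E1 t x * exp (Q x)) \<le> C1"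
      using rapid_product[OF p(2) AI, of E1 n] E1_le by blast
    obtain C2 where C2: "\<forall>t\<in>I. \<forall>x. (1 + norm x) ^ n * norm (p2 t x * E2 t x * exp (Q x)) \<le> C2"
      using rapid_product[OF p(3) poly_family.mult[OF AI AI], of E2 n] E2_le by blast
    have "(1 + norm x) ^ n * norm (\<Phi> t x) \<le> C0 + C1 + C2" if "t \<in> I" for t x
    proof -
      have "norm (\<Phi> t x) \<le> norm (p0 t x * E0 t x * exp (Q x)) + norm (p1 t x * E1 t x * exp (Q x))
          + norm (p2 t x * E2 t x * exp (Q x))"
        unfolding \<Phi> Fam_def ring_distribs by (intro norm_triangle_mono order_refl)
      then have "(1 + norm x) ^ n * norm (\<Phi> t x) \<le> (1 + norm x) ^ n * (norm (p0 t x * E0 t x * exp (Q x)) +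
          norm (p1 t x * E1 t x * exp (Q x)) + norm (p2 t x * E2 t x * exp (Q x)))"
        by (intro mult_left_mono) auto
      also have "\<dots> \<le> C0 + C1 + C2"
        unfolding ring_distribs using C0 C1 C2 that by (intro add_mono) auto
      finally show ?thesis .
    qed
    then show "\<exists>C. \<forall>t\<in>I. \<forall>x. (1 + norm x) ^ n * norm (\<Phi> t x) \<le> C" by blast
  qed
  fix b :: 'a assume "b \<in> Basis"
  obtain p0' p1' p2' A' Q' where d: "poly_family I p0'" "poly_family I p1'" "poly_family I p2'"
      "poly_family I A'" "poly_family I Q'"
    and pd: "\<And>t. has_pd b (p0 t) (p0' t)" "\<And>t. has_pd b (p1 t) (p1' t)" "\<And>t. has_pd b (p2 t) (p2' t)"
      "\<And>t. has_pd b A (A' t)" "\<And>t. has_pd b Q (Q' t)"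
    using p[THEN poly_family_pd[where b = b]] poly_family_pd[OF AI, where b = b] poly_family_pd[OF QI, where b = b]
    by blast
  have tI: "poly_family I (\<lambda>t x. complex_of_real t)"
    by (rule poly_family.const[where C = t0]) (auto simp: I_def)
  have E0': "has_pd b (E0 t) (\<lambda>x. of_real t * A' t x * E0 t x)" for t
    using has_pd_exp[OF has_pd_cmult[OF pd(4)[of t], of "of_real t"]] by (simp add: E0_def[abs_def])
  have E1': "has_pd b (E1 t) (\<lambda>x. A' t x * E0 t x)" if "t \<in> I" for t
    using has_pd_cmult[OF has_pd_add[OF E0'[of t] has_pd_const[of b "-1"]], of "1 / of_real t"] that
    by (simp add: E1_def[abs_def] E0_def I_def diff_divide_distrib)
  have E2': "has_pd b (E2 t) (\<lambda>x. A' t x * E1 t x)" if "t \<in> I" for t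
  proof -
    have 1: "E2 t = (\<lambda>x. 1 / (of_real t)\<^sup>2 * (E0 t x + - 1 + - of_real t * A x))"
      by (simp add: E2_def[abs_def] E0_def)
    have 2: "(\<lambda>x. A' t x * E1 t x) = (\<lambda>x. 1 / (of_real t)\<^sup>2 * (of_real t * A' t x * E0 t x + 0 + - of_real t * A' t x))"
      using that by (auto simp: E1_def E0_def I_def field_simps power2_eq_square)
    show ?thesis unfolding 2 unfolding 1
      by (intro has_pd_cmult has_pd_add E0' has_pd_const pd)
  qed
  \<comment> \<open>The terms of the product rule, sorted by whether they multiply
    \<open>E0\<close>, \<open>E1\<close> or \<open>E2\<close>.\<close>
  define q0 where "q0 t x = p0' t x + p0 t x * (of_real t * A' t x) + p0 t x * Q' t x + p1 t x * A' t x" for t x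
  define q1 where "q1 t x = p1' t x + p1 t x * Q' t x + p2 t x * A' t x" for t x
  define q2 where "q2 t x = p2' t x + p2 t x * Q' t x" for t x
  have "has_pd b (\<Phi> t) (Fam q0 q1 q2 t)" if "t \<in> I" for t
  proof -
    have eq: "Fam q0 q1 q2 t = (\<lambda>x. (((p0' t x * E0 t x + p0 t x * (of_real t * A' t x * E0 t x)) +
           (p1' t x * E1 t x + p1 t x * (A' t x * E0 t x))) +
           (p2' t x * E2 t x + p2 t x * (A' t x * E1 t x))) * exp (Q x) +
           (p0 t x * E0 t x + p1 t x * E1 t x + p2 t x * E2 t x) * (Q' t x * exp (Q x)))"
      unfolding Fam_def q0_def q1_def q2_def by (intro ext) (simp add: algebra_simps)
    show ?thesis
      unfolding \<Phi> eq unfolding Fam_def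
      by (intro has_pd_mult has_pd_add has_pd_exp pd E0' E1' E2' that)
  qed
  moreover have "Fam q0 q1 q2 \<in> X"
    unfolding X_def q0_def[abs_def] q1_def[abs_def] q2_def[abs_def] using p d tI
    by (auto intro!: exI conjI poly_family.add poly_family.mult)
  ultimately show "\<exists>\<Psi>\<in>X. \<forall>t\<in>I. has_pd b (\<Phi> t) (\<Psi> t)" by blast
qed

lemma schwartz_exp_tA:
  assumes "polyfun P" "t \<in> I"
  shows "schwartz (\<lambda>x. P x * exp (of_real t * A x) * exp (Q x))"
proof -
  have "Fam (\<lambda>_. P) (\<lambda>_ _. 0) (\<lambda>_ _. 0) \<in> X"
    unfolding X_def using poly_family_mono[OF assms(1)] poly_family_constant by blast
  from derivative_closed_schwartz[OF derivative_closed_X this assms(2)] show ?thesis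
    by (simp add: Fam_def E0_def)
qed

text \<open>In \<open>exp (t A) = 1 + t A + t\<^sup>2 E2\<close> the distribution is bounded on the
  remainder family uniformly in \<open>t\<close>, so the difference quotient misses the claimed
  derivative by at most a constant times \<open>\<bar>t\<bar>\<close>.\<close>

lemma tempered_exp_family_derivative:
  assumes T: "tempered T" and P: "polyfun P"
    and S: "schwartz (\<lambda>x. P x * exp (Q x))" "schwartz (\<lambda>x. A x * P x * exp (Q x))"
  shows "((\<lambda>t. T (\<lambda>x. P x * exp (of_real t * A x) * exp (Q x))) has_vector_derivative
           T (\<lambda>x. A x * P x * exp (Q x))) (at 0)"
proof -
  let ?R = "Fam (\<lambda>_ _. 0) (\<lambda>_ _. 0) (\<lambda>_. P)"
  have RX: "?R \<in> X"
    unfolding X_def using poly_family_mono[OF P] poly_family_constant by blast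
  obtain C N where C: "C > 0" "\<And>\<phi>. schwartz \<phi> \<Longrightarrow> norm (T \<phi>) \<le> C * schwartz_seminorm N \<phi>"
    using tempered_bound[OF T] by blast
  obtain D where D: "\<forall>t\<in>I. schwartz_seminorm N (?R t) \<le> D"
    using derivative_closed_seminorm_bounded[OF derivative_closed_X RX] by blast
  have R: "schwartz (?R t)" "norm (T (?R t)) \<le> C * D" if "t \<in> I" for t
  proof -
    show "schwartz (?R t)" by (rule derivative_closed_schwartz[OF derivative_closed_X RX that])
    then have "norm (T (?R t)) \<le> C * schwartz_seminorm N (?R t)" by (rule C)
    also have "\<dots> \<le> C * D" using D that C(1) by (intro mult_left_mono) auto
    finally show "norm (T (?R t)) \<le> C * D" .
  qed
  let ?f = "\<lambda>t. T (\<lambda>x. P x * exp (of_real t * A x) * exp (Q x))"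
  let ?L = "T (\<lambda>x. A x * P x * exp (Q x))"
  have eq: "?f t = ?f 0 + of_real t * ?L + (of_real t)\<^sup>2 * T (?R t)" if "t \<in> I" for t
  proof -
    have "(\<lambda>x. P x * exp (of_real t * A x) * exp (Q x)) =
        (\<lambda>x. (P x * exp (Q x) + of_real t * (A x * P x * exp (Q x))) + (of_real t)\<^sup>2 * ?R t x)"
      using that by (intro ext) (simp add: Fam_def E2_def I_def field_simps)
    then have "?f t = T (\<lambda>x. (P x * exp (Q x) + of_real t * (A x * P x * exp (Q x))) + (of_real t)\<^sup>2 * ?R t x)"
      by simp
    also have "\<dots> = T (\<lambda>x. P x * exp (Q x)) + of_real t * ?L + (of_real t)\<^sup>2 * T (?R t)"
      using S R(1)[OF that] by (simp add: tempered_add[OF T] tempered_cmult[OF T] schwartz_add schwartz_cmult)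
    finally show ?thesis by simp
  qed
  have "((\<lambda>t. (?f t - ?f 0) /\<^sub>R t) \<longlongrightarrow> ?L) (at 0)"
  proof (rule Lim_transform)
    show "((\<lambda>t. ?L) \<longlongrightarrow> ?L) (at 0)" by simp
    have ev: "eventually (\<lambda>t. t \<in> I) (at 0)"
      unfolding eventually_at I_def using t0 by (intro exI[of _ t0]) (auto simp: dist_real_def)
    show "((\<lambda>t. (?f t - ?f 0) /\<^sub>R t - ?L) \<longlongrightarrow> 0) (at 0)"
    proof (rule tendsto_0_le[where K = 1])
      show "((\<lambda>t. t * (C * D)) \<longlongrightarrow> 0) (at 0)" by (auto intro!: tendsto_eq_intros)
      show "\<forall>\<^sub>F t in at 0. norm ((?f t - ?f 0) /\<^sub>R t - ?L) \<le> norm (t * (C * D)) * 1"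
        using ev
      proof eventually_elim
        case (elim t)
        have "(?f t - ?f 0) /\<^sub>R t - ?L = of_real t * T (?R t)"
          using elim unfolding eq[OF elim] by (simp add: I_def scaleR_conv_of_real field_simps power2_eq_square)
        then show ?case
          using mult_left_mono[OF order_trans[OF R(2)[OF elim] abs_ge_self], of "\<bar>t\<bar>"]
          by (simp add: norm_mult abs_mult)
      qed
    qed
  qed
  then show ?thesis
    by (simp add: has_vector_derivative_at_0_iff)
qed

end


section \<open>Polynomials times Gaussians as test functions\<close>

definition gaussian :: "real \<Rightarrow> 'a::euclidean_space \<Rightarrow> 'a \<Rightarrow> complex" where
  "gaussian a v x = exp (complex_of_real (- a / 2 * (x \<bullet> x) + x \<bullet> v))"

text \<open>By \<open>1 + r \<le> exp r\<close> the weight only changes the linear coefficient from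
  \<open>\<beta>\<close> to \<open>\<beta> + n\<close>; completing the square gives the
  bound.\<close>

lemma weight_exp_quadratic_bounded:
  fixes \<alpha> \<beta> :: real
  assumes "\<alpha> > 0"
  shows "\<exists>C. \<forall>r\<ge>0. (1 + r) ^ n * exp (- \<alpha> * r\<^sup>2 + \<beta> * r + \<gamma>) \<le> C"
proof (intro exI allI impI)
  fix r :: real assume r: "r \<ge> 0"
  have "(1 + r) ^ n \<le> exp (real n * r)"
    using power_mono[OF exp_ge_add_one_self, of r n] r by (simp add: exp_of_nat_mult)
  then have "(1 + r) ^ n * exp (- \<alpha> * r\<^sup>2 + \<beta> * r + \<gamma>) \<le> exp (real n * r) * exp (- \<alpha> * r\<^sup>2 + \<beta> * r + \<gamma>)"
    by (intro mult_right_mono) auto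
  also have "\<dots> = exp (- \<alpha> * r\<^sup>2 + (\<beta> + n) * r + \<gamma>)"
    by (simp add: exp_add[symmetric] algebra_simps)
  also have "\<dots> \<le> exp ((\<beta> + n)\<^sup>2 / (4 * \<alpha>) + \<gamma>)"
  proof -
    have "0 \<le> \<alpha> * (r - (\<beta> + n) / (2 * \<alpha>))\<^sup>2" using assms by simp
    also have "\<dots> = \<alpha> * r\<^sup>2 - (\<beta> + n) * r + (\<beta> + n)\<^sup>2 / (4 * \<alpha>)"
      using assms by (simp add: power2_eq_square field_simps)
    finally show ?thesis by simp
  qed
  finally show "(1 + r) ^ n * exp (- \<alpha> * r\<^sup>2 + \<beta> * r + \<gamma>) \<le> exp ((\<beta> + n)\<^sup>2 / (4 * \<alpha>) + \<gamma>)" .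
qed

lemma polyfun_inner_self: "polyfun (\<lambda>x::'a::euclidean_space. complex_of_real (x \<bullet> x))"
proof -
  have "(\<lambda>x::'a. complex_of_real (x \<bullet> x)) = (\<lambda>x. \<Sum>b\<in>Basis. complex_of_real (x \<bullet> b) * complex_of_real (x \<bullet> b))"
    by (subst euclidean_inner) simp
  then show ?thesis
    by (auto intro!: poly_family_sum poly_family.mult poly_family.coord)
qed

lemma polyfun_gaussian_exponent: "polyfun (\<lambda>x. complex_of_real (- a / 2 * (x \<bullet> x) + x \<bullet> v))"
  using poly_family.add[OF poly_family.mult[OF poly_family_constant[of _ "of_real (- a / 2)"] polyfun_inner_self]
      poly_family.coord[of UNIV v]] by simp

lemma exp_family_gaussian:
  fixes A :: "'a::euclidean_space \<Rightarrow> complex"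
  assumes "a > 0" "polyfun A" and K: "\<And>x. norm (A x) \<le> K * (1 + norm x)\<^sup>2"
  shows "\<exists>t0. exp_family A (\<lambda>x. complex_of_real (- a / 2 * (x \<bullet> x) + x \<bullet> v)) t0"
proof -
  have K0: "K \<ge> 0" using K[of 0] norm_ge_zero[of "A 0"] by (simp del: norm_ge_zero)
  \<comment> \<open>With this choice \<open>t0 * norm (A x)\<close> is at most
    \<open>a / 4 * (norm x)\<^sup>2 + a / 4\<close>, which uses up half of the Gaussian exponent and
    leaves the other half for the decay. \<open>K + 1\<close> keeps the denominator
    positive.\<close>
  define t0 where "t0 = a / (8 * (K + 1))"
  have t0: "t0 > 0" using assms(1) K0 by (simp add: t0_def)
  have tK: "t0 * K \<le> a / 8" using assms(1) K0 by (simp add: t0_def field_simps)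
  have "exp_family A (\<lambda>x. complex_of_real (- a / 2 * (x \<bullet> x) + x \<bullet> v)) t0"
  proof
    fix n
    obtain C where C: "\<And>r. r \<ge> 0 \<Longrightarrow> (1 + r) ^ n * exp (- (a / 4) * r\<^sup>2 + norm v * r + a / 4) \<le> C"
      using weight_exp_quadratic_bounded[of "a / 4" n "norm v" "a / 4"] assms(1) by auto
    have "(1 + norm x) ^ n * (norm (exp (complex_of_real (- a / 2 * (x \<bullet> x) + x \<bullet> v))) * exp (t0 * norm (A x))) \<le> C" for x
    proof -
      have "t0 * norm (A x) \<le> (t0 * K) * (1 + norm x)\<^sup>2"
        using mult_left_mono[OF K[of x], of t0] t0 by simp
      also have "\<dots> \<le> a / 8 * (2 + 2 * (norm x)\<^sup>2)"
      proof (intro mult_mono tK)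
        show "(1 + norm x)\<^sup>2 \<le> 2 + 2 * (norm x)\<^sup>2"
          using sum_squares_ge_zero[of "norm x - 1" 0] by (simp add: power2_eq_square algebra_simps)
      qed (use assms(1) in auto)
      finally have 1: "t0 * norm (A x) \<le> a / 4 * (norm x)\<^sup>2 + a / 4" by (simp add: algebra_simps)
      have 2: "x \<bullet> v \<le> norm v * norm x"
        using Cauchy_Schwarz_ineq2[of x v] by (simp add: mult.commute)
      have "norm (exp (complex_of_real (- a / 2 * (x \<bullet> x) + x \<bullet> v))) * exp (t0 * norm (A x)) =
          exp (- a / 2 * (norm x)\<^sup>2 + x \<bullet> v + t0 * norm (A x))"
        by (simp add: exp_add[symmetric] power2_norm_eq_inner)
      also have "\<dots> \<le> exp (- (a / 4) * (norm x)\<^sup>2 + norm v * norm x + a / 4)"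
        using 1 2 by (simp add: algebra_simps)
      finally have "(1 + norm x) ^ n * (norm (exp (complex_of_real (- a / 2 * (x \<bullet> x) + x \<bullet> v))) * exp (t0 * norm (A x))) \<le>
         (1 + norm x) ^ n * exp (- (a / 4) * (norm x)\<^sup>2 + norm v * norm x + a / 4)"
        by (intro mult_left_mono) auto
      also have "\<dots> \<le> C" by (rule C) simp
      finally show ?thesis .
    qed
    then show "\<exists>C. \<forall>x. (1 + norm x) ^ n * (norm (exp (complex_of_real (- a / 2 * (x \<bullet> x) + x \<bullet> v))) * exp (t0 * norm (A x))) \<le> C"
      by blast
  qed (use assms(2) t0 polyfun_gaussian_exponent in auto)
  then show ?thesis ..
qed

text \<open>The instance \<open>A = 0\<close> of \<open>exp_family\<close>, where the family does
  not depend on \<open>t\<close>; any member of \<open>I\<close> will do.\<close>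

lemma schwartz_poly_gaussian:
  assumes "a > 0" "polyfun P"
  shows "schwartz (\<lambda>x. P x * gaussian a v x)"
proof -
  obtain t0 where "exp_family (\<lambda>x. 0) (\<lambda>x. complex_of_real (- a / 2 * (x \<bullet> x) + x \<bullet> v)) t0"
    using exp_family_gaussian[OF assms(1) poly_family_constant, of 0 0 v] by auto
  then interpret exp_family "\<lambda>x. 0" "\<lambda>x. complex_of_real (- a / 2 * (x \<bullet> x) + x \<bullet> v)" t0 .
  have "t0 / 2 \<in> I" using t0 by (simp add: I_def)
  from schwartz_exp_tA[OF assms(2) this] show ?thesis by (simp add: gaussian_def)
qed

lemma schwartz_gaussian: "a > 0 \<Longrightarrow> schwartz (gaussian a v)"
  using schwartz_poly_gaussian[of a "\<lambda>x. 1" v, OF _ poly_family_constant] by simp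

lemma tempered_gaussian_derivative:
  assumes "tempered T" "a > 0" "polyfun P" "polyfun A" and K: "\<And>x. norm (A x) \<le> K * (1 + norm x)\<^sup>2"
  shows "((\<lambda>t. T (\<lambda>x. P x * exp (of_real t * A x) * gaussian a v x)) has_vector_derivative
           T (\<lambda>x. A x * P x * gaussian a v x)) (at 0)"
proof -
  obtain t0 where "exp_family A (\<lambda>x. complex_of_real (- a / 2 * (x \<bullet> x) + x \<bullet> v)) t0"
    using exp_family_gaussian[OF assms(2,4) K] by auto
  then interpret exp_family A "\<lambda>x. complex_of_real (- a / 2 * (x \<bullet> x) + x \<bullet> v)" t0 .
  show ?thesis
    using tempered_exp_family_derivative[OF assms(1,3)] schwartz_poly_gaussian[OF assms(2), of _ v]
      poly_family.mult[OF assms(4,3)] assms(3)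
    unfolding gaussian_def by blast
qed

section \<open>Density of Gaussians in the Schwartz space\<close>

text \<open>If \<open>f\<close> is not integrable its integral is 0 by convention, and the bound
  reduces to nonnegativity of the integral of \<open>g\<close>.\<close>

lemma norm_integral_le:
  fixes f :: "'b \<Rightarrow> 'c::{banach, second_countable_topology}"
  assumes "integrable M g" "\<And>x. norm (f x) \<le> g x"
  shows "norm (integral\<^sup>L M f) \<le> integral\<^sup>L M g"
proof (cases "integrable M f")
  case True
  have "norm (integral\<^sup>L M f) \<le> integral\<^sup>L M (\<lambda>x. norm (f x))" by simp
  also have "\<dots> \<le> integral\<^sup>L M g" using True assms by (intro integral_mono) auto
  finally show ?thesis .
next
  case False
  have "0 \<le> g x" for x using assms(2)[of x] norm_ge_zero order_trans by blast
  then show ?thesis using False by (simp add: not_integrable_integral_eq)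
qed

lemma integral_lborel_affine:
  fixes F :: "'a::euclidean_space \<Rightarrow> complex"
  assumes [measurable]: "F \<in> borel_measurable borel" and c: "c \<noteq> 0"
  shows "integral\<^sup>L lborel F = of_real (\<bar>c\<bar> ^ DIM('a)) * (\<integral>y. F (t + c *\<^sub>R y) \<partial>lborel)"
  by (subst lborel_affine[OF c, of t])
     (simp add: integral_density integral_distr scaleR_conv_of_real)

lemma integral_lborel_reflect:
  fixes F :: "'a::euclidean_space \<Rightarrow> complex"
  assumes "F \<in> borel_measurable borel"
  shows "(\<integral>y. F (x - y) \<partial>lborel) = integral\<^sup>L lborel F"
  using integral_lborel_affine[OF assms, of "-1" x] by simp

lemma integral_lborel_translate:
  fixes F :: "'a::euclidean_space \<Rightarrow> complex"
  assumes "F \<in> borel_measurable borel"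
  shows "(\<integral>y. F (y + a) \<partial>lborel) = integral\<^sup>L lborel F"
  using integral_lborel_affine[OF assms, of 1 a] by (simp add: add.commute)

text \<open>Dominated by a series of indicators of balls of radius \<open>Suc k\<close> with
  coefficients of order \<open>-(d + 2)\<close> in the radius. The ball volume has order
  \<open>d\<close>, so a convergent series of inverse squares remains.\<close>

lemma integrable_weight:
  "integrable lborel (\<lambda>x::'a::euclidean_space. 1 / (1 + norm x) ^ (DIM('a) + 2))"
proof (rule integrableI_bounded)
  let ?d = "DIM('a)"
  let ?V = "unit_ball_vol (real ?d)"
  have "(\<integral>\<^sup>+x. norm (1 / (1 + norm (x::'a)) ^ (?d + 2)) \<partial>lborel) \<le>
      (\<integral>\<^sup>+x. (\<Sum>k. ennreal (1 / real (Suc k) ^ (?d + 2)) * indicator (cball 0 (real (Suc k))) (x::'a)) \<partial>lborel)"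
  proof (rule nn_integral_mono)
    fix x :: 'a
    define k where "k = nat \<lfloor>norm x\<rfloor>"
    have k: "real k \<le> norm x" "norm x \<le> real (Suc k)"
      using floor_correct[of "norm x"] by (auto simp: k_def of_nat_nat) linarith
    have "norm (1 / (1 + norm x) ^ (?d + 2)) \<le> 1 / real (Suc k) ^ (?d + 2)"
      using k by (auto intro!: divide_left_mono power_mono mult_pos_pos simp del: power_Suc)
    then have "ennreal (norm (1 / (1 + norm x) ^ (?d + 2))) \<le>
        ennreal (1 / real (Suc k) ^ (?d + 2)) * indicator (cball 0 (real (Suc k))) x"
      using k by (auto simp: indicator_def intro!: ennreal_leI)
    also have "\<dots> \<le> (\<Sum>k. ennreal (1 / real (Suc k) ^ (?d + 2)) * indicator (cball 0 (real (Suc k))) x)" (is "?g k \<le> suminf ?g")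
    proof -
      have "sum ?g {k} \<le> suminf ?g" by (rule sum_le_suminf) auto
      then show ?thesis by (simp only: sum.insert[OF finite.emptyI] sum.empty empty_iff not_False_eq_True add_0_right)
    qed
    finally show "ennreal (norm (1 / (1 + norm x) ^ (?d + 2))) \<le>
      (\<Sum>k. ennreal (1 / real (Suc k) ^ (?d + 2)) * indicator (cball 0 (real (Suc k))) x)" .
  qed
  also have "\<dots> = (\<Sum>k. ennreal (1 / real (Suc k) ^ (?d + 2)) * emeasure lborel (cball 0 (real (Suc k)) :: 'a set))"
  proof -
    have [measurable]: "cball (0::'a) r \<in> sets borel" for r by auto
    show ?thesis by (subst nn_integral_suminf) (measurable, simp add: nn_integral_cmult_indicator)
  qed
  also have "\<dots> = (\<Sum>k. ennreal (?V * (1 / real (Suc k) ^ 2)))"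
    by (intro arg_cong[where f = suminf] ext)
       (simp add: emeasure_cball ennreal_mult[symmetric] power_add power2_eq_square field_simps del: of_nat_Suc)
  also have "\<dots> < \<infinity>"
  proof -
    have "summable (\<lambda>k. 1 / real (Suc k) ^ 2)"
      using inverse_power_summable[of 2, where 'a = real] by (subst summable_Suc_iff) (simp add: field_simps)
    then have "summable (\<lambda>k. ?V * (1 / real (Suc k) ^ 2))" by (rule summable_mult)
    then show ?thesis by (subst suminf_ennreal2) auto
  qed
  finally show "(\<integral>\<^sup>+x. norm (1 / (1 + norm (x::'a)) ^ (?d + 2)) \<partial>lborel) < \<infinity>" .
qed auto

section \<open>Integrability and weighted uniform continuity of Schwartz functions\<close>

lemma schwartz_borel_measurable [measurable]: "schwartz \<phi> \<Longrightarrow> \<phi> \<in> borel_measurable borel"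
  by (intro borel_measurable_continuous_onI schwartz_continuous)

lemma schwartz_weight_integrable:
  assumes "schwartz \<phi>"
  shows "integrable lborel (\<lambda>x. (1 + norm x) ^ n * norm (\<phi> x))"
proof -
  let ?m = "DIM('a) + 2"
  obtain C where C: "C > 0" "\<And>x. (1 + norm x) ^ (n + ?m) * norm (\<phi> x) \<le> C"
    using schwartz_bound[OF assms, of "n + ?m"] by blast
  have "integrable lborel (\<lambda>x::'a. C * (1 / (1 + norm x) ^ ?m))"
    by (intro integrable_mult_right integrable_weight)
  then show ?thesis
  proof (rule Bochner_Integration.integrable_bound)
    show "AE x in lborel. norm ((1 + norm x) ^ n * norm (\<phi> x)) \<le> norm (C * (1 / (1 + norm x) ^ ?m))"
    proof (rule AE_I2)
      fix x :: 'a
      have "(1 + norm x) ^ n * norm (\<phi> x) \<le> C / (1 + norm x) ^ ?m"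
        using C(2)[of x] by (simp add: pos_le_divide_eq add_pos_nonneg power_add mult_ac)
      then show "norm ((1 + norm x) ^ n * norm (\<phi> x)) \<le> norm (C * (1 / (1 + norm x) ^ ?m))"
        using C(1) by (simp add: abs_mult)
    qed
  qed (use assms in measurable)
qed

lemma schwartz_integrable: "schwartz \<phi> \<Longrightarrow> integrable lborel \<phi>"
  using schwartz_weight_integrable[of \<phi> 0] by (subst integrable_norm_iff[symmetric]) auto

text \<open>Outside a large ball both values are small by decay with one power to spare; inside,
  uniform continuity on a compact ball suffices because the weight is bounded there.\<close>

lemma schwartz_uniform_shift:
  fixes \<psi> :: "'a::euclidean_space \<Rightarrow> complex"
  assumes \<psi>: "schwartz \<psi>" and e: "e > 0"
  shows "\<exists>\<delta>>0. \<forall>x y. norm y < \<delta> \<longrightarrow> (1 + norm x) ^ N * norm (\<psi> (x - y) - \<psi> x) \<le> e"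
proof -
  obtain C where C: "C > 0" "\<And>x. (1 + norm x) ^ (N + 1) * norm (\<psi> x) \<le> C"
    using schwartz_bound[OF \<psi>, of "N + 1"] by blast
  \<comment> \<open>The factor \<open>2 ^ N\<close> pays for replacing the weight at
    \<open>x\<close> by the one at a point \<open>z\<close> within distance 1, and \<open>R\<close>
    turns the spare power of the weight into the bound \<open>e / 2\<close>.\<close>
  define R where "R = 2 * C * 2 ^ N / e"
  have R: "R > 0" using C e by (simp add: R_def)
  have far: "(1 + norm x) ^ N * norm (\<psi> z) \<le> e / 2" if z: "norm (x - z) \<le> 1" "norm z \<ge> R" for x z
  proof -
    have "(1 + norm x) ^ N \<le> (1 + norm z) ^ N * (1 + norm (x - z)) ^ N" by (rule weight_shift)
    also have "\<dots> \<le> (1 + norm z) ^ N * 2 ^ N"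
      using z by (intro mult_left_mono power_mono) auto
    finally have "(1 + norm x) ^ N * norm (\<psi> z) * R \<le> (1 + norm z) ^ N * 2 ^ N * norm (\<psi> z) * (1 + norm z)"
      using R z by (intro mult_mono mult_right_mono) auto
    also have "\<dots> \<le> C * 2 ^ N"
      using mult_right_mono[OF C(2)[of z], of "2 ^ N"] by (simp add: mult_ac)
    finally have "(1 + norm x) ^ N * norm (\<psi> z) \<le> C * 2 ^ N / R" using R by (simp add: field_simps)
    also have "\<dots> = e / 2" using C e by (simp add: R_def)
    finally show ?thesis .
  qed
  have "uniformly_continuous_on (cball 0 (R + 2)) \<psi>"
    by (intro compact_uniformly_continuous continuous_on_subset[OF schwartz_continuous[OF \<psi>]]) auto
  moreover have "0 < e / (R + 3) ^ N" using e R by simp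
  ultimately obtain \<delta> where \<delta>: "\<delta> > 0" "\<And>x x'. x \<in> cball 0 (R + 2) \<Longrightarrow> x' \<in> cball 0 (R + 2) \<Longrightarrow>
      dist x' x < \<delta> \<Longrightarrow> dist (\<psi> x') (\<psi> x) < e / (R + 3) ^ N"
    unfolding uniformly_continuous_on_def by blast
  have "(1 + norm x) ^ N * norm (\<psi> (x - y) - \<psi> x) \<le> e" if y: "norm y < min \<delta> 1" for x y
  proof (cases "norm x \<ge> R + 1")
    case True
    have "norm (x - y) \<ge> R" using norm_triangle_ineq2[of x y] True y by simp
    then have "(1 + norm x) ^ N * norm (\<psi> (x - y)) \<le> e / 2" "(1 + norm x) ^ N * norm (\<psi> x) \<le> e / 2"
      using True y by (auto intro!: far simp del: le_divide_eq_numeral1)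
    moreover have "(1 + norm x) ^ N * norm (\<psi> (x - y) - \<psi> x) \<le> (1 + norm x) ^ N * (norm (\<psi> (x - y)) + norm (\<psi> x))"
      by (intro mult_left_mono norm_triangle_ineq4) auto
    ultimately show ?thesis by (simp add: ring_distribs)
  next
    case False
    have "norm (x - y) \<le> R + 2" using norm_triangle_ineq4[of x y] False y by simp
    then have "norm (\<psi> (x - y) - \<psi> x) < e / (R + 3) ^ N"
      using \<delta>(2)[of x "x - y"] False y by (auto simp: dist_norm norm_minus_commute)
    then have "(1 + norm x) ^ N * norm (\<psi> (x - y) - \<psi> x) \<le> (R + 3) ^ N * (e / (R + 3) ^ N)"
      using False R by (intro mult_mono power_mono) auto
    then show ?thesis using R by simp
  qed
  then show ?thesis using \<delta>(1) by (intro exI[of _ "min \<delta> 1"]) auto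
qed

section \<open>Convolution of Schwartz functions and its approximations\<close>

definition conv :: "('a::euclidean_space \<Rightarrow> complex) \<Rightarrow> ('a \<Rightarrow> complex) \<Rightarrow> 'a \<Rightarrow> complex" where
  "conv f g x = (\<integral>y. f (x - y) * g y \<partial>lborel)"

lemma conv_commute:
  assumes "schwartz f" "schwartz g"
  shows "conv f g = conv g f"
proof
  fix x
  have "(\<lambda>y. f (x - y) * g y) \<in> borel_measurable borel"
    using assms by measurable
  from integral_lborel_reflect[OF this, of x] show "conv f g x = conv g f x"
    unfolding conv_def by (simp add: mult.commute)
qed

lemma schwartz_bounded:
  assumes "schwartz \<phi>"
  shows "\<exists>C>0. \<forall>x. norm (\<phi> x) \<le> C"
  using schwartz_bound[OF assms, of 0] by simp

lemma conv_dominated: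
  assumes g: "schwartz g" and f: "\<And>n. f n \<in> borel_measurable borel"
    and C: "\<And>n x. norm (f n x) \<le> C" and lim: "\<And>y. (\<lambda>n. f n y) \<longlonglongrightarrow> h y"
  shows "(\<lambda>n. \<integral>y. f n y * g y \<partial>lborel) \<longlonglongrightarrow> (\<integral>y. h y * g y \<partial>lborel)"
proof (rule integral_dominated_convergence[where w = "\<lambda>y. C * norm (g y)"])
  have [measurable]: "\<And>n. f n \<in> borel_measurable borel" "g \<in> borel_measurable borel" by (fact f) (use g in measurable)
  have [measurable]: "h \<in> borel_measurable borel"
    by (rule borel_measurable_LIMSEQ_metric[where f = f]) (use f lim in auto)
  show "(\<lambda>y. h y * g y) \<in> borel_measurable lborel" by measurable
  show "(\<lambda>y. f n y * g y) \<in> borel_measurable lborel" for n by measurable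
  show "integrable lborel (\<lambda>y. C * norm (g y))" using schwartz_integrable[OF g] by auto
  show "AE y in lborel. (\<lambda>n. f n y * g y) \<longlonglongrightarrow> h y * g y" by (auto intro!: tendsto_intros lim)
  show "AE y in lborel. norm (f n y * g y) \<le> C * norm (g y)" for n
    using C by (auto simp: norm_mult intro!: mult_right_mono)
qed

lemma integrable_bounded_mult:
  assumes g: "schwartz g" and f: "f \<in> borel_measurable borel" and C: "\<And>x. norm (f x) \<le> C"
  shows "integrable lborel (\<lambda>y. f y * g y)"
proof (rule Bochner_Integration.integrable_bound[where f = "\<lambda>y. C * norm (g y)"])
  show "integrable lborel (\<lambda>y. C * norm (g y))" using schwartz_integrable[OF g] by auto
  show "(\<lambda>y. f y * g y) \<in> borel_measurable lborel" using f g by measurable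
  show "AE y in lborel. norm (f y * g y) \<le> norm (C * norm (g y))"
    using C by (auto simp: norm_mult abs_mult intro!: mult_right_mono order_trans[OF _ abs_ge_self])
qed

text \<open>Differentiation under the integral. The derivative is tested along sequences
  \<open>u\<close> tending to 0, so that dominated convergence applies.\<close>

lemma conv_has_pd:
  assumes f: "schwartz f" and g: "schwartz g" and b: "b \<in> Basis"
  shows "has_pd b (conv f g) (conv (pderivs [b] f) g)"
  unfolding has_pd_def
proof
  fix x
  let ?f' = "pderivs [b] f"
  have f': "schwartz ?f'" using schwartz_pderivs[OF f, of "[b]"] b by simp
  obtain C where C: "\<And>x. norm (f x) \<le> C" using schwartz_bounded[OF f] by blast
  obtain D where D: "\<And>x. norm (?f' x) \<le> D" using schwartz_bounded[OF f'] by blast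
  have pd: "has_pd b f ?f'" by (rule has_pd_schwartz[OF f b])
  \<comment> \<open>By the mean value inequality the difference quotients are bounded by the
    supremum of the derivative, which supplies the dominating function.\<close>
  have lip: "norm ((f (z + t *\<^sub>R b) - f z) /\<^sub>R t) \<le> D" for z t
  proof (cases "t = 0")
    case True then show ?thesis using D[of z] norm_ge_zero order_trans by (auto intro: order_trans[OF norm_ge_zero])
  next
    case False
    have *: "norm (f (z + t *\<^sub>R b) - f (z + 0 *\<^sub>R b)) \<le> D * norm (t - 0)"
    proof (rule differentiable_bound[where f' = "\<lambda>s h. h *\<^sub>R ?f' (z + s *\<^sub>R b)" and S = UNIV])
      show "((\<lambda>t. f (z + t *\<^sub>R b)) has_derivative (\<lambda>h. h *\<^sub>R ?f' (z + s *\<^sub>R b))) (at s within UNIV)" for s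
        using has_pd_line[OF pd, of z s UNIV] by (simp add: has_vector_derivative_def del: pderivs.simps)
      show "onorm (\<lambda>h. h *\<^sub>R ?f' (z + s *\<^sub>R b)) \<le> D" for s
        using D by (subst onorm_scaleR_left) (auto simp: onorm_id simp del: pderivs.simps)
    qed auto
    have "norm ((f (z + t *\<^sub>R b) - f z) /\<^sub>R t) = norm (f (z + t *\<^sub>R b) - f z) / \<bar>t\<bar>"
      by (simp add: divide_inverse mult.commute)
    also have "\<dots> \<le> D" using * False by (simp add: pos_divide_le_eq)
    finally show ?thesis .
  qed
  have int: "integrable lborel (\<lambda>y. f (z - y) * g y)" for z
    using f by (intro integrable_bounded_mult[OF g _ C]) measurable
  have "(\<lambda>n. (conv f g (x + u n *\<^sub>R b) - conv f g x) /\<^sub>R u n) \<longlonglongrightarrow> conv ?f' g x"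
    if u: "\<And>n. u n \<noteq> 0" "u \<longlonglongrightarrow> 0" for u :: "nat \<Rightarrow> real"
  proof -
    have "(\<lambda>n. \<integral>y. ((f (x - y + u n *\<^sub>R b) - f (x - y)) /\<^sub>R u n) * g y \<partial>lborel) \<longlonglongrightarrow> (\<integral>y. ?f' (x - y) * g y \<partial>lborel)"
    proof (rule conv_dominated[OF g, where C = D])
      show "(\<lambda>y. (f (x - y + u n *\<^sub>R b) - f (x - y)) /\<^sub>R u n) \<in> borel_measurable borel" for n
        using f by measurable
      show "(\<lambda>n. (f (x - y + u n *\<^sub>R b) - f (x - y)) /\<^sub>R u n) \<longlonglongrightarrow> ?f' (x - y)" for y
        using pd[unfolded has_pd_def has_vector_derivative_at_0_iff, rule_format, of "x - y"] u
        unfolding filterlim_at tendsto_at_iff_sequentially by (auto simp: o_def simp del: pderivs.simps)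
    qed (rule lip)
    moreover have "(\<integral>y. ((f (x - y + u n *\<^sub>R b) - f (x - y)) /\<^sub>R u n) * g y \<partial>lborel) =
        (conv f g (x + u n *\<^sub>R b) - conv f g x) /\<^sub>R u n" for n
    proof -
      have "(\<integral>y. ((f (x - y + u n *\<^sub>R b) - f (x - y)) /\<^sub>R u n) * g y \<partial>lborel) =
          (\<integral>y. (f ((x + u n *\<^sub>R b) - y) * g y - f (x - y) * g y) /\<^sub>R u n \<partial>lborel)"
        by (intro Bochner_Integration.integral_cong) (auto simp: algebra_simps)
      also have "\<dots> = (conv f g (x + u n *\<^sub>R b) - conv f g x) /\<^sub>R u n"
        unfolding conv_def using int by simp
      finally show ?thesis .
    qed
    ultimately show ?thesis unfolding conv_def[of ?f'] by (simp only:)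
  qed
  then show "((\<lambda>t. conv f g (x + t *\<^sub>R b)) has_vector_derivative conv ?f' g x) (at 0)"
    unfolding has_vector_derivative_at_0_iff tendsto_at_iff_sequentially by (auto simp: o_def simp del: pderivs.simps)
qed

lemma pderivs_conv_left:
  assumes f: "schwartz f" and g: "schwartz g" and "set bs \<subseteq> Basis"
  shows "pderivs bs (conv f g) = conv (pderivs bs f) g"
  using assms(3)
proof (induction bs)
  case (Cons b bs)
  then have "has_pd b (pderivs bs (conv f g)) (conv (pderivs [b] (pderivs bs f)) g)"
    using conv_has_pd[OF schwartz_pderivs[OF f, of bs] g, of b] by (simp del: pderivs.simps)
  from pderivs_Cons_eq[OF this] show ?case by simp
qed simp

lemma pderivs_conv_right:
  assumes "schwartz f" "schwartz g" "set bs \<subseteq> Basis"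
  shows "pderivs bs (conv f g) = conv f (pderivs bs g)"
  using pderivs_conv_left[OF assms(2,1,3)] conv_commute[OF assms(1,2)]
    conv_commute[OF assms(1) schwartz_pderivs[OF assms(2,3)]] by simp


text \<open>Rescaling moves \<open>m\<close> from the kernel into the argument:
  \<open>\<psi> (x - y / m)\<close> is compared with \<open>\<psi> x\<close> against the fixed
  weight \<open>k y\<close>. Small \<open>y\<close> are handled by uniform continuity, large
  \<open>y\<close> by the decay of \<open>k\<close>.\<close>

lemma conv_approximate_identity:
  fixes \<psi> k :: "'a::euclidean_space \<Rightarrow> complex"
  assumes \<psi>: "schwartz \<psi>" and k: "schwartz k" and e: "e > 0"
  shows "\<exists>M\<ge>1. \<forall>m\<ge>M. \<forall>x. (1 + norm x) ^ N *
    norm (conv \<psi> (\<lambda>y. of_real (m ^ DIM('a)) * k (m *\<^sub>R y)) x - integral\<^sup>L lborel k * \<psi> x) \<le> e"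
proof -
  obtain C where C: "C > 0" "\<And>x. (1 + norm x) ^ N * norm (\<psi> x) \<le> C"
    using schwartz_bound[OF \<psi>, of N] by blast
  obtain C' where C': "\<And>x. norm (\<psi> x) \<le> C'" using schwartz_bounded[OF \<psi>] by blast
  \<comment> \<open>Of the \<open>N + 1\<close> powers, \<open>N\<close> are consumed by
    \<open>weight_shift\<close> and one by the tail: for \<open>norm y > R\<close> the constant
    \<open>2 * C = e1 * R\<close> is below \<open>e1 * (1 + norm y)\<close>.\<close>
  define J where "J = (\<integral>y. (1 + norm y) ^ (N + 1) * norm (k y) \<partial>lborel)"
  have Jint: "integrable lborel (\<lambda>y. (1 + norm y) ^ (N + 1) * norm (k y))"
    by (rule schwartz_weight_integrable[OF k])
  have J: "J \<ge> 0" unfolding J_def by (intro Bochner_Integration.integral_nonneg) auto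
  define e1 where "e1 = e / (2 * (J + 1))"
  have e1: "e1 > 0" using e J by (simp add: e1_def)
  define R where "R = 2 * C / e1"
  have R: "R > 0" using C e1 by (simp add: R_def)
  obtain \<delta> where \<delta>: "\<delta> > 0" "\<And>x y. norm y < \<delta> \<Longrightarrow> (1 + norm x) ^ N * norm (\<psi> (x - y) - \<psi> x) \<le> e1"
    using schwartz_uniform_shift[OF \<psi> e1] by blast
  \<comment> \<open>The second entry gives \<open>norm (y / m) < \<delta>\<close> whenever
    \<open>norm y \<le> R\<close>; the first makes \<open>norm (y / m) \<le> norm y\<close>.\<close>
  define M where "M = max 1 (R / \<delta> + 1)"
  have "(1 + norm x) ^ N * norm (conv \<psi> (\<lambda>y. of_real (m ^ DIM('a)) * k (m *\<^sub>R y)) x - integral\<^sup>L lborel k * \<psi> x) \<le> e"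
    if m: "m \<ge> M" for m x
  proof -
    have m1: "m \<ge> 1" "m > R / \<delta>" using m by (auto simp: M_def)
    then have "m > 0" by simp
    note m1 = m1(1) this m1(2)
    have "(\<lambda>y. \<psi> (x - y) * (of_real (m ^ DIM('a)) * k (m *\<^sub>R y))) \<in> borel_measurable borel"
      using \<psi> k by measurable
    note affine = integral_lborel_affine[OF this, of "1 / m" 0]
    have 1: "conv \<psi> (\<lambda>y. of_real (m ^ DIM('a)) * k (m *\<^sub>R y)) x = (\<integral>y. \<psi> (x - (1 / m) *\<^sub>R y) * k y \<partial>lborel)"
    proof -
      have "of_real (\<bar>1 / m\<bar> ^ DIM('a)) * (\<integral>y. \<psi> (x - (1 / m) *\<^sub>R y) * (of_real (m ^ DIM('a)) * k y) \<partial>lborel) =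
         of_real (\<bar>1 / m\<bar> ^ DIM('a)) * (of_real (m ^ DIM('a)) * (\<integral>y. \<psi> (x - (1 / m) *\<^sub>R y) * k y \<partial>lborel))"
        by (subst integral_mult_right_zero[symmetric]) (simp add: mult_ac)
      also have "\<dots> = (\<integral>y. \<psi> (x - (1 / m) *\<^sub>R y) * k y \<partial>lborel)"
        using m1 by (simp add: power_divide)
      finally show ?thesis
        using affine m1 by (simp add: conv_def)
    qed
    have i1: "integrable lborel (\<lambda>y. \<psi> (x - (1 / m) *\<^sub>R y) * k y)"
      using \<psi> by (intro integrable_bounded_mult[OF k _ C']) measurable
    have i2: "integrable lborel (\<lambda>y. \<psi> x * k y)"
      using schwartz_integrable[OF k] by auto
    have 2: "conv \<psi> (\<lambda>y. of_real (m ^ DIM('a)) * k (m *\<^sub>R y)) x - integral\<^sup>L lborel k * \<psi> x =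
        (\<integral>y. \<psi> (x - (1 / m) *\<^sub>R y) * k y - \<psi> x * k y \<partial>lborel)"
      using i1 i2 unfolding 1 by (simp add: mult.commute)
    have "norm (of_real ((1 + norm x) ^ N) * (\<integral>y. \<psi> (x - (1 / m) *\<^sub>R y) * k y - \<psi> x * k y \<partial>lborel)) \<le>
        (\<integral>y. 2 * e1 * ((1 + norm y) ^ (N + 1) * norm (k y)) \<partial>lborel)"
      unfolding integral_mult_right_zero[symmetric]
    proof (rule norm_integral_le)
      fix y
      let ?z = "x - (1 / m) *\<^sub>R y"
      have "(1 + norm x) ^ N * norm (\<psi> ?z - \<psi> x) \<le> 2 * e1 * (1 + norm y) ^ (N + 1)"
      proof (cases "norm y \<le> R")
        case True
        have "norm ((1 / m) *\<^sub>R y) < \<delta>"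
        proof -
          have "norm y < m * \<delta>" using True m1(3) \<delta>(1) by (simp add: field_simps)
          then show ?thesis using m1 by (simp add: field_simps)
        qed
        then have "(1 + norm x) ^ N * norm (\<psi> ?z - \<psi> x) \<le> e1" by (rule \<delta>)
        also have "\<dots> \<le> 2 * e1 * 1" using e1 by simp
        also have "\<dots> \<le> 2 * e1 * (1 + norm y) ^ (N + 1)"
          using e1 by (intro mult_left_mono one_le_power) auto
        finally show ?thesis .
      next
        case False
        have "(1 + norm x) ^ N * norm (\<psi> ?z) \<le> (1 + norm ?z) ^ N * (1 + norm (x - ?z)) ^ N * norm (\<psi> ?z)"
          by (intro mult_right_mono weight_shift) auto
        also have "\<dots> \<le> (1 + norm ?z) ^ N * (1 + norm y) ^ N * norm (\<psi> ?z)"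
        proof -
          have "norm (x - ?z) \<le> norm y" using m1 mult_right_mono[of 1 m "norm y"] by (simp add: field_simps)
          then show ?thesis by (intro mult_right_mono mult_left_mono power_mono) auto
        qed
        also have "\<dots> \<le> C * (1 + norm y) ^ N"
          using mult_right_mono[OF C(2)[of ?z], of "(1 + norm y) ^ N"] by (simp add: mult_ac)
        finally have "(1 + norm x) ^ N * norm (\<psi> ?z) \<le> C * (1 + norm y) ^ N" .
        moreover have "(1 + norm x) ^ N * norm (\<psi> x) \<le> C * (1 + norm y) ^ N"
        proof -
          have "C * 1 \<le> C * (1 + norm y) ^ N" using C(1) by (intro mult_left_mono one_le_power) auto
          then show ?thesis using C(2)[of x] by simp
        qed
        moreover have "(1 + norm x) ^ N * norm (\<psi> ?z - \<psi> x) \<le> (1 + norm x) ^ N * (norm (\<psi> ?z) + norm (\<psi> x))"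
          by (intro mult_left_mono norm_triangle_ineq4) auto
        ultimately have "(1 + norm x) ^ N * norm (\<psi> ?z - \<psi> x) \<le> 2 * C * (1 + norm y) ^ N"
          by (simp add: ring_distribs)
        also have "\<dots> = e1 * R * (1 + norm y) ^ N" using e1 by (simp add: R_def)
        also have "\<dots> \<le> e1 * (1 + norm y) * (1 + norm y) ^ N"
          using False e1 by (intro mult_right_mono mult_left_mono) auto
        also have "\<dots> \<le> 2 * e1 * (1 + norm y) ^ (N + 1)" using e1 by simp
        finally show ?thesis .
      qed
      then have "(1 + norm x) ^ N * norm (\<psi> ?z - \<psi> x) * norm (k y) \<le> 2 * e1 * (1 + norm y) ^ (N + 1) * norm (k y)"
        by (rule mult_right_mono) auto
      then show "norm (of_real ((1 + norm x) ^ N) * (\<psi> ?z * k y - \<psi> x * k y)) \<le> 2 * e1 * ((1 + norm y) ^ (N + 1) * norm (k y))"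
        unfolding left_diff_distrib[symmetric] by (simp add: norm_mult abs_mult mult_ac del: of_real_power)
    qed (intro integrable_mult_right Jint)
    also have "\<dots> = 2 * e1 * J" by (simp add: J_def)
    also have "\<dots> \<le> e" using e J by (simp add: e1_def field_simps)
    finally show ?thesis unfolding 2 by (simp add: norm_mult abs_mult del: of_real_power)
  qed
  then show ?thesis by (intro exI[of _ M]) (auto simp: M_def)
qed

text \<open>A measurable choice of a centre from a finite cover; the fibres of \<open>s\<close>
  become the cells of a Riemann sum. Off the cover the value defaults to 0, whence
  \<open>insert 0 D\<close>.\<close>

lemma finite_net_rounding:
  fixes D :: "'a::euclidean_space set"
  assumes "finite D"
  shows "\<exists>s. s \<in> borel_measurable borel \<and> range s \<subseteq> insert 0 D \<and> (\<forall>y\<in>(\<Union>d\<in>D. ball d \<delta>). norm (s y - y) < \<delta>)"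
  using assms
proof (induction D rule: finite_induct)
  case empty
  show ?case by (intro exI[of _ "\<lambda>_. 0"]) auto
next
  case (insert d D)
  then obtain s where [measurable]: "s \<in> borel_measurable borel"
    and s: "range s \<subseteq> insert 0 D" "\<forall>y\<in>(\<Union>d\<in>D. ball d \<delta>). norm (s y - y) < \<delta>" by blast
  have "(\<lambda>y. if y \<in> ball d \<delta> then d else s y) \<in> borel_measurable borel"
    by (rule measurable_If_set) auto
  then show ?case
    using s by (intro exI[of _ "\<lambda>y. if y \<in> ball d \<delta> then d else s y"]) (auto simp: dist_norm)
qed

text \<open>A convolution is almost a Riemann sum of translates of \<open>h\<close>. The
  coefficients \<open>c z\<close> are integrals of \<open>\<phi>\<close> over cells and do not
  depend on \<open>h\<close>, so one sum serves all of \<open>H\<close>; this is what allows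
  approximating a function together with its derivatives.\<close>

lemma conv_translates_approximation:
  fixes \<phi> :: "'a::euclidean_space \<Rightarrow> complex"
  assumes \<phi>: "schwartz \<phi>" and H: "finite H" "\<And>h. h \<in> H \<Longrightarrow> schwartz h" and e: "e > 0"
  shows "\<exists>D c. finite D \<and> (\<forall>h\<in>H. \<forall>x. (1 + norm x) ^ N * norm (conv h \<phi> x - (\<Sum>z\<in>D. c z * h (x - z))) \<le> e)"
proof -
  define J where "J = (\<integral>y. (1 + norm y) ^ (N + 1) * norm (\<phi> y) \<partial>lborel)"
  have Jint: "integrable lborel (\<lambda>y. (1 + norm y) ^ (N + 1) * norm (\<phi> y))"
    by (rule schwartz_weight_integrable[OF \<phi>])
  have J: "J \<ge> 0" unfolding J_def by (intro Bochner_Integration.integral_nonneg) auto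
  define e1 where "e1 = e / (J + 1)"
  have e1: "e1 > 0" using e J by (simp add: e1_def)
  have "\<exists>\<delta>>0. \<forall>h\<in>H. \<forall>x y. norm y < \<delta> \<longrightarrow> (1 + norm x) ^ N * norm (h (x - y) - h x) \<le> e1"
    using H
  proof (induction H rule: finite_induct)
    case empty show ?case by (intro exI[of _ 1]) auto
  next
    case (insert h H)
    then obtain \<delta>1 where "\<delta>1 > 0" "\<forall>h\<in>H. \<forall>x y. norm y < \<delta>1 \<longrightarrow> (1 + norm x) ^ N * norm (h (x - y) - h x) \<le> e1" by blast
    moreover obtain \<delta>2 where "\<delta>2 > 0" "\<forall>x y. norm y < \<delta>2 \<longrightarrow> (1 + norm x) ^ N * norm (h (x - y) - h x) \<le> e1"
      using schwartz_uniform_shift[OF _ e1, of h N] insert by blast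
    ultimately show ?case by (intro exI[of _ "min \<delta>1 \<delta>2"]) auto
  qed
  then obtain \<delta> where \<delta>: "\<delta> > 0" "\<And>h x y. h \<in> H \<Longrightarrow> norm y < \<delta> \<Longrightarrow> (1 + norm x) ^ N * norm (h (x - y) - h x) \<le> e1"
    by blast
  have "\<exists>C>0. \<forall>h\<in>H. \<forall>x. (1 + norm x) ^ N * norm (h x) \<le> C"
    using H
  proof (induction H rule: finite_induct)
    case empty show ?case by (intro exI[of _ 1]) auto
  next
    case (insert h H)
    then obtain C1 where "C1 > 0" "\<forall>h\<in>H. \<forall>x. (1 + norm x) ^ N * norm (h x) \<le> C1" by blast
    moreover obtain C2 where "C2 > 0" "\<forall>x. (1 + norm x) ^ N * norm (h x) \<le> C2"
      using schwartz_bound[of h N] insert by blast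
    ultimately show ?case by (intro exI[of _ "max C1 C2"]) (auto simp: le_max_iff_disj)
  qed
  then obtain C where C: "C > 0" "\<And>h x. h \<in> H \<Longrightarrow> (1 + norm x) ^ N * norm (h x) \<le> C" by blast
  \<comment> \<open>Beyond this radius \<open>C = e1 * R\<close> is below
    \<open>e1 * (1 + norm y)\<close>, so the integral over large \<open>y\<close> needs no
    translates at all.\<close>
  define R where "R = C / e1"
  have R: "R > 0" using C e1 by (simp add: R_def)
  have "cball 0 R \<subseteq> (\<Union>d\<in>(UNIV::'a set). ball d \<delta>)" using \<delta>(1) centre_in_ball by blast
  then obtain D0 :: "'a set" where D0: "finite D0" "cball 0 R \<subseteq> (\<Union>d\<in>D0. ball d \<delta>)"
    by (rule compactE_image[OF compact_cball open_ball])
  obtain s where s[measurable]: "s \<in> borel_measurable borel" and sD: "range s \<subseteq> insert 0 D0"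
    and sd: "\<And>y. y \<in> (\<Union>d\<in>D0. ball d \<delta>) \<Longrightarrow> norm (s y - y) < \<delta>"
    using finite_net_rounding[OF D0(1), of \<delta>] by blast
  define D where "D = insert 0 D0"
  have D: "finite D" "range s \<subseteq> D" using D0 sD by (auto simp: D_def)
  define A where "A z = {y. norm y \<le> R \<and> s y = z}" for z
  have A[measurable]: "A z \<in> sets borel" for z unfolding A_def by measurable
  define c where "c z = (\<integral>y. indicator (A z) y * \<phi> y \<partial>lborel)" for z
  have cint: "integrable lborel (\<lambda>y. indicator (A z) y * \<phi> y)" for z
    by (intro integrable_bounded_mult[OF \<phi>, where C = 1]) (auto simp: indicator_def)
  have "(1 + norm x) ^ N * norm (conv h \<phi> x - (\<Sum>z\<in>D. c z * h (x - z))) \<le> e" if h: "h \<in> H" for h x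
  proof -
    obtain C' where C': "\<And>x. norm (h x) \<le> C'" using schwartz_bounded[OF H(2)[OF h]] by blast
    have sum: "(\<Sum>z\<in>D. indicator (A z) y * \<phi> y * h (x - z)) = (if norm y \<le> R then \<phi> y * h (x - s y) else 0)" for y
    proof (cases "norm y \<le> R")
      case True
      have "(\<Sum>z\<in>D. indicator (A z) y * \<phi> y * h (x - z)) = (\<Sum>z\<in>D. if z = s y then \<phi> y * h (x - s y) else 0)"
        using True by (intro sum.cong) (auto simp: A_def indicator_def)
      then show ?thesis using True D by auto
    qed (auto simp: A_def)
    have i1: "integrable lborel (\<lambda>y. h (x - y) * \<phi> y)"
      using H(2)[OF h] by (intro integrable_bounded_mult[OF \<phi> _ C']) measurable
    have i2: "integrable lborel (\<lambda>y. \<Sum>z\<in>D. indicator (A z) y * \<phi> y * h (x - z))"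
      by (intro Bochner_Integration.integrable_sum integrable_mult_left cint)
    have eq: "conv h \<phi> x - (\<Sum>z\<in>D. c z * h (x - z)) =
        (\<integral>y. h (x - y) * \<phi> y - (\<Sum>z\<in>D. indicator (A z) y * \<phi> y * h (x - z)) \<partial>lborel)"
      using i1 i2 cint by (simp add: conv_def c_def Bochner_Integration.integral_sum)
    have "norm (of_real ((1 + norm x) ^ N) * (\<integral>y. h (x - y) * \<phi> y - (\<Sum>z\<in>D. indicator (A z) y * \<phi> y * h (x - z)) \<partial>lborel))
        \<le> (\<integral>y. e1 * ((1 + norm y) ^ (N + 1) * norm (\<phi> y)) \<partial>lborel)"
      unfolding integral_mult_right_zero[symmetric]
    proof (rule norm_integral_le)
      fix y
      \<comment> \<open>The local error: a rounding error inside the ball, and all of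
        \<open>h (x - y)\<close> outside, where the sum has no cell.\<close>
      define g where "g = (if norm y \<le> R then h (x - y) - h (x - s y) else h (x - y))"
      have g: "h (x - y) * \<phi> y - (\<Sum>z\<in>D. indicator (A z) y * \<phi> y * h (x - z)) = g * \<phi> y"
        unfolding sum g_def by (simp add: algebra_simps)
      have w: "(1 + norm x) ^ N \<le> (1 + norm (x - y)) ^ N * (1 + norm y) ^ N"
        using weight_shift[of x N "x - y"] by simp
      have "(1 + norm (x - y)) ^ N * norm g \<le> e1 * (1 + norm y)"
      proof (cases "norm y \<le> R")
        case True
        then have "y \<in> cball 0 R" by simp
        then have "norm (s y - y) < \<delta>" using D0(2) by (intro sd) blast
        from \<delta>(2)[OF h this, of "x - y"] have "(1 + norm (x - y)) ^ N * norm g \<le> e1"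
          using True by (simp add: g_def norm_minus_commute)
        also have "\<dots> \<le> e1 * (1 + norm y)" using e1 by simp
        finally show ?thesis .
      next
        case False
        have "(1 + norm (x - y)) ^ N * norm g \<le> C" using False C(2)[OF h] by (simp add: g_def)
        also have "\<dots> = e1 * R" using e1 by (simp add: R_def)
        also have "\<dots> \<le> e1 * (1 + norm y)" using False e1 by (intro mult_left_mono) auto
        finally show ?thesis .
      qed
      then have "(1 + norm (x - y)) ^ N * norm g * (1 + norm y) ^ N \<le> e1 * (1 + norm y) * (1 + norm y) ^ N"
        by (intro mult_right_mono) auto
      moreover have "(1 + norm x) ^ N * norm g \<le> (1 + norm (x - y)) ^ N * (1 + norm y) ^ N * norm g"
        by (intro mult_right_mono w) auto
      ultimately have "(1 + norm x) ^ N * norm g \<le> e1 * (1 + norm y) ^ (N + 1)"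
        by (simp add: mult_ac)
      then have "(1 + norm x) ^ N * norm g * norm (\<phi> y) \<le> e1 * (1 + norm y) ^ (N + 1) * norm (\<phi> y)"
        by (rule mult_right_mono) auto
      then show "norm (of_real ((1 + norm x) ^ N) * (h (x - y) * \<phi> y - (\<Sum>z\<in>D. indicator (A z) y * \<phi> y * h (x - z))))
          \<le> e1 * ((1 + norm y) ^ (N + 1) * norm (\<phi> y))"
        unfolding g by (simp add: norm_mult abs_mult mult_ac del: of_real_power)
    qed (intro integrable_mult_right Jint)
    also have "\<dots> = e1 * J" by (simp add: J_def)
    also have "\<dots> \<le> e" using e J by (simp add: e1_def field_simps)
    finally show ?thesis unfolding eq by (simp add: norm_mult abs_mult del: of_real_power)
  qed
  then show ?thesis using D by blast
qed


lemma conv_approximate_identity_finite: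
  fixes k :: "'a::euclidean_space \<Rightarrow> complex"
  assumes H: "finite H" "\<And>h. h \<in> H \<Longrightarrow> schwartz h" and k: "schwartz k" and e: "e > 0"
  shows "\<exists>M\<ge>1. \<forall>m\<ge>M. \<forall>h\<in>H. \<forall>x. (1 + norm x) ^ N *
    norm (conv h (\<lambda>y. of_real (m ^ DIM('a)) * k (m *\<^sub>R y)) x - integral\<^sup>L lborel k * h x) \<le> e"
  using H
proof (induction H rule: finite_induct)
  case empty show ?case by (intro exI[of _ 1]) auto
next
  case (insert h H)
  let ?P = "\<lambda>h M. \<forall>m\<ge>M. \<forall>x. (1 + norm x) ^ N *
    norm (conv h (\<lambda>y. of_real (m ^ DIM('a)) * k (m *\<^sub>R y)) x - integral\<^sup>L lborel k * h x) \<le> e"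
  obtain M1 where M1: "M1 \<ge> 1" "\<forall>h\<in>H. ?P h M1" using insert by blast
  obtain M2 where M2: "M2 \<ge> 1" "?P h M2" using conv_approximate_identity[OF _ k e] insert by blast
  show ?case using M1 M2 by (intro exI[of _ "max M1 M2"]) auto
qed

lemma gaussian_integral_pos: "integral\<^sup>L lborel (gaussian 1 (0::'a::euclidean_space)) \<noteq> 0"
proof
  let ?f = "\<lambda>x::'a. exp (- (x \<bullet> x) / 2)"
  have f: "gaussian 1 (0::'a) = (\<lambda>x. complex_of_real (?f x))"
    by (auto simp: gaussian_def exp_of_real[symmetric])
  have int: "integrable lborel ?f"
    using integrable_norm[OF schwartz_integrable[OF schwartz_gaussian[of 1 "0::'a"]]] unfolding f by simp
  assume "integral\<^sup>L lborel (gaussian 1 (0::'a)) = 0"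
  then have "integral\<^sup>L lborel ?f = 0" unfolding f by simp
  then have "AE x::'a in lborel. ?f x = 0" using int by (subst (asm) integral_nonneg_eq_0_iff_AE) auto
  then have "AE x::'a in lborel. False" by simp
  then show False using ae_filter_eq_bot_iff[of "lborel :: 'a measure"] by (simp add: eventually_False)
qed

text \<open>In the one seminorm that controls \<open>T\<close>, \<open>c * \<phi>\<close> is close
  to the convolution of \<open>\<phi>\<close> with a narrow Gaussian \<open>\<kappa>\<close>, which
  is close to a finite combination of translates of \<open>\<kappa>\<close>. These are multiples of
  functions \<open>gaussian a v\<close>, on which \<open>T\<close> vanishes.\<close>

theorem tempered_eq_zero_if_zero_on_gaussians:
  fixes T :: "('a::euclidean_space \<Rightarrow> complex) \<Rightarrow> complex"
  assumes T: "tempered T" and T0: "\<And>a v. a > 0 \<Longrightarrow> T (gaussian a v) = 0" and \<phi>: "schwartz \<phi>"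
  shows "T \<phi> = 0"
proof -
  obtain C N where C: "C > 0" "\<And>\<phi>. schwartz \<phi> \<Longrightarrow> norm (T \<phi>) \<le> C * schwartz_seminorm N \<phi>"
    using tempered_bound[OF T] by blast
  let ?k = "gaussian 1 (0::'a)"
  define c where "c = integral\<^sup>L lborel ?k"
  have k: "schwartz ?k" by (rule schwartz_gaussian) simp
  have MI: "finite (multi_indices N :: 'a list set)" by (rule finite_lists_length_le[OF finite_Basis])
  define K where "K = real (card (multi_indices N :: 'a list set))"
  have "norm (c * T \<phi>) \<le> C * (K * (2 * e))" if e: "e > 0" for e
  proof -
    obtain m where m: "m \<ge> 1" "\<And>h x. h \<in> (\<lambda>bs. pderivs bs \<phi>) ` multi_indices N \<Longrightarrow> (1 + norm x) ^ N *
        norm (conv h (\<lambda>y. of_real (m ^ DIM('a)) * ?k (m *\<^sub>R y)) x - c * h x) \<le> e"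
    proof -
      have "\<exists>M\<ge>1. \<forall>m\<ge>M. \<forall>h\<in>(\<lambda>bs. pderivs bs \<phi>) ` multi_indices N. \<forall>x. (1 + norm x) ^ N *
        norm (conv h (\<lambda>y. of_real (m ^ DIM('a)) * ?k (m *\<^sub>R y)) x - c * h x) \<le> e"
        unfolding c_def using MI schwartz_pderivs[OF \<phi>]
        by (intro conv_approximate_identity_finite k e) auto
      then show ?thesis using that by blast
    qed
    define \<kappa> where "\<kappa> = (\<lambda>y. of_real (m ^ DIM('a)) * ?k (m *\<^sub>R y))"
    have \<kappa>_eq: "\<kappa> = (\<lambda>y. of_real (m ^ DIM('a)) * gaussian (m\<^sup>2) 0 y)"
      by (simp add: \<kappa>_def gaussian_def power2_eq_square mult_ac)
    have \<kappa>: "schwartz \<kappa>" unfolding \<kappa>_eq using m(1) by (intro schwartz_cmult schwartz_gaussian) auto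
    obtain D d where D: "finite D" "\<And>h x. h \<in> (\<lambda>bs. pderivs bs \<kappa>) ` multi_indices N \<Longrightarrow>
        (1 + norm x) ^ N * norm (conv h \<phi> x - (\<Sum>z\<in>D. d z * h (x - z))) \<le> e"
    proof -
      have "\<exists>D d. finite D \<and> (\<forall>h\<in>(\<lambda>bs. pderivs bs \<kappa>) ` multi_indices N. \<forall>x.
          (1 + norm x) ^ N * norm (conv h \<phi> x - (\<Sum>z\<in>D. d z * h (x - z))) \<le> e)"
        using MI schwartz_pderivs[OF \<kappa>] by (intro conv_translates_approximation \<phi> e) auto
      then show ?thesis using that by blast
    qed
    define S where "S = (\<lambda>x. \<Sum>z\<in>D. d z * \<kappa> (x + - z))"
    have Sz: "schwartz (\<lambda>x. d z * \<kappa> (x + - z))" for z by (intro schwartz_cmult schwartz_shift \<kappa>)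
    have S: "schwartz S" unfolding S_def by (intro schwartz_sum Sz)
    \<comment> \<open>Expanding the square turns a translation into a real exponential factor, hence
      into the parameter \<open>v\<close>.\<close>
    have shift: "gaussian (m\<^sup>2) 0 (x + - z) = gaussian (m\<^sup>2) 0 z * gaussian (m\<^sup>2) (m\<^sup>2 *\<^sub>R z) x" for x z :: 'a
      unfolding gaussian_def exp_add[symmetric] of_real_add[symmetric]
      by (intro arg_cong[where f = exp] arg_cong[where f = complex_of_real])
         (simp add: inner_simps inner_commute algebra_simps)
    have TS: "T S = 0"
    proof -
      have "T (\<lambda>x. d z * \<kappa> (x + - z)) = 0" for z
      proof -
        have eq: "(\<lambda>x. d z * \<kappa> (x + - z)) = (\<lambda>x. (d z * of_real (m ^ DIM('a)) * gaussian (m\<^sup>2) 0 z) * gaussian (m\<^sup>2) (m\<^sup>2 *\<^sub>R z) x)"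
          unfolding \<kappa>_eq shift by (simp add: mult.assoc)
        show ?thesis unfolding eq using m(1)
          by (subst tempered_cmult[OF T schwartz_gaussian]) (auto simp: T0)
      qed
      then show ?thesis unfolding S_def by (subst tempered_sum[OF T Sz]) simp
    qed
    have pS: "pderivs bs S = (\<lambda>x. \<Sum>z\<in>D. d z * pderivs bs \<kappa> (x - z))" if "bs \<in> multi_indices N" for bs
    proof -
      have bs: "set bs \<subseteq> Basis" using that by simp
      have "pderivs bs S = (\<lambda>x. \<Sum>z\<in>D. pderivs bs (\<lambda>x. d z * \<kappa> (x + - z)) x)"
        unfolding S_def by (rule pderivs_sum[OF Sz bs])
      then show ?thesis
        by (simp only: pderivs_cmult[OF schwartz_shift[OF \<kappa>] bs] pderivs_shift[OF \<kappa> bs]) simp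
    qed
    let ?\<chi> = "\<lambda>x. c * \<phi> x - S x"
    have \<chi>: "schwartz ?\<chi>" by (intro schwartz_diff schwartz_cmult \<phi> S)
    have "(1 + norm x) ^ N * norm (pderivs bs ?\<chi> x) \<le> 2 * e" if bs: "bs \<in> multi_indices N" for bs x
    proof -
      have bs': "set bs \<subseteq> Basis" using bs by simp
      \<comment> \<open>The derivatives change sides: on \<open>\<phi>\<close> they fit the
        approximate identity, on \<open>\<kappa>\<close> they fit the sum of translates.\<close>
      have "conv (pderivs bs \<phi>) \<kappa> = conv (pderivs bs \<kappa>) \<phi>"
        using pderivs_conv_left[OF \<phi> \<kappa> bs'] pderivs_conv_right[OF \<phi> \<kappa> bs']
          conv_commute[OF \<phi> schwartz_pderivs[OF \<kappa> bs']] by simp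
      then have "pderivs bs ?\<chi> x = (conv (pderivs bs \<kappa>) \<phi> x - (\<Sum>z\<in>D. d z * pderivs bs \<kappa> (x - z))) -
          (conv (pderivs bs \<phi>) \<kappa> x - c * pderivs bs \<phi> x)"
        using pS[OF bs] pderivs_diff[OF schwartz_cmult[OF \<phi>] S bs', of c] pderivs_cmult[OF \<phi> bs', of c] by simp
      then have "(1 + norm x) ^ N * norm (pderivs bs ?\<chi> x) \<le> (1 + norm x) ^ N *
          (norm (conv (pderivs bs \<kappa>) \<phi> x - (\<Sum>z\<in>D. d z * pderivs bs \<kappa> (x - z))) +
           norm (conv (pderivs bs \<phi>) \<kappa> x - c * pderivs bs \<phi> x))"
        by (simp only:) (intro mult_left_mono norm_triangle_ineq4; simp)
      also have "\<dots> \<le> e + e"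
        unfolding ring_distribs using D(2)[OF imageI[OF bs]] m(2)[OF imageI[OF bs]]
        by (intro add_mono) (auto simp: \<kappa>_def)
      finally show ?thesis by simp
    qed
    then have "schwartz_seminorm N ?\<chi> \<le> (\<Sum>bs\<in>(multi_indices N :: 'a list set). 2 * e)"
      by (intro schwartz_seminorm_le) auto
    then have "norm (T ?\<chi>) \<le> C * (K * (2 * e))"
      using C(2)[OF \<chi>] C(1) by (auto simp: K_def intro: order_trans)
    moreover have "T ?\<chi> = c * T \<phi>"
      using tempered_diff[OF T schwartz_cmult[OF \<phi>] S, of c] tempered_cmult[OF T \<phi>, of c] TS by simp
    ultimately show ?thesis by simp
  qed
  note bound = this
  have "norm (c * T \<phi>) \<le> 0"
  proof (rule field_le_epsilon)
    fix e :: real assume e: "e > 0"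
    have K: "K \<ge> 0" by (simp add: K_def)
    \<comment> \<open>This argument of \<open>bound\<close> leaves
      \<open>e * (K / (K + 1))\<close>.\<close>
    have "norm (c * T \<phi>) \<le> C * (K * (2 * (e / (2 * C * (K + 1)))))"
      using e C(1) K by (intro bound) auto
    also have "\<dots> = e * (K / (K + 1))" using C(1) by simp
    also have "\<dots> \<le> e * 1" using e K by (intro mult_left_mono) auto
    finally show "norm (c * T \<phi>) \<le> 0 + e" by simp
  qed
  moreover have "c \<noteq> 0" unfolding c_def by (rule gaussian_integral_pos)
  ultimately show ?thesis by simp
qed

section \<open>Invariant sesquilinear forms on the Schwartz space\<close>

text \<open>The transpose of \<open>modtrans\<close> (see \<open>modtrans_tf_shift\<close>):
  invariance of an inner product on distributions becomes invariance of a form on test functions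
  under \<open>tf_shift\<close>.\<close>

definition tf_shift :: "'a::euclidean_space \<Rightarrow> 'a \<Rightarrow> ('a \<Rightarrow> complex) \<Rightarrow> 'a \<Rightarrow> complex" where
  "tf_shift x \<xi> \<phi> z = exp (\<i> * complex_of_real ((z + x) \<bullet> \<xi>)) * \<phi> (z + x)"

lemma schwartz_tf_shift: "schwartz \<phi> \<Longrightarrow> schwartz (tf_shift x \<xi> \<phi>)"
  unfolding tf_shift_def[abs_def]
  using schwartz_shift[OF schwartz_modulate, of \<phi> x \<xi>] by simp

lemma polyfun_quadratic:
  "polyfun (\<lambda>x. \<alpha> * complex_of_real (x \<bullet> x) + \<beta> * complex_of_real (x \<bullet> u) + \<delta>)"
  by (intro poly_family.add poly_family.mult poly_family_constant polyfun_inner_self poly_family.coord)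

text \<open>The complex coefficients cover all later uses: modulation (\<open>\<beta> = \<i>\<close>
  or \<open>- \<i>\<close>), translation (\<open>\<beta> = - a\<close>), and a change of both
  Gaussian parameters (\<open>\<alpha> = - (r - a) / 2\<close>, \<open>\<beta> = 1\<close>).\<close>

lemma tempered_gaussian_derivative_quadratic:
  fixes \<alpha> \<beta> \<delta> :: complex and u :: "'a::euclidean_space"
  defines "A \<equiv> \<lambda>x. \<alpha> * complex_of_real (x \<bullet> x) + \<beta> * complex_of_real (x \<bullet> u) + \<delta>"
  assumes "tempered T" "a > 0" "polyfun P"
  shows "((\<lambda>t. T (\<lambda>x. P x * exp (of_real t * A x) * gaussian a v x)) has_vector_derivative
           T (\<lambda>x. A x * P x * gaussian a v x)) (at 0)"
proof (rule tempered_gaussian_derivative[OF assms(2-4)])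
  show "polyfun A" unfolding A_def by (rule polyfun_quadratic)
  fix x :: 'a
  have "norm (A x) \<le> norm \<alpha> * (norm x)\<^sup>2 + norm \<beta> * (norm x * norm u) + norm \<delta>"
    unfolding A_def
    by (intro norm_triangle_mono order_refl)
       (auto simp: norm_mult power2_norm_eq_inner intro!: mult_left_mono Cauchy_Schwarz_ineq2)
  also have "\<dots> \<le> norm \<alpha> * (1 + norm x)\<^sup>2 + norm \<beta> * ((1 + norm x)\<^sup>2 * norm u) + norm \<delta> * (1 + norm x)\<^sup>2"
  proof -
    have "norm x \<le> (1 + norm x)\<^sup>2" "(norm x)\<^sup>2 \<le> (1 + norm x)\<^sup>2" "1 \<le> (1 + norm x)\<^sup>2"
      by (auto simp: power2_eq_square algebra_simps)
    then show ?thesis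
      using mult_left_mono[of 1 "(1 + norm x)\<^sup>2" "norm \<delta>"] by (intro add_mono mult_left_mono mult_right_mono) auto
  qed
  finally show "norm (A x) \<le> (norm \<alpha> + norm \<beta> * norm u + norm \<delta>) * (1 + norm x)\<^sup>2"
    by (simp add: algebra_simps)
qed

text \<open>The factor that is quadratic in \<open>t\<close> has derivative 0 at
  \<open>t = 0\<close>; the rest, with its vanishing quadratic term spelled out, has exactly the
  form of \<open>tempered_gaussian_derivative_quadratic\<close>.\<close>

lemma gaussian_translate:
  "gaussian a v (x + t *\<^sub>R u) =
     exp (complex_of_real (- a / 2 * (u \<bullet> u) * t\<^sup>2)) *
     (exp (of_real t * (0 * complex_of_real (x \<bullet> x) + complex_of_real (- a) * complex_of_real (x \<bullet> u) + complex_of_real (u \<bullet> v)))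
      * gaussian a v x)"
proof -
  have eq: "of_real t * (0 * complex_of_real (x \<bullet> x) + complex_of_real (- a) * complex_of_real (x \<bullet> u) + complex_of_real (u \<bullet> v)) =
      complex_of_real (t * (- a * (x \<bullet> u) + u \<bullet> v))" by simp
  show ?thesis
    unfolding gaussian_def eq exp_add[symmetric] of_real_add[symmetric]
    by (intro arg_cong[where f = exp] arg_cong[where f = complex_of_real])
       (simp add: inner_simps inner_commute algebra_simps power2_eq_square)
qed

lemma gaussian_exp_linear:
  "exp (of_real t * (0 * complex_of_real (x \<bullet> x) + 1 * complex_of_real (x \<bullet> u) + 0)) * gaussian a v x = gaussian a (v + t *\<^sub>R u) x"
proof -
  have eq: "of_real t * (0 * complex_of_real (x \<bullet> x) + 1 * complex_of_real (x \<bullet> u) + 0) = complex_of_real (t * (x \<bullet> u))" by simp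
  show ?thesis
    unfolding gaussian_def eq exp_add[symmetric] of_real_add[symmetric]
    by (intro arg_cong[where f = exp] arg_cong[where f = complex_of_real]) (simp add: inner_simps)
qed

lemma gaussian_exp_quadratic:
  "exp (of_real t * (complex_of_real (- r / 2) * complex_of_real (x \<bullet> x) + 1 * complex_of_real (x \<bullet> u) + 0)) * gaussian a v x
    = gaussian (a + t * r) (v + t *\<^sub>R u) x"
proof -
  have eq: "of_real t * (complex_of_real (- r / 2) * complex_of_real (x \<bullet> x) + 1 * complex_of_real (x \<bullet> u) + 0) =
     complex_of_real (t * (- r / 2 * (x \<bullet> x) + x \<bullet> u))" by simp
  show ?thesis
    unfolding gaussian_def eq exp_add[symmetric] of_real_add[symmetric]
    by (intro arg_cong[where f = exp] arg_cong[where f = complex_of_real]) (simp add: inner_simps field_simps)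
qed

lemma has_vector_derivative_exp_square_0:
  "((\<lambda>t. exp (complex_of_real (c * t\<^sup>2))) has_vector_derivative 0) (at 0)"
proof -
  have "((\<lambda>t. exp (c * t\<^sup>2)) has_real_derivative 0) (at 0)"
    by (auto intro!: derivative_eq_intros)
  then have "((\<lambda>t. complex_of_real (exp (c * t\<^sup>2))) has_vector_derivative complex_of_real 0) (at 0)"
    by (rule has_vector_derivative_of_real[unfolded has_real_derivative_iff_has_vector_derivative[symmetric]])
  then show ?thesis by (simp only: exp_of_real of_real_0)
qed

text \<open>Continuity is asked for each fixed second argument; conjugate linearity in that argument
  comes from \<open>hermitian\<close>. The axioms survive real linear combinations, so they apply to
  the difference of \<open>B\<close> and a multiple of the L^2 product.\<close>

locale invariant_form =
  fixes B :: "('a::euclidean_space \<Rightarrow> complex) \<Rightarrow> ('a \<Rightarrow> complex) \<Rightarrow> complex"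
  assumes tempered: "schwartz \<psi> \<Longrightarrow> tempered (\<lambda>\<phi>. B \<phi> \<psi>)"
    and hermitian: "schwartz \<phi> \<Longrightarrow> schwartz \<psi> \<Longrightarrow> B \<phi> \<psi> = cnj (B \<psi> \<phi>)"
    and invariant: "schwartz \<phi> \<Longrightarrow> schwartz \<psi> \<Longrightarrow> B (tf_shift x \<xi> \<phi>) (tf_shift x \<xi> \<psi>) = B \<phi> \<psi>"
begin

lemma B_cmult_left: "schwartz \<phi> \<Longrightarrow> schwartz \<psi> \<Longrightarrow> B (\<lambda>x. c * \<phi> x) \<psi> = c * B \<phi> \<psi>"
  using tempered_cmult[OF tempered] by blast

lemma B_cmult_right: "schwartz \<phi> \<Longrightarrow> schwartz \<psi> \<Longrightarrow> B \<phi> (\<lambda>x. c * \<psi> x) = cnj c * B \<phi> \<psi>"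
  using hermitian[of \<phi> \<psi>] hermitian[of \<phi> "\<lambda>x. c * \<psi> x"] B_cmult_left[of \<psi> \<phi> c] by (simp add: schwartz_cmult)

lemma B_modulate_adjoint:
  assumes "schwartz \<phi>" "schwartz \<psi>"
  shows "B (\<lambda>x. exp (\<i> * complex_of_real (x \<bullet> \<xi>)) * \<phi> x) \<psi> = B \<phi> (\<lambda>x. exp (\<i> * complex_of_real (x \<bullet> (- \<xi>))) * \<psi> x)"
proof -
  have "B (tf_shift 0 \<xi> \<phi>) (tf_shift 0 \<xi> (\<lambda>x. exp (\<i> * complex_of_real (x \<bullet> (- \<xi>))) * \<psi> x)) =
      B \<phi> (\<lambda>x. exp (\<i> * complex_of_real (x \<bullet> (- \<xi>))) * \<psi> x)"
    by (intro invariant assms schwartz_modulate)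
  moreover have "tf_shift 0 \<xi> (\<lambda>x. exp (\<i> * complex_of_real (x \<bullet> (- \<xi>))) * \<psi> x) = \<psi>"
    by (simp add: tf_shift_def[abs_def] mult.assoc[symmetric] exp_add[symmetric])
  ultimately show ?thesis by (simp add: tf_shift_def[abs_def])
qed

lemma B_translate_adjoint:
  assumes "schwartz \<phi>" "schwartz \<psi>"
  shows "B (\<lambda>x. \<phi> (x + a)) \<psi> = B \<phi> (\<lambda>x. \<psi> (x + - a))"
proof -
  have "B (tf_shift a 0 \<phi>) (tf_shift a 0 (\<lambda>x. \<psi> (x + - a))) = B \<phi> (\<lambda>x. \<psi> (x + - a))"
    by (intro invariant assms schwartz_shift)
  then show ?thesis by (simp add: tf_shift_def[abs_def])
qed

lemma schwartz_coord_gaussian: "a > 0 \<Longrightarrow> schwartz (\<lambda>x. complex_of_real (x \<bullet> u) * gaussian a v x)"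
  by (intro schwartz_poly_gaussian poly_family.coord)

text \<open>Differentiate \<open>B_modulate_adjoint\<close> along \<open>\<xi> = t u\<close> at 0.
  The factor \<open>\<i>\<close> on the left meets the conjugate of \<open>- \<i>\<close> on the
  right and cancels.\<close>

lemma B_coord_adjoint:
  assumes "a > 0" "s > 0"
  shows "B (\<lambda>x. complex_of_real (x \<bullet> u) * gaussian a v x) (gaussian s w) =
         B (gaussian a v) (\<lambda>x. complex_of_real (x \<bullet> u) * gaussian s w x)"
proof -
  let ?q = "gaussian a v" and ?g = "gaussian s w"
  have S: "schwartz ?q" "schwartz ?g" using assms by (auto intro: schwartz_gaussian)
  have d1: "((\<lambda>t. B (\<lambda>x. exp (\<i> * complex_of_real (x \<bullet> (t *\<^sub>R u))) * ?q x) ?g) has_vector_derivative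
      \<i> * B (\<lambda>x. complex_of_real (x \<bullet> u) * ?q x) ?g) (at 0)"
    using tempered_gaussian_derivative_quadratic[OF tempered[OF S(2)] assms(1) poly_family_constant[of _ 1], of 0 \<i> u 0 v]
    by (simp add: mult.left_commute mult.assoc B_cmult_left[OF schwartz_coord_gaussian[OF assms(1)] S(2)])
  have d2: "((\<lambda>t. B (\<lambda>x. exp (\<i> * complex_of_real (x \<bullet> (- (t *\<^sub>R u)))) * ?g x) ?q) has_vector_derivative
      - \<i> * B (\<lambda>x. complex_of_real (x \<bullet> u) * ?g x) ?q) (at 0)"
    using tempered_gaussian_derivative_quadratic[OF tempered[OF S(1)] assms(2) poly_family_constant[of _ 1], of 0 "- \<i>" u 0 w]
      B_cmult_left[OF schwartz_coord_gaussian[OF assms(2), of u w] S(1), of "- \<i>"]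
    by (simp add: mult.left_commute mult.assoc)
  have eq: "(\<lambda>t. B (\<lambda>x. exp (\<i> * complex_of_real (x \<bullet> (t *\<^sub>R u))) * ?q x) ?g) =
      (\<lambda>t. cnj (B (\<lambda>x. exp (\<i> * complex_of_real (x \<bullet> (- (t *\<^sub>R u)))) * ?g x) ?q))"
    by (intro ext) (subst B_modulate_adjoint[OF S], rule hermitian[OF S(1) schwartz_modulate[OF S(2)]])
  have
    "\<i> * B (\<lambda>x. complex_of_real (x \<bullet> u) * ?q x) ?g = cnj (- \<i> * B (\<lambda>x. complex_of_real (x \<bullet> u) * ?g x) ?q)"
    by (rule vector_derivative_unique_at[OF d1[unfolded eq] has_vector_derivative_cnj[OF d2]])
  then show ?thesis
    using hermitian[OF S(1) schwartz_coord_gaussian[OF assms(2), of u w]] by simp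
qed

text \<open>Differentiate translation invariance in direction \<open>u\<close>. The left side
  produces \<open>(- a (x \<bullet> u) + u \<bullet> v)\<close> times the first Gaussian, the right
  side \<open>s (x \<bullet> u)\<close> times it, after \<open>B_coord_adjoint\<close> has moved the
  coordinate across. So a first moment is expressed by the zeroth one.\<close>

lemma B_coord_gaussian:
  assumes "a > 0" "s > 0"
  shows "of_real (s + a) * B (\<lambda>x. complex_of_real (x \<bullet> u) * gaussian a v x) (gaussian s 0) =
         of_real (u \<bullet> v) * B (gaussian a v) (gaussian s 0)"
proof -
  let ?q = "gaussian a v" and ?g = "gaussian s (0::'a)"
  let ?xq = "\<lambda>x. complex_of_real (x \<bullet> u) * ?q x" and ?xg = "\<lambda>x. complex_of_real (x \<bullet> u) * ?g x"
  have S: "schwartz ?q" "schwartz ?g" "schwartz ?xq" "schwartz ?xg"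
    using assms by (auto intro: schwartz_gaussian schwartz_coord_gaussian)
  let ?E = "\<lambda>a v t x. exp (of_real t * (0 * complex_of_real (x \<bullet> x) + complex_of_real (- a) * complex_of_real (x \<bullet> u) + complex_of_real (u \<bullet> v))) * gaussian a v x"
  have tr: "((\<lambda>t. B (\<lambda>x. gaussian a v (x + t *\<^sub>R u)) \<psi>) has_vector_derivative
      - of_real a * B (\<lambda>x. complex_of_real (x \<bullet> u) * gaussian a v x) \<psi> + of_real (u \<bullet> v) * B (gaussian a v) \<psi>) (at 0)"
    if "a > 0" "schwartz \<psi>" for a v \<psi>
  proof -
    have S': "schwartz (\<lambda>x. complex_of_real (x \<bullet> u) * gaussian a v x)" "schwartz (gaussian a v)"
      using that by (auto intro: schwartz_gaussian schwartz_coord_gaussian)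
    have "schwartz (?E a v t)" for t
    proof -
      have "?E a v t = (\<lambda>x. exp (- complex_of_real (- a / 2 * (u \<bullet> u) * t\<^sup>2)) * gaussian a v (x + t *\<^sub>R u))"
        unfolding gaussian_translate mult.assoc[symmetric] exp_add[symmetric] by simp
      then show ?thesis using schwartz_cmult[OF schwartz_shift[OF S'(2)]] by simp
    qed
    then have eq: "(\<lambda>t. B (\<lambda>x. gaussian a v (x + t *\<^sub>R u)) \<psi>) =
        (\<lambda>t. exp (complex_of_real (- a / 2 * (u \<bullet> u) * t\<^sup>2)) * B (?E a v t) \<psi>)"
      unfolding gaussian_translate using B_cmult_left that(2) by blast
    have d: "((\<lambda>t. B (?E a v t) \<psi>) has_vector_derivative
        B (\<lambda>x. (0 * complex_of_real (x \<bullet> x) + complex_of_real (- a) * complex_of_real (x \<bullet> u) + complex_of_real (u \<bullet> v)) * 1 * gaussian a v x) \<psi>) (at 0)"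
      using tempered_gaussian_derivative_quadratic[OF tempered[OF that(2)] that(1) poly_family_constant[of _ 1],
          of 0 "complex_of_real (- a)" u "complex_of_real (u \<bullet> v)" v] by simp
    have val: "B (\<lambda>x. (0 * complex_of_real (x \<bullet> x) + complex_of_real (- a) * complex_of_real (x \<bullet> u) + complex_of_real (u \<bullet> v)) * 1 * gaussian a v x) \<psi> =
       - of_real a * B (\<lambda>x. complex_of_real (x \<bullet> u) * gaussian a v x) \<psi> + of_real (u \<bullet> v) * B (gaussian a v) \<psi>"
      using tempered_add[OF tempered[OF that(2)] schwartz_cmult[OF S'(1), of "- of_real a"] schwartz_cmult[OF S'(2), of "of_real (u \<bullet> v)"]]
        B_cmult_left[OF S'(1) that(2), of "- of_real a"] B_cmult_left[OF S'(2) that(2), of "of_real (u \<bullet> v)"]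
      by (simp add: algebra_simps)
    show ?thesis
      unfolding eq using has_vector_derivative_mult[OF has_vector_derivative_exp_square_0[of "- a / 2 * (u \<bullet> u)"] d]
      unfolding val by simp
  qed
  have d1: "((\<lambda>t. B (\<lambda>x. ?q (x + t *\<^sub>R u)) ?g) has_vector_derivative - of_real a * B ?xq ?g + of_real (u \<bullet> v) * B ?q ?g) (at 0)"
    by (rule tr[OF assms(1) S(2)])
  have "((\<lambda>t. B (\<lambda>x. ?g (x + t *\<^sub>R u)) ?q) has_vector_derivative - of_real s * B ?xg ?q) (at 0)"
    using tr[OF assms(2) S(1), of 0] by simp
  then have "((\<lambda>t. B (\<lambda>x. ?g (x + t *\<^sub>R u)) ?q) has_vector_derivative - of_real s * B ?xg ?q) (at (- 0))" by simp
  then have "((\<lambda>t. B (\<lambda>x. ?g (x + t *\<^sub>R u)) ?q) \<circ> uminus has_vector_derivative (- 1) *\<^sub>R (- of_real s * B ?xg ?q)) (at 0)"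
    by (intro vector_diff_chain_at) (auto intro!: derivative_eq_intros)
  then have d2: "((\<lambda>t. B (\<lambda>x. ?g (x + (- t) *\<^sub>R u)) ?q) has_vector_derivative of_real s * B ?xg ?q) (at 0)"
    by (simp add: o_def)
  have eq: "(\<lambda>t. B (\<lambda>x. ?q (x + t *\<^sub>R u)) ?g) = (\<lambda>t. cnj (B (\<lambda>x. ?g (x + (- t) *\<^sub>R u)) ?q))"
    unfolding scaleR_minus_left
    by (intro ext) (subst B_translate_adjoint[OF S(1,2)], rule hermitian[OF S(1) schwartz_shift[OF S(2)]])
  have
    "- of_real a * B ?xq ?g + of_real (u \<bullet> v) * B ?q ?g = cnj (of_real s * B ?xg ?q)"
    by (rule vector_derivative_unique_at[OF d1[unfolded eq] has_vector_derivative_cnj[OF d2]])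
  also have "\<dots> = of_real s * B ?xq ?g"
    using hermitian[OF S(1,4)] B_coord_adjoint[OF assms, of u v 0] by simp
  finally show ?thesis by (simp add: algebra_simps)
qed

text \<open>Differentiate \<open>B_coord_gaussian\<close> with respect to \<open>v\<close> in
  direction \<open>u\<close>: each derivative of a Gaussian in \<open>v\<close> brings down one more
  coordinate.\<close>

lemma B_coord_square_gaussian:
  assumes "a > 0" "s > 0"
  shows "of_real (s + a) * B (\<lambda>x. complex_of_real (x \<bullet> u) * complex_of_real (x \<bullet> u) * gaussian a v x) (gaussian s 0) =
         of_real (u \<bullet> u) * B (gaussian a v) (gaussian s 0) +
         of_real (u \<bullet> v) * B (\<lambda>x. complex_of_real (x \<bullet> u) * gaussian a v x) (gaussian s 0)"
proof -
  let ?g = "gaussian s (0::'a)"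
  have g: "schwartz ?g" using assms by (auto intro: schwartz_gaussian)
  have d1: "((\<lambda>t. B (\<lambda>x. complex_of_real (x \<bullet> u) * gaussian a (v + t *\<^sub>R u) x) ?g) has_vector_derivative
      B (\<lambda>x. complex_of_real (x \<bullet> u) * complex_of_real (x \<bullet> u) * gaussian a v x) ?g) (at 0)"
    using tempered_gaussian_derivative_quadratic[OF tempered[OF g] assms(1) poly_family.coord[of _ u], of 0 1 u 0 v]
    unfolding mult.assoc gaussian_exp_linear by simp
  have d2: "((\<lambda>t. B (gaussian a (v + t *\<^sub>R u)) ?g) has_vector_derivative
      B (\<lambda>x. complex_of_real (x \<bullet> u) * gaussian a v x) ?g) (at 0)"
    using tempered_gaussian_derivative_quadratic[OF tempered[OF g] assms(1) poly_family_constant[of _ 1], of 0 1 u 0 v]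
    unfolding mult.assoc gaussian_exp_linear by simp
  have d3: "((\<lambda>t. complex_of_real (u \<bullet> (v + t *\<^sub>R u))) has_vector_derivative of_real (u \<bullet> u)) (at 0)"
  proof (rule has_vector_derivative_of_real[unfolded has_real_derivative_iff_has_vector_derivative[symmetric]])
    show "((\<lambda>t. u \<bullet> (v + t *\<^sub>R u)) has_real_derivative u \<bullet> u) (at 0)"
      by (auto simp: inner_simps intro!: derivative_eq_intros)
  qed
  have "((\<lambda>t. of_real (u \<bullet> (v + t *\<^sub>R u)) * B (gaussian a (v + t *\<^sub>R u)) ?g) has_vector_derivative
     of_real (u \<bullet> v) * B (\<lambda>x. complex_of_real (x \<bullet> u) * gaussian a v x) ?g + of_real (u \<bullet> u) * B (gaussian a v) ?g) (at 0)"
    using has_vector_derivative_mult[OF d3 d2] by simp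
  moreover have "((\<lambda>t. of_real (s + a) * B (\<lambda>x. complex_of_real (x \<bullet> u) * gaussian a (v + t *\<^sub>R u) x) ?g) has_vector_derivative
     of_real (s + a) * B (\<lambda>x. complex_of_real (x \<bullet> u) * complex_of_real (x \<bullet> u) * gaussian a v x) ?g) (at 0)"
    by (rule has_vector_derivative_mult_right[OF d1])
  ultimately have "of_real (s + a) * B (\<lambda>x. complex_of_real (x \<bullet> u) * complex_of_real (x \<bullet> u) * gaussian a v x) ?g =
     of_real (u \<bullet> v) * B (\<lambda>x. complex_of_real (x \<bullet> u) * gaussian a v x) ?g + of_real (u \<bullet> u) * B (gaussian a v) ?g"
    unfolding B_coord_gaussian[OF assms] by (rule vector_derivative_unique_at[rotated])
  then show ?thesis by simp
qed

text \<open>On the straight path from \<open>(a, 0)\<close> to \<open>(r, v)\<close> the derivative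
  of the pairing involves only the moments of \<open>norm x\<close> squared and of
  \<open>x \<bullet> v\<close>. Both are real multiples of the pairing itself, so a zero at the
  start persists.\<close>

lemma B_gaussian_propagate:
  assumes pos: "a > 0" "r > 0" "s > 0" and zero: "B (gaussian a 0) (gaussian s 0) = 0"
  shows "B (gaussian r v) (gaussian s 0) = 0"
proof -
  let ?g = "gaussian s (0::'a)"
  have g: "schwartz ?g" using pos by (auto intro: schwartz_gaussian)
  define \<alpha> where "\<alpha> t = a + t * (r - a)" for t
  have \<alpha>: "\<alpha> t > 0" if "t \<in> {0..1}" for t
  proof -
    have "\<alpha> t = (1 - t) * a + t * r" by (simp add: \<alpha>_def algebra_simps)
    moreover have "(1 - t) * a + t * r > 0"
      using that pos by (cases "t = 0") (auto intro!: add_nonneg_pos)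
    ultimately show ?thesis by simp
  qed
  define U where "U t = B (gaussian (\<alpha> t) (t *\<^sub>R v)) ?g" for t
  \<comment> \<open>The first summand sums the second moments over the basis, which is where the
    dimension enters; the second is the moment of \<open>x \<bullet> v\<close>.\<close>
  define \<kappa> where "\<kappa> t = - (r - a) / 2 * ((DIM('a) + t\<^sup>2 * (v \<bullet> v) / (s + \<alpha> t)) / (s + \<alpha> t)) + t * (v \<bullet> v) / (s + \<alpha> t)" for t
  have dU: "(U has_vector_derivative of_real (\<kappa> t) * U t) (at t)" if t: "t \<in> {0..1}" for t
  proof -
    let ?q = "gaussian (\<alpha> t) (t *\<^sub>R v)"
    note at = \<alpha>[OF t]
    have sa: "s + \<alpha> t \<noteq> 0" "s + \<alpha> t > 0" using at pos by auto
    have q: "schwartz ?q" using at by (rule schwartz_gaussian)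
    have x1: "B (\<lambda>x. complex_of_real (x \<bullet> u) * ?q x) ?g = of_real (t * (u \<bullet> v) / (s + \<alpha> t)) * U t" for u
      using B_coord_gaussian[OF at pos(3), of u "t *\<^sub>R v"] sa
      by (simp add: U_def field_simps of_real_add[symmetric] del: of_real_add)
    have x2: "B (\<lambda>x. complex_of_real (x \<bullet> b) * complex_of_real (x \<bullet> b) * ?q x) ?g =
        of_real ((1 + t\<^sup>2 * (v \<bullet> b)\<^sup>2 / (s + \<alpha> t)) / (s + \<alpha> t)) * U t" (is "?X = of_real (?y / _) * _")
      if "b \<in> Basis" for b
    proof -
      have "of_real (s + \<alpha> t) * ?X = of_real (b \<bullet> b) * U t + of_real (b \<bullet> (t *\<^sub>R v)) * (of_real (t * (b \<bullet> v) / (s + \<alpha> t)) * U t)"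
        using B_coord_square_gaussian[OF at pos(3), of b "t *\<^sub>R v"] unfolding x1 U_def[symmetric] .
      also have "\<dots> = of_real (b \<bullet> b + (b \<bullet> (t *\<^sub>R v)) * (t * (b \<bullet> v) / (s + \<alpha> t))) * U t"
        by (simp only: of_real_add of_real_mult ring_distribs mult.assoc)
      also have "b \<bullet> b + (b \<bullet> (t *\<^sub>R v)) * (t * (b \<bullet> v) / (s + \<alpha> t)) = (s + \<alpha> t) * (?y / (s + \<alpha> t))"
        using that sa by (simp add: power2_eq_square inner_commute)
      finally have "of_real (s + \<alpha> t) * ?X = of_real (s + \<alpha> t) * (of_real (?y / (s + \<alpha> t)) * U t)"
        by (simp only: of_real_mult mult.assoc)
      then show ?thesis using sa(1) by (simp only: mult_cancel_left of_real_eq_0_iff) simp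
    qed
    have xs: "schwartz (\<lambda>x. complex_of_real (x \<bullet> b) * complex_of_real (x \<bullet> b) * ?q x)" for b
      by (intro schwartz_poly_gaussian at poly_family.mult poly_family.coord)
    have "(\<lambda>x. complex_of_real (x \<bullet> x) * ?q x) = (\<lambda>x. \<Sum>b\<in>Basis. complex_of_real (x \<bullet> b) * complex_of_real (x \<bullet> b) * ?q x)"
      by (subst euclidean_inner) (simp add: sum_distrib_right)
    then have "B (\<lambda>x. complex_of_real (x \<bullet> x) * ?q x) ?g =
       (\<Sum>b\<in>Basis. B (\<lambda>x. complex_of_real (x \<bullet> b) * complex_of_real (x \<bullet> b) * ?q x) ?g)"
      using tempered_sum[OF tempered[OF g] xs] by simp
    also have "\<dots> = (\<Sum>b\<in>(Basis::'a set). of_real ((1 + t\<^sup>2 * (v \<bullet> b)\<^sup>2 / (s + \<alpha> t)) / (s + \<alpha> t)) * U t)"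
      by (intro sum.cong x2) auto
    also have "\<dots> = of_real ((DIM('a) + t\<^sup>2 * (v \<bullet> v) / (s + \<alpha> t)) / (s + \<alpha> t)) * U t"
    proof -
      have "(\<Sum>b\<in>(Basis::'a set). (1 + t\<^sup>2 * (v \<bullet> b)\<^sup>2 / (s + \<alpha> t)) / (s + \<alpha> t)) =
          (DIM('a) + t\<^sup>2 * (\<Sum>b\<in>(Basis::'a set). (v \<bullet> b)\<^sup>2) / (s + \<alpha> t)) / (s + \<alpha> t)"
        by (simp add: sum_divide_distrib[symmetric] sum.distrib sum_distrib_left[symmetric])
      also have "(\<Sum>b\<in>(Basis::'a set). (v \<bullet> b)\<^sup>2) = v \<bullet> v"
        using euclidean_inner[of v v] by (simp add: power2_eq_square)
      finally show ?thesis unfolding sum_distrib_right[symmetric] of_real_sum[symmetric] by simp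
    qed
    finally have x3: "B (\<lambda>x. complex_of_real (x \<bullet> x) * ?q x) ?g =
        of_real ((DIM('a) + t\<^sup>2 * (v \<bullet> v) / (s + \<alpha> t)) / (s + \<alpha> t)) * U t" .
    have d: "((\<lambda>h. B (gaussian (\<alpha> t + h * (r - a)) (t *\<^sub>R v + h *\<^sub>R v)) ?g) has_vector_derivative
       B (\<lambda>x. (complex_of_real (- (r - a) / 2) * complex_of_real (x \<bullet> x) + 1 * complex_of_real (x \<bullet> v) + 0) * 1 * ?q x) ?g) (at 0)"
      using tempered_gaussian_derivative_quadratic[OF tempered[OF g] at poly_family_constant[of _ 1],
          of "complex_of_real (- (r - a) / 2)" 1 v 0 "t *\<^sub>R v"]
      unfolding mult_1_left gaussian_exp_quadratic[of _ "r - a", unfolded mult_1_left] by simp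
    have s1: "schwartz (\<lambda>x. complex_of_real (x \<bullet> x) * ?q x)"
      by (intro schwartz_poly_gaussian at polyfun_inner_self)
    have s2: "schwartz (\<lambda>x. complex_of_real (x \<bullet> v) * ?q x)" by (rule schwartz_coord_gaussian[OF at])
    have "B (\<lambda>x. (complex_of_real (- (r - a) / 2) * complex_of_real (x \<bullet> x) + 1 * complex_of_real (x \<bullet> v) + 0) * 1 * ?q x) ?g =
        B (\<lambda>x. complex_of_real (- (r - a) / 2) * (complex_of_real (x \<bullet> x) * ?q x) + complex_of_real (x \<bullet> v) * ?q x) ?g"
      by (simp add: algebra_simps)
    also have "\<dots> = complex_of_real (- (r - a) / 2) * B (\<lambda>x. complex_of_real (x \<bullet> x) * ?q x) ?g + B (\<lambda>x. complex_of_real (x \<bullet> v) * ?q x) ?g"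
      by (subst tempered_add[OF tempered[OF g] schwartz_cmult[OF s1] s2]) (subst B_cmult_left[OF s1 g], rule refl)
    also have "\<dots> = of_real (\<kappa> t) * U t"
      unfolding x1 x3 \<kappa>_def by (simp only: of_real_add of_real_mult ring_distribs mult.assoc)
    finally have val: "B (\<lambda>x. (complex_of_real (- (r - a) / 2) * complex_of_real (x \<bullet> x) + 1 * complex_of_real (x \<bullet> v) + 0) * 1 * ?q x) ?g
        = of_real (\<kappa> t) * U t" .
    have "((\<lambda>h. U (t + h)) has_vector_derivative of_real (\<kappa> t) * U t) (at 0)"
      using d unfolding val by (simp add: U_def \<alpha>_def algebra_simps)
    then have "((\<lambda>h. U (t + h)) has_vector_derivative of_real (\<kappa> t) * U t) (at (t + - t))" by simp
    then have "((\<lambda>h. U (t + h)) \<circ> (\<lambda>h. h + - t) has_vector_derivative 1 *\<^sub>R (of_real (\<kappa> t) * U t)) (at t)"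
      by (intro vector_diff_chain_at) (auto intro!: derivative_eq_intros)
    then show ?thesis by (simp add: o_def)
  qed
  have c\<alpha>: "continuous_on {0..1} \<alpha>" unfolding \<alpha>_def by (intro continuous_intros)
  have nz: "\<forall>t\<in>{0..1}. s + \<alpha> t \<noteq> 0" using \<alpha> pos by (metis add_pos_pos less_irrefl)
  have "continuous_on {0..1} \<kappa>"
    unfolding \<kappa>_def by (intro continuous_intros c\<alpha> nz) auto
  \<comment> \<open>\<open>G\<close> yields the integrating factor \<open>exp (- G t)\<close>, which
    makes the product with \<open>U\<close> constant.\<close>
  then obtain G where G: "\<And>t. t \<in> {0..1} \<Longrightarrow> (G has_vector_derivative \<kappa> t) (at t within {0..1})"
    using antiderivative_continuous by blast
  have "((\<lambda>t. complex_of_real (exp (- G t)) * U t) has_vector_derivative 0) (at t within {0..1})" if t: "t \<in> {0..1}" for t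
  proof -
    have "((\<lambda>t. exp (- G t)) has_real_derivative - \<kappa> t * exp (- G t)) (at t within {0..1})"
      using G[OF t, unfolded has_real_derivative_iff_has_vector_derivative[symmetric]]
      by (auto intro!: derivative_eq_intros)
    then have "((\<lambda>t. complex_of_real (exp (- G t))) has_vector_derivative of_real (- \<kappa> t * exp (- G t))) (at t within {0..1})"
      by (rule has_vector_derivative_of_real[unfolded has_real_derivative_iff_has_vector_derivative[symmetric]])
    from has_vector_derivative_mult[OF this has_vector_derivative_at_within[OF dU[OF t]]]
    show ?thesis by (simp add: algebra_simps)
  qed
  then obtain c where "\<And>t. t \<in> {0..1} \<Longrightarrow> complex_of_real (exp (- G t)) * U t = c"
    by (rule has_vector_derivative_zero_constant[rotated]) auto
  then have "complex_of_real (exp (- G 1)) * U 1 = complex_of_real (exp (- G 0)) * U 0" by auto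
  moreover have "U 0 = 0" using zero by (simp add: U_def \<alpha>_def)
  ultimately have "U 1 = 0" by simp
  then show ?thesis by (simp add: U_def \<alpha>_def)
qed

text \<open>Propagation alters only the first Gaussian, so \<open>s\<close> in the second slot is
  reached by swapping the arguments. Density frees the first argument against centred Gaussians;
  translation invariance then handles uncentred ones, and a second use of density frees the other
  argument.\<close>

theorem B_eq_zero:
  assumes zero: "B (gaussian 1 0) (gaussian 1 0) = 0" and S: "schwartz \<phi>" "schwartz \<psi>"
  shows "B \<phi> \<psi> = 0"
proof -
  have gs: "schwartz (gaussian s w)" if "s > 0" for s and w :: 'a using that by (rule schwartz_gaussian)
  have "B (gaussian 1 0) (gaussian s 0) = 0" if "s > 0" for s
    using B_gaussian_propagate[of 1 s 1 0] hermitian[OF gs gs, of 1 s 0 0] zero that by simp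
  then have "B (gaussian r v) (gaussian s 0) = 0" if "r > 0" "s > 0" for r s v
    using B_gaussian_propagate[of 1 r s v] that by simp
  then have 1: "B \<phi> (gaussian s 0) = 0" if "s > 0" "schwartz \<phi>" for s \<phi>
    using tempered_eq_zero_if_zero_on_gaussians[OF tempered[OF gs[OF that(1)]] _ that(2)] that(1) by blast
  have 2: "B (gaussian s v) \<psi> = 0" if "s > 0" for s v
  proof -
    \<comment> \<open>The centre of \<open>gaussian s v\<close>; \<open>c\<close> is the constant
      left after completing the square.\<close>
    define a where "a = (1 / s) *\<^sub>R v"
    define c where "c = exp (complex_of_real (s / 2 * (a \<bullet> a)))"
    have eq: "gaussian s v = (\<lambda>x. c * gaussian s 0 (x + - a))"
      unfolding gaussian_def c_def exp_add[symmetric] of_real_add[symmetric] using that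
      by (intro ext arg_cong[where f = exp] arg_cong[where f = complex_of_real])
         (simp add: a_def inner_simps inner_commute field_simps)
    have "B \<psi> (gaussian s v) = cnj c * B \<psi> (\<lambda>x. gaussian s 0 (x + - a))"
      unfolding eq by (rule B_cmult_right[OF S(2) schwartz_shift[OF gs[OF that]]])
    also have "\<dots> = cnj c * B (\<lambda>x. \<psi> (x + a)) (gaussian s 0)"
      using B_translate_adjoint[OF S(2) gs[OF that], of a] by simp
    also have "\<dots> = 0" using 1[OF that schwartz_shift[OF S(2)]] by simp
    finally show ?thesis using hermitian[OF gs[OF that] S(2)] by simp
  qed
  show ?thesis
    using tempered_eq_zero_if_zero_on_gaussians[OF tempered[OF S(2)] 2 S(1)] by blast
qed

end

section \<open>Invariant forms as multiples of the L^2 product\<close>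

lemma schwartz_seminorm_le_seminorm:
  fixes \<phi> :: "'a::euclidean_space \<Rightarrow> complex"
  assumes "schwartz \<phi>" "N \<le> M"
  shows "schwartz_seminorm N \<phi> \<le> real (card (multi_indices N :: 'a list set)) * schwartz_seminorm M \<phi>"
proof -
  have "(1 + norm x) ^ N * norm (pderivs bs \<phi> x) \<le> schwartz_seminorm M \<phi>"
    if "bs \<in> multi_indices N" for bs x
  proof -
    have "(1 + norm x) ^ N * norm (pderivs bs \<phi> x) \<le> (1 + norm x) ^ M * norm (pderivs bs \<phi> x)"
      using assms(2) by (intro mult_right_mono power_increasing) auto
    also have "\<dots> \<le> schwartz_seminorm M \<phi>"
      using that assms by (intro norm_pderivs_le_seminorm) auto
    finally show ?thesis .
  qed
  then have "schwartz_seminorm N \<phi> \<le> (\<Sum>bs\<in>(multi_indices N :: 'a list set). schwartz_seminorm M \<phi>)"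
    by (intro schwartz_seminorm_le) auto
  then show ?thesis by simp
qed

lemma tempered_add_cmult:
  assumes T: "tempered T" and S: "tempered S"
  shows "tempered (\<lambda>\<phi>. T \<phi> + c * S (\<phi> :: 'a::euclidean_space \<Rightarrow> complex))"
proof -
  obtain C N where C: "C > 0" "\<And>\<phi>. schwartz \<phi> \<Longrightarrow> norm (T \<phi>) \<le> C * schwartz_seminorm N \<phi>"
    using tempered_bound[OF T] by blast
  obtain D M where D: "D > 0" "\<And>\<phi>. schwartz \<phi> \<Longrightarrow> norm (S \<phi>) \<le> D * schwartz_seminorm M \<phi>"
    using tempered_bound[OF S] by blast
  define k where "k N = real (card (multi_indices N :: 'a list set))" for N
  have "norm (T \<phi> + c * S \<phi>) \<le> (C * k N + norm c * (D * k M)) * schwartz_seminorm (max N M) \<phi>"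
    if \<phi>: "schwartz \<phi>" for \<phi>
  proof -
    have "norm (T \<phi>) \<le> C * (k N * schwartz_seminorm (max N M) \<phi>)"
      using C(1) unfolding k_def
      by (intro order_trans[OF C(2)[OF \<phi>]] mult_left_mono schwartz_seminorm_le_seminorm \<phi>) auto
    moreover have "norm (S \<phi>) \<le> D * (k M * schwartz_seminorm (max N M) \<phi>)"
      using D(1) unfolding k_def
      by (intro order_trans[OF D(2)[OF \<phi>]] mult_left_mono schwartz_seminorm_le_seminorm \<phi>) auto
    ultimately have "norm (T \<phi>) + norm c * norm (S \<phi>) \<le>
        C * (k N * schwartz_seminorm (max N M) \<phi>) + norm c * (D * (k M * schwartz_seminorm (max N M) \<phi>))"
      by (intro add_mono mult_left_mono) auto
    moreover have "norm (T \<phi> + c * S \<phi>) \<le> norm (T \<phi>) + norm c * norm (S \<phi>)"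
      using norm_triangle_ineq[of "T \<phi>" "c * S \<phi>"] by (simp add: norm_mult)
    ultimately show ?thesis by (simp add: algebra_simps)
  qed
  then have "\<exists>C N. \<forall>\<phi>. schwartz \<phi> \<longrightarrow> norm (T \<phi> + c * S \<phi>) \<le> C * schwartz_seminorm N \<phi>" by blast
  then show ?thesis
    using T S unfolding tempered_def by (auto simp: algebra_simps)
qed

lemma invariant_form_add_cmult:
  assumes "invariant_form B" "invariant_form B'"
  shows "invariant_form (\<lambda>\<phi> \<psi>. B \<phi> \<psi> + complex_of_real c * B' \<phi> \<psi>)"
proof -
  interpret B: invariant_form B by fact
  interpret B': invariant_form B' by fact
  show ?thesis
  proof
    fix \<phi> \<psi> :: "'a \<Rightarrow> complex" and x \<xi>
    show "tempered (\<lambda>\<phi>. B \<phi> \<psi> + complex_of_real c * B' \<phi> \<psi>)" if "schwartz \<psi>"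
      using that by (intro tempered_add_cmult B.tempered B'.tempered)
    assume S: "schwartz \<phi>" "schwartz \<psi>"
    show "B \<phi> \<psi> + complex_of_real c * B' \<phi> \<psi> = cnj (B \<psi> \<phi> + complex_of_real c * B' \<psi> \<phi>)"
      using B.hermitian[OF S] B'.hermitian[OF S] by simp
    show "B (tf_shift x \<xi> \<phi>) (tf_shift x \<xi> \<psi>) + complex_of_real c * B' (tf_shift x \<xi> \<phi>) (tf_shift x \<xi> \<psi>) =
        B \<phi> \<psi> + complex_of_real c * B' \<phi> \<psi>"
      using B.invariant[OF S] B'.invariant[OF S] by simp
  qed
qed

text \<open>The value 0 off the Schwartz space follows the convention of \<open>tempered\<close>, so
  that \<open>l2_form _ \<psi>\<close> is a tempered distribution.\<close>

definition l2_form :: "('a::euclidean_space \<Rightarrow> complex) \<Rightarrow> ('a \<Rightarrow> complex) \<Rightarrow> complex" where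
  "l2_form \<phi> \<psi> = (if schwartz \<phi> then \<integral>x. \<phi> x * cnj (\<psi> x) \<partial>lborel else 0)"

lemma integrable_schwartz_mult:
  assumes "schwartz \<phi>" "schwartz \<psi>"
  shows "integrable lborel (\<lambda>x. \<phi> x * \<psi> x)"
  by (intro schwartz_integrable schwartz_mult assms)

lemma invariant_form_l2: "invariant_form (l2_form :: ('a::euclidean_space \<Rightarrow> complex) \<Rightarrow> _)"
proof
  fix \<phi> \<psi> :: "'a \<Rightarrow> complex" and x \<xi>
  show "tempered (\<lambda>\<phi>. l2_form \<phi> \<psi>)" if \<psi>: "schwartz \<psi>"
    unfolding tempered_def
  proof (intro conjI allI impI)
    fix \<phi> \<theta> :: "'a \<Rightarrow> complex" and c
    show "l2_form \<phi> \<psi> = 0" if "\<not> schwartz \<phi>" using that by (simp add: l2_form_def)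
    assume \<phi>: "schwartz \<phi>"
    show "l2_form (\<lambda>x. c * \<phi> x) \<psi> = c * l2_form \<phi> \<psi>"
      using \<phi> by (simp add: l2_form_def schwartz_cmult mult.assoc)
    assume "schwartz \<theta>"
    with \<phi> show "l2_form (\<lambda>x. \<phi> x + \<theta> x) \<psi> = l2_form \<phi> \<psi> + l2_form \<theta> \<psi>"
      using integrable_schwartz_mult[OF \<phi> schwartz_cnj[OF \<psi>]] integrable_schwartz_mult[of \<theta>, OF _ schwartz_cnj[OF \<psi>]]
      by (simp add: l2_form_def schwartz_add ring_distribs)
  next
    show "\<exists>C N. \<forall>\<phi>. schwartz \<phi> \<longrightarrow> norm (l2_form \<phi> \<psi>) \<le> C * schwartz_seminorm N \<phi>"
    proof (intro exI allI impI)
      fix \<phi> :: "'a \<Rightarrow> complex" assume \<phi>: "schwartz \<phi>"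
      have eq: "l2_form \<phi> \<psi> = (\<integral>x. \<phi> x * cnj (\<psi> x) \<partial>lborel)" using \<phi> by (simp add: l2_form_def)
      have "norm (l2_form \<phi> \<psi>) \<le> (\<integral>x. schwartz_seminorm 0 \<phi> * norm (\<psi> x) \<partial>lborel)"
        unfolding eq
      proof (rule norm_integral_le)
        fix x
        have "norm (\<phi> x) \<le> schwartz_seminorm 0 \<phi>" using norm_pderivs_le_seminorm[OF \<phi>, of "[]" 0 x] by simp
        then show "norm (\<phi> x * cnj (\<psi> x)) \<le> schwartz_seminorm 0 \<phi> * norm (\<psi> x)"
          by (simp add: norm_mult mult_right_mono)
      qed (use schwartz_integrable[OF \<psi>] in auto)
      then show "norm (l2_form \<phi> \<psi>) \<le> (\<integral>x. norm (\<psi> x) \<partial>lborel) * schwartz_seminorm 0 \<phi>"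
        by (simp add: mult.commute)
    qed
  qed
  assume S: "schwartz \<phi>" "schwartz \<psi>"
  have "(\<integral>x. \<phi> x * cnj (\<psi> x) \<partial>lborel) = (\<integral>x. cnj (\<psi> x * cnj (\<phi> x)) \<partial>lborel)"
    by (simp add: mult.commute)
  also have "\<dots> = cnj (\<integral>x. \<psi> x * cnj (\<phi> x) \<partial>lborel)" by (rule Bochner_Integration.integral_cnj)
  finally show "l2_form \<phi> \<psi> = cnj (l2_form \<psi> \<phi>)" using S by (simp add: l2_form_def)
  have "tf_shift x \<xi> \<phi> z * cnj (tf_shift x \<xi> \<psi> z) = \<phi> (z + x) * cnj (\<psi> (z + x))" for z
  proof -
    have "exp (\<i> * complex_of_real ((z + x) \<bullet> \<xi>)) * cnj (exp (\<i> * complex_of_real ((z + x) \<bullet> \<xi>))) = 1"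
      by (simp add: complex_norm_square[symmetric])
    then show ?thesis unfolding tf_shift_def complex_cnj_mult by (metis (no_types, opaque_lifting) mult.assoc mult.commute mult_1)
  qed
  moreover have "(\<lambda>z. \<phi> z * cnj (\<psi> z)) \<in> borel_measurable borel"
    by (intro schwartz_borel_measurable schwartz_mult schwartz_cnj S)
  ultimately show "l2_form (tf_shift x \<xi> \<phi>) (tf_shift x \<xi> \<psi>) = l2_form \<phi> \<psi>"
    using S integral_lborel_translate[of "\<lambda>z. \<phi> z * cnj (\<psi> z)" x] by (simp add: l2_form_def schwartz_tf_shift)
qed

lemma gaussian_eq_of_real: "gaussian a v x = complex_of_real (exp (- a / 2 * (x \<bullet> x) + x \<bullet> v))"
  by (simp only: gaussian_def exp_of_real)

lemma l2_form_gaussian: "\<exists>r. r \<noteq> 0 \<and> l2_form (gaussian 1 0) (gaussian 1 (0::'a::euclidean_space)) = complex_of_real r"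
proof -
  let ?f = "\<lambda>x::'a. exp (- (x \<bullet> x))"
  have f: "gaussian 1 0 x * cnj (gaussian 1 (0::'a) x) = complex_of_real (?f x)" for x
    by (simp add: gaussian_eq_of_real exp_add[symmetric] flip: of_real_mult)
  have int: "integrable lborel ?f"
    using integrable_norm[OF integrable_schwartz_mult[OF schwartz_gaussian schwartz_cnj[OF schwartz_gaussian], of 1 1 "0::'a" 0]]
    unfolding f by simp
  have "integral\<^sup>L lborel ?f \<noteq> 0"
  proof
    assume "integral\<^sup>L lborel ?f = 0"
    then have "AE x::'a in lborel. ?f x = 0" using int by (subst (asm) integral_nonneg_eq_0_iff_AE) auto
    then have "AE x::'a in lborel. False" by simp
    then show False using ae_filter_eq_bot_iff[of "lborel :: 'a measure"] by (simp add: eventually_False)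
  qed
  then show ?thesis
    by (intro exI[of _ "integral\<^sup>L lborel ?f"]) (simp add: l2_form_def schwartz_gaussian f)
qed

text \<open>\<open>c\<close> is the ratio of the two forms on the unit Gaussian, real because
  hermitian forms are real on the diagonal. The difference of the forms vanishes there and hence
  everywhere.\<close>

theorem invariant_form_eq_l2_form:
  fixes B :: "('a::euclidean_space \<Rightarrow> complex) \<Rightarrow> ('a \<Rightarrow> complex) \<Rightarrow> complex"
  assumes "invariant_form B"
  shows "\<exists>c::real. \<forall>\<phi> \<psi>. schwartz \<phi> \<longrightarrow> schwartz \<psi> \<longrightarrow> B \<phi> \<psi> = of_real c * l2_form \<phi> \<psi>"
proof -
  interpret B: invariant_form B by fact
  let ?g = "gaussian 1 (0::'a)"
  obtain r where r: "r \<noteq> 0" "l2_form ?g ?g = complex_of_real r" using l2_form_gaussian by blast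
  have g: "schwartz ?g" by (rule schwartz_gaussian) simp
  have re: "B ?g ?g = complex_of_real (Re (B ?g ?g))"
    using B.hermitian[OF g g] by (simp add: complex_eq_iff)
  define c where "c = Re (B ?g ?g) / r"
  interpret D: invariant_form "\<lambda>\<phi> \<psi>. B \<phi> \<psi> + complex_of_real (- c) * l2_form \<phi> \<psi>"
    by (intro invariant_form_add_cmult assms invariant_form_l2)
  have "B ?g ?g + complex_of_real (- c) * l2_form ?g ?g = 0"
    using r by (subst re) (simp add: c_def)
  from D.B_eq_zero[OF this] show ?thesis by (intro exI[of _ c]) auto
qed

section \<open>The space of square integrable functions\<close>

lemma L2_measurable: "f \<in> L2 \<Longrightarrow> f \<in> borel_measurable lebesgue"
  by (simp add: L2_def)

lemma L2_iff_nn_integral: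
  assumes "f \<in> borel_measurable lebesgue" "e \<ge> 0"
    and "(\<integral>\<^sup>+x. ennreal ((norm (f x))\<^sup>2) \<partial>lebesgue) \<le> ennreal (e\<^sup>2)"
  shows "f \<in> L2" "L2_norm f \<le> e"
proof -
  have m: "(\<lambda>x. (norm (f x))\<^sup>2) \<in> borel_measurable lebesgue" using assms(1) by measurable
  have int: "integrable lebesgue (\<lambda>x. (norm (f x))\<^sup>2)"
    using assms(3) m by (intro integrableI_bounded) (auto intro: le_less_trans)
  then show "f \<in> L2" using assms(1) by (simp add: L2_def)
  have "ennreal (\<integral>x. (norm (f x))\<^sup>2 \<partial>lebesgue) \<le> ennreal (e\<^sup>2)"
    using assms(3) by (subst nn_integral_eq_integral[OF int, symmetric]) auto
  then show "L2_norm f \<le> e"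
    unfolding L2_norm_def using assms(2) by (intro real_le_lsqrt) auto
qed

lemma L2_norm_nonneg: "L2_norm f \<ge> 0"
  by (simp add: L2_norm_def)

lemma L2_norm_square: "(L2_norm f)\<^sup>2 = (\<integral>x. (norm (f x))\<^sup>2 \<partial>lebesgue)"
  by (simp add: L2_norm_def)

lemma L2_nn_integral:
  "f \<in> L2 \<Longrightarrow> (\<integral>\<^sup>+x. ennreal ((norm (f x))\<^sup>2) \<partial>lebesgue) = ennreal ((L2_norm f)\<^sup>2)"
  unfolding L2_norm_square by (subst nn_integral_eq_integral) (auto simp: L2_def)

lemma norm_add_square_le: "(norm (a + b :: complex))\<^sup>2 \<le> 2 * (norm a)\<^sup>2 + 2 * (norm b)\<^sup>2"
proof -
  have "(norm (a + b))\<^sup>2 \<le> (norm a + norm b)\<^sup>2" by (intro power_mono norm_triangle_ineq) auto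
  also have "\<dots> \<le> 2 * (norm a)\<^sup>2 + 2 * (norm b)\<^sup>2"
    using sum_squares_ge_zero[of "norm a - norm b" 0] by (simp add: power2_eq_square algebra_simps)
  finally show ?thesis .
qed

lemma L2_add:
  assumes "f \<in> L2" "g \<in> L2"
  shows "(\<lambda>x. f x + g x) \<in> L2"
proof -
  have [measurable]: "f \<in> borel_measurable lebesgue" "g \<in> borel_measurable lebesgue"
    using assms L2_measurable by auto
  have "integrable lebesgue (\<lambda>x. (norm (f x + g x))\<^sup>2)"
    by (rule Bochner_Integration.integrable_bound[where f = "\<lambda>x. 2 * (norm (f x))\<^sup>2 + 2 * (norm (g x))\<^sup>2"])
       (use assms norm_add_square_le in \<open>auto simp: L2_def\<close>)
  then show ?thesis by (simp add: L2_def)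
qed

lemma L2_cmult: "f \<in> L2 \<Longrightarrow> (\<lambda>x. c * f x) \<in> L2"
  by (auto simp: L2_def norm_mult power_mult_distrib)

lemma L2_diff: "f \<in> L2 \<Longrightarrow> g \<in> L2 \<Longrightarrow> (\<lambda>x. f x - g x) \<in> L2"
  using L2_add[of f "\<lambda>x. - 1 * g x"] L2_cmult[of g "-1"] by simp

lemma L2_norm_cmult: "L2_norm (\<lambda>x. c * f x) = norm c * L2_norm f"
  by (simp add: L2_norm_def norm_mult power_mult_distrib real_sqrt_mult)

text \<open>The optimal parameter is \<open>b / a\<close>. Since \<open>a\<close> or
  \<open>b\<close> may be 0, both are first enlarged by a small \<open>d\<close>.\<close>

lemma le_product_if_le_all:
  fixes X a b :: real
  assumes "a \<ge> 0" "b \<ge> 0" "\<And>t. t > 0 \<Longrightarrow> 2 * X \<le> t * a\<^sup>2 + b\<^sup>2 / t"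
  shows "X \<le> a * b"
proof (rule field_le_epsilon)
  fix e :: real assume e: "e > 0"
  have "((\<lambda>d. (a + d) * (b + d)) \<longlongrightarrow> (a + 0) * (b + 0)) (at_right 0)"
    by (intro tendsto_intros)
  then have "eventually (\<lambda>d. (a + d) * (b + d) < a * b + e) (at_right 0)"
    using e by (intro order_tendstoD) auto
  then have "eventually (\<lambda>d. d > 0 \<and> (a + d) * (b + d) < a * b + e) (at_right 0)"
    by (intro eventually_conj) (auto simp: eventually_at_right_less)
  then obtain d where d: "d > 0" "(a + d) * (b + d) < a * b + e"
    using eventually_happens'[of "at_right (0::real)"] trivial_limit_at_right_real by blast
  define t where "t = (b + d) / (a + d)"
  have pos: "a + d > 0" "b + d > 0" "t > 0" using assms d by (auto simp: t_def)
  have "2 * X \<le> t * a\<^sup>2 + b\<^sup>2 / t" by (rule assms(3)[OF pos(3)])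
  also have "\<dots> \<le> t * (a + d)\<^sup>2 + (b + d)\<^sup>2 / t"
    using assms(1,2) d pos by (intro add_mono mult_left_mono divide_right_mono power_mono) auto
  also have "\<dots> = 2 * ((a + d) * (b + d))" using pos by (simp add: t_def power2_eq_square)
  finally show "X \<le> a * b + e" using d by simp
qed

lemma L2_mult_integrable:
  assumes "f \<in> L2" "g \<in> L2"
  shows "integrable lebesgue (\<lambda>x. norm (f x) * norm (g x))"
proof -
  have [measurable]: "f \<in> borel_measurable lebesgue" "g \<in> borel_measurable lebesgue"
    using assms L2_measurable by auto
  show ?thesis
  proof (rule Bochner_Integration.integrable_bound[where f = "\<lambda>x. (norm (f x))\<^sup>2 + (norm (g x))\<^sup>2"])
    show "AE x in lebesgue. norm (norm (f x) * norm (g x)) \<le> norm ((norm (f x))\<^sup>2 + (norm (g x))\<^sup>2)"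
    proof (rule AE_I2)
      fix x
      have "2 * (norm (f x) * norm (g x)) \<le> (norm (f x))\<^sup>2 + (norm (g x))\<^sup>2"
        using sum_squares_bound[of "norm (f x)" "norm (g x)"] by simp
      moreover have "0 \<le> norm (f x) * norm (g x)" by simp
      ultimately have "norm (f x) * norm (g x) \<le> (norm (f x))\<^sup>2 + (norm (g x))\<^sup>2" by linarith
      then show "norm (norm (f x) * norm (g x)) \<le> norm ((norm (f x))\<^sup>2 + (norm (g x))\<^sup>2)"
        by (simp add: abs_mult)
    qed
  qed (use assms in \<open>auto simp: L2_def\<close>)
qed

lemma L2_product_integrable:
  assumes "f \<in> L2" "g \<in> L2"
  shows "integrable lebesgue (\<lambda>x. f x * g x)"
proof -
  have [measurable]: "f \<in> borel_measurable lebesgue" "g \<in> borel_measurable lebesgue"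
    using assms L2_measurable by auto
  have "integrable lebesgue (\<lambda>x. norm (f x * g x))"
    using L2_mult_integrable[OF assms] by (simp add: norm_mult)
  then show ?thesis by (rule integrable_norm_cancel) measurable
qed

lemma L2_Cauchy_Schwarz_norm:
  assumes "f \<in> L2" "g \<in> L2"
  shows "(\<integral>x. norm (f x) * norm (g x) \<partial>lebesgue) \<le> L2_norm f * L2_norm g"
proof (rule le_product_if_le_all[OF L2_norm_nonneg L2_norm_nonneg])
  fix t :: real assume t: "t > 0"
  have "2 * (\<integral>x. norm (f x) * norm (g x) \<partial>lebesgue) = (\<integral>x. 2 * (norm (f x) * norm (g x)) \<partial>lebesgue)" by simp
  also have "\<dots> \<le> (\<integral>x. t * (norm (f x))\<^sup>2 + (norm (g x))\<^sup>2 / t \<partial>lebesgue)"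
  proof (rule integral_mono)
    fix x
    have "0 \<le> (t * norm (f x) - norm (g x))\<^sup>2 / t" using t by simp
    also have "\<dots> = t * (norm (f x))\<^sup>2 + (norm (g x))\<^sup>2 / t - 2 * (norm (f x) * norm (g x))"
      using t by (simp add: power2_eq_square field_simps)
    finally show "2 * (norm (f x) * norm (g x)) \<le> t * (norm (f x))\<^sup>2 + (norm (g x))\<^sup>2 / t" by simp
  qed (use assms L2_mult_integrable[OF assms] in \<open>auto simp: L2_def\<close>)
  also have "\<dots> = t * (L2_norm f)\<^sup>2 + (L2_norm g)\<^sup>2 / t"
    using assms unfolding L2_norm_square by (subst Bochner_Integration.integral_add) (auto simp: L2_def)
  finally show "2 * (\<integral>x. norm (f x) * norm (g x) \<partial>lebesgue) \<le> t * (L2_norm f)\<^sup>2 + (L2_norm g)\<^sup>2 / t" .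
qed

lemma L2_Cauchy_Schwarz:
  assumes "f \<in> L2" "g \<in> L2"
  shows "norm (\<integral>x. f x * g x \<partial>lebesgue) \<le> L2_norm f * L2_norm g"
proof -
  have "norm (\<integral>x. f x * g x \<partial>lebesgue) \<le> (\<integral>x. norm (f x) * norm (g x) \<partial>lebesgue)"
    by (rule norm_integral_le[OF L2_mult_integrable[OF assms]]) (simp add: norm_mult)
  then show ?thesis using L2_Cauchy_Schwarz_norm[OF assms] by simp
qed

lemma L2_triangle:
  assumes "f \<in> L2" "g \<in> L2"
  shows "L2_norm (\<lambda>x. f x + g x) \<le> L2_norm f + L2_norm g"
proof (rule power2_le_imp_le)
  have "(L2_norm (\<lambda>x. f x + g x))\<^sup>2 \<le> (\<integral>x. (norm (f x))\<^sup>2 + 2 * (norm (f x) * norm (g x)) + (norm (g x))\<^sup>2 \<partial>lebesgue)"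
    unfolding L2_norm_square
  proof (rule integral_mono)
    fix x
    have "(norm (f x + g x))\<^sup>2 \<le> (norm (f x) + norm (g x))\<^sup>2" by (intro power_mono norm_triangle_ineq) auto
    then show "(norm (f x + g x))\<^sup>2 \<le> (norm (f x))\<^sup>2 + 2 * (norm (f x) * norm (g x)) + (norm (g x))\<^sup>2"
      by (simp add: power2_eq_square algebra_simps)
  qed (use assms L2_add[OF assms] L2_mult_integrable[OF assms] in \<open>auto simp: L2_def\<close>)
  also have "\<dots> = (L2_norm f)\<^sup>2 + 2 * (\<integral>x. norm (f x) * norm (g x) \<partial>lebesgue) + (L2_norm g)\<^sup>2"
    using assms L2_mult_integrable[OF assms] unfolding L2_norm_square
    by (subst Bochner_Integration.integral_add, simp add: L2_def, simp add: L2_def)+ simp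
  also have "\<dots> \<le> (L2_norm f + L2_norm g)\<^sup>2"
    using L2_Cauchy_Schwarz_norm[OF assms] by (simp add: power2_eq_square algebra_simps)
  finally show "(L2_norm (\<lambda>x. f x + g x))\<^sup>2 \<le> (L2_norm f + L2_norm g)\<^sup>2" .
qed (simp add: L2_norm_nonneg)

section \<open>Completeness of L^2\<close>

lemma L2_norm_diff_commute: "L2_norm (\<lambda>x. f x - g x) = L2_norm (\<lambda>x. g x - f x)"
  by (simp add: L2_norm_def norm_minus_commute)

lemma L2_norm_convergent:
  assumes "\<And>n. X n \<in> L2" "f \<in> L2" "(\<lambda>n. L2_norm (\<lambda>x. X n x - f x)) \<longlonglongrightarrow> 0"
  shows "(\<lambda>n. L2_norm (X n)) \<longlonglongrightarrow> L2_norm f"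
proof -
  have "norm (L2_norm (X n) - L2_norm f) \<le> L2_norm (\<lambda>x. X n x - f x)" for n
    using L2_triangle[OF L2_diff[OF assms(1)[of n] assms(2)] assms(2)]
      L2_triangle[OF L2_diff[OF assms(2) assms(1)[of n]] assms(1)[of n]] L2_norm_diff_commute[of "X n" f] by simp
  then have "(\<lambda>n. L2_norm (X n) - L2_norm f) \<longlonglongrightarrow> 0"
    by (intro tendsto_0_le[OF assms(3), where K = 1]) (auto simp: L2_norm_nonneg)
  then show ?thesis by (simp add: LIM_zero_iff)
qed

text \<open>Riesz-Fischer: a fast subsequence converges almost everywhere because its weighted
  squared increments have an integrable sum; Fatou's lemma then turns the pointwise limit into a
  limit in norm.\<close>

theorem L2_complete:
  fixes X :: "nat \<Rightarrow> 'a::euclidean_space \<Rightarrow> complex"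
  assumes X: "\<And>n. X n \<in> L2"
    and cauchy: "\<And>e. e > 0 \<Longrightarrow> \<exists>N. \<forall>m\<ge>N. \<forall>n\<ge>N. L2_norm (\<lambda>x. X m x - X n x) < e"
  shows "\<exists>f\<in>L2. (\<lambda>n. L2_norm (\<lambda>x. X n x - f x)) \<longlonglongrightarrow> 0"
proof -
  have [measurable]: "X n \<in> borel_measurable lebesgue" for n using X L2_measurable by auto
  have "\<forall>k::nat. \<exists>N. \<forall>m\<ge>N. \<forall>n\<ge>N. L2_norm (\<lambda>x. X m x - X n x) < (1 / 4) ^ k"
    using cauchy by simp
  then obtain N where N: "\<And>k m n. m \<ge> N k \<Longrightarrow> n \<ge> N k \<Longrightarrow> L2_norm (\<lambda>x. X m x - X n x) < (1 / 4) ^ k"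
    by metis
  \<comment> \<open>The sum puts both \<open>r k\<close> and \<open>r (Suc k)\<close> beyond
    \<open>N k\<close>; the summand \<open>k\<close> makes \<open>r\<close> tend to
    infinity.\<close>
  define r where "r k = k + (\<Sum>i\<le>k. N i)" for k
  have rN: "r k \<ge> N k" "r k \<ge> k" for k
    unfolding r_def using member_le_sum[of k "{..k}" N] by auto
  have rS: "r (Suc k) \<ge> N k" for k
    unfolding r_def using member_le_sum[of k "{..Suc k}" N] by auto
  define d where "d k x = X (r (Suc k)) x - X (r k) x" for k x
  have dL: "d k \<in> L2" for k unfolding d_def[abs_def] by (intro L2_diff X)
  have [measurable]: "d k \<in> borel_measurable lebesgue" for k using dL L2_measurable by auto
  have dn: "(L2_norm (d k))\<^sup>2 \<le> (1 / 16) ^ k" for k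
  proof -
    have "(L2_norm (d k))\<^sup>2 \<le> ((1 / 4) ^ k)\<^sup>2"
      unfolding d_def[abs_def] using N[OF rS rN(1), of k] by (intro power_mono) (auto simp: L2_norm_nonneg)
    also have "\<dots> = (1 / 16) ^ k" by (simp add: power2_eq_square power_mult_distrib[symmetric])
    finally show ?thesis .
  qed
  \<comment> \<open>The integral of \<open>a k\<close> is at most \<open>(1 / 4) ^ k\<close>, while
    \<open>a k x < 1\<close> still forces \<open>norm (d k x) \<le> (1 / 2) ^ k\<close>.\<close>
  define a where "a k x = 4 ^ k * (norm (d k x))\<^sup>2" for k x
  have am[measurable]: "a k \<in> borel_measurable lebesgue" for k unfolding a_def[abs_def] by measurable
  have "(\<integral>\<^sup>+x. (\<Sum>k. ennreal (a k x)) \<partial>lebesgue) = (\<Sum>k. \<integral>\<^sup>+x. ennreal (a k x) \<partial>lebesgue)"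
    by (rule nn_integral_suminf) measurable
  also have "\<dots> \<le> (\<Sum>k. ennreal ((1 / 4) ^ k))"
  proof (rule suminf_le)
    fix k
    have "(\<integral>\<^sup>+x. ennreal (a k x) \<partial>lebesgue) = ennreal (4 ^ k) * (\<integral>\<^sup>+x. ennreal ((norm (d k x))\<^sup>2) \<partial>lebesgue)"
      unfolding a_def by (subst nn_integral_cmult[symmetric]) (auto simp: ennreal_mult)
    also have "\<dots> = ennreal (4 ^ k * (L2_norm (d k))\<^sup>2)"
      using L2_nn_integral[OF dL] by (simp add: ennreal_mult)
    also have "\<dots> \<le> ennreal ((1 / 4) ^ k)"
    proof (rule ennreal_leI)
      have "4 ^ k * (L2_norm (d k))\<^sup>2 \<le> 4 ^ k * (1 / 16) ^ k" by (intro mult_left_mono dn) auto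
      also have "\<dots> = (1 / 4) ^ k" by (simp add: power_mult_distrib[symmetric])
      finally show "4 ^ k * (L2_norm (d k))\<^sup>2 \<le> (1 / 4) ^ k" .
    qed
    finally show "(\<integral>\<^sup>+x. ennreal (a k x) \<partial>lebesgue) \<le> ennreal ((1 / 4) ^ k)" .
  qed auto
  also have "\<dots> < \<infinity>"
    by (subst suminf_ennreal2) (auto intro!: summable_geometric)
  finally have fin: "(\<integral>\<^sup>+x. (\<Sum>k. ennreal (a k x)) \<partial>lebesgue) \<noteq> \<infinity>" by simp
  have "AE x in lebesgue. (\<Sum>k. ennreal (a k x)) \<noteq> \<infinity>"
    by (rule nn_integral_PInf_AE[OF _ fin]) measurable
  then have conv: "AE x in lebesgue. convergent (\<lambda>k. X (r k) x)"
  proof eventually_elim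
    case (elim x)
    have a0: "a k x \<ge> 0" for k by (simp add: a_def)
    have "summable (\<lambda>k. a k x)" using elim by (intro summable_suminf_not_top a0) auto
    then have "(\<lambda>k. a k x) \<longlonglongrightarrow> 0" by (rule summable_LIMSEQ_zero)
    then have "eventually (\<lambda>k. a k x < 1) sequentially" by (rule order_tendstoD) simp
    then have "eventually (\<lambda>k. norm (d k x) \<le> (1 / 2) ^ k) sequentially"
    proof eventually_elim
      case (elim k)
      have "(2 ^ k * norm (d k x))\<^sup>2 \<le> 1\<^sup>2"
        using elim power_mult[of "2::real" 2 k] by (simp add: a_def power_mult_distrib power_mult[symmetric] mult.commute)
      then have "2 ^ k * norm (d k x) \<le> 1" by (rule power2_le_imp_le) simp
      then show ?case by (simp add: field_simps power_one_over)
    qed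
    then have "summable (\<lambda>k. d k x)"
      by (intro summable_comparison_test_ev[OF _ summable_geometric[of "1/2 :: real"]]) auto
    then have "convergent (\<lambda>k. X (r 0) x + (\<Sum>i<k. d i x))"
      by (intro convergent_add convergent_const) (simp add: summable_iff_convergent)
    moreover have "X (r 0) x + (\<Sum>i<k. d i x) = X (r k) x" for k
      using sum_lessThan_telescope[of "\<lambda>k. X (r k) x" k] by (simp add: d_def)
    ultimately show ?case by simp
  qed
  \<comment> \<open>Where the subsequence diverges the value of \<open>lim\<close> is arbitrary;
    that happens on a null set only.\<close>
  define f where "f x = lim (\<lambda>k. X (r k) x)" for x
  have [measurable]: "f \<in> borel_measurable lebesgue" unfolding f_def[abs_def] by measurable
  \<comment> \<open>Fatou's lemma along the subsequence, for fixed \<open>n\<close>.\<close>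
  have main: "(\<lambda>x. X n x - f x) \<in> L2 \<and> L2_norm (\<lambda>x. X n x - f x) \<le> e"
    if e: "e > 0" and n: "\<And>m. m \<ge> n \<Longrightarrow> L2_norm (\<lambda>x. X n x - X m x) \<le> e" for n e
  proof -
    have "(\<integral>\<^sup>+x. ennreal ((norm (X n x - f x))\<^sup>2) \<partial>lebesgue) =
        (\<integral>\<^sup>+x. liminf (\<lambda>k. ennreal ((norm (X n x - X (r k) x))\<^sup>2)) \<partial>lebesgue)"
    proof (rule nn_integral_cong_AE)
      show "AE x in lebesgue. ennreal ((norm (X n x - f x))\<^sup>2) = liminf (\<lambda>k. ennreal ((norm (X n x - X (r k) x))\<^sup>2))"
        using conv
      proof eventually_elim
        case (elim x)
        then have "(\<lambda>k. X (r k) x) \<longlonglongrightarrow> f x" by (simp add: f_def convergent_LIMSEQ_iff)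
        then have "(\<lambda>k. ennreal ((norm (X n x - X (r k) x))\<^sup>2)) \<longlonglongrightarrow> ennreal ((norm (X n x - f x))\<^sup>2)"
          by (intro tendsto_ennrealI tendsto_intros)
        then show ?case using lim_imp_Liminf[OF sequentially_bot] by metis
      qed
    qed
    also have "\<dots> \<le> liminf (\<lambda>k. \<integral>\<^sup>+x. ennreal ((norm (X n x - X (r k) x))\<^sup>2) \<partial>lebesgue)"
      by (rule nn_integral_liminf) measurable
    also have "\<dots> \<le> ennreal (e\<^sup>2)"
    proof (rule Liminf_le)
      show "\<forall>\<^sub>F k in sequentially. (\<integral>\<^sup>+x. ennreal ((norm (X n x - X (r k) x))\<^sup>2) \<partial>lebesgue) \<le> ennreal (e\<^sup>2)"
        using eventually_ge_at_top[of n]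
      proof eventually_elim
        case (elim k)
        then have "L2_norm (\<lambda>x. X n x - X (r k) x) \<le> e" using rN(2)[of k] by (intro n) simp
        then show ?case
          using L2_nn_integral[OF L2_diff[OF X X], of n "r k"] by (auto intro!: ennreal_leI power_mono simp: L2_norm_nonneg)
      qed
    qed simp
    finally show ?thesis using L2_iff_nn_integral[of "\<lambda>x. X n x - f x" e] e by simp
  qed
  have ev: "\<exists>N. \<forall>n\<ge>N. (\<lambda>x. X n x - f x) \<in> L2 \<and> L2_norm (\<lambda>x. X n x - f x) \<le> e" if e: "e > 0" for e
  proof -
    obtain N where N: "\<And>m n. m \<ge> N \<Longrightarrow> n \<ge> N \<Longrightarrow> L2_norm (\<lambda>x. X m x - X n x) < e" using cauchy[OF e] by blast
    have "(\<lambda>x. X n x - f x) \<in> L2 \<and> L2_norm (\<lambda>x. X n x - f x) \<le> e" if "n \<ge> N" for n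
      using N[of n] that by (intro main[OF e]) (auto intro: less_imp_le)
    then show ?thesis by blast
  qed
  obtain n where "(\<lambda>x. X n x - f x) \<in> L2" using ev[of 1] by auto
  from L2_diff[OF X[of n] this] have "f \<in> L2" by simp
  moreover have "(\<lambda>n. L2_norm (\<lambda>x. X n x - f x)) \<longlonglongrightarrow> 0"
  proof (rule LIMSEQ_I)
    fix e :: real assume "e > 0"
    then obtain N where "\<forall>n\<ge>N. L2_norm (\<lambda>x. X n x - f x) \<le> e / 2" using ev[of "e / 2"] by auto
    then show "\<exists>N. \<forall>n\<ge>N. norm (L2_norm (\<lambda>x. X n x - f x) - 0) < e"
      using \<open>e > 0\<close> by (intro exI[of _ N]) (auto simp: L2_norm_nonneg intro: le_less_trans[where y = "e / 2"])
  qed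
  ultimately show ?thesis by blast
qed

section \<open>Functions in L^2 that are orthogonal to the Schwartz space\<close>

lemma schwartz_L2:
  assumes "schwartz \<phi>"
  shows "\<phi> \<in> L2"
proof -
  have m: "\<phi> \<in> borel_measurable borel" using assms by measurable
  have "integrable lborel (\<lambda>x. \<phi> x * cnj (\<phi> x))" by (intro integrable_schwartz_mult schwartz_cnj assms)
  then have int: "integrable lborel (\<lambda>x. norm (\<phi> x * cnj (\<phi> x)))" by (rule integrable_norm)
  have "norm (\<phi> x * cnj (\<phi> x)) = (norm (\<phi> x))\<^sup>2" for x unfolding norm_mult by (simp add: power2_eq_square)
  note int = int[unfolded this]
  have m2: "(\<lambda>x. (norm (\<phi> x))\<^sup>2) \<in> borel_measurable lborel" using m by measurable
  have "integrable lebesgue (\<lambda>x. (norm (\<phi> x))\<^sup>2)" using int integrable_completion[OF m2] by blast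
  then show ?thesis using m by (simp add: L2_def measurable_completion)
qed

lemma l2_form_self:
  assumes "schwartz \<phi>"
  shows "l2_form \<phi> \<phi> = of_real ((L2_norm \<phi>)\<^sup>2)"
proof -
  have m: "\<phi> \<in> borel_measurable borel" using assms by measurable
  have "l2_form \<phi> \<phi> = (\<integral>x. of_real ((norm (\<phi> x))\<^sup>2) \<partial>lborel)"
    using assms by (simp add: l2_form_def complex_norm_square[symmetric])
  also have "\<dots> = of_real (\<integral>x. (norm (\<phi> x))\<^sup>2 \<partial>lborel)" by (rule integral_complex_of_real)
  also have "\<dots> = of_real ((L2_norm \<phi>)\<^sup>2)"
    unfolding L2_norm_square by (subst integral_completion) (use m in auto)
  finally show ?thesis .
qed

text \<open>The product of \<open>u ^ m\<close> with the outer exponent is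
  \<open>m * (2 * u) ^ m\<close>. For \<open>u \<ge> 1 / 2\<close> it is at least \<open>m\<close>,
  and \<open>1 - y \<le> exp (- y)\<close> applies; for \<open>u < 1 / 2\<close> it tends to 0, and
  Bernoulli's inequality applies. The factor \<open>m\<close> settles the borderline
  \<open>u = 1 / 2\<close>.\<close>

lemma bump_polynomial_limit:
  fixes u :: real
  assumes "0 < u" "u \<le> 1"
  shows "(\<lambda>m. 1 - (1 - u ^ m) ^ (m * 2 ^ m)) \<longlonglongrightarrow> (if u \<ge> 1 / 2 then 1 else 0)"
proof (cases "u \<ge> 1 / 2")
  case True
  have bound: "(1 - u ^ m) ^ (m * 2 ^ m) \<le> exp (- real m)" for m
  proof -
    have um: "u ^ m \<le> 1" "0 \<le> u ^ m" using assms by (auto intro: power_le_one)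
    have "(1 - u ^ m) ^ (m * 2 ^ m) \<le> exp (- (u ^ m)) ^ (m * 2 ^ m)"
      using exp_ge_add_one_self[of "- (u ^ m)"] um by (intro power_mono) auto
    also have "\<dots> = exp (- (real m * (2 * u) ^ m))"
      by (simp add: exp_of_nat_mult[symmetric] power_mult_distrib mult_ac)
    also have "\<dots> \<le> exp (- real m)"
      using mult_left_mono[OF one_le_power[of "2 * u" m], of "real m"] True by simp
    finally show ?thesis .
  qed
  have "(\<lambda>m. (1 - u ^ m) ^ (m * 2 ^ m)) \<longlonglongrightarrow> 0"
  proof (rule tendsto_sandwich[OF _ _ tendsto_const])
    show "\<forall>\<^sub>F m in sequentially. 0 \<le> (1 - u ^ m) ^ (m * 2 ^ m)"
      using assms by (auto intro!: always_eventually zero_le_power simp: power_le_one)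
    show "\<forall>\<^sub>F m in sequentially. (1 - u ^ m) ^ (m * 2 ^ m) \<le> exp (- real m)" using bound by auto
    have "(\<lambda>m. exp (- 1 :: real) ^ m) \<longlonglongrightarrow> 0" by (rule LIMSEQ_realpow_zero) auto
    then show "(\<lambda>m. exp (- real m)) \<longlonglongrightarrow> 0" by (simp add: exp_of_nat_mult[symmetric])
  qed
  from tendsto_diff[OF tendsto_const[of 1] this] show ?thesis using True by simp
next
  case False
  have lim: "(\<lambda>m. real m * (2 * u) ^ m) \<longlonglongrightarrow> 0"
    using False assms by (intro powser_times_n_limit_0) auto
  have "(\<lambda>m. 1 - (1 - u ^ m) ^ (m * 2 ^ m)) \<longlonglongrightarrow> 0"
  proof (rule tendsto_sandwich[OF _ _ tendsto_const lim])
    show "\<forall>\<^sub>F m in sequentially. 0 \<le> 1 - (1 - u ^ m) ^ (m * 2 ^ m)"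
      using assms by (auto intro!: always_eventually power_le_one simp: power_le_one)
    have "1 - (1 - u ^ m) ^ (m * 2 ^ m) \<le> real m * (2 * u) ^ m" for m
      using Bernoulli_inequality[of "- (u ^ m)" "m * 2 ^ m"] assms by (simp add: power_le_one power_mult_distrib mult_ac)
    then show "\<forall>\<^sub>F m in sequentially. 1 - (1 - u ^ m) ^ (m * 2 ^ m) \<le> real m * (2 * u) ^ m" by auto
  qed
  then show ?thesis using False by simp
qed

text \<open>A polynomial without constant term in a Gaussian that is at least \<open>1 / 2\<close>
  exactly on the closed ball, so the bumps are Schwartz functions and converge to the indicator of
  the ball.\<close>

definition ball_bump :: "nat \<Rightarrow> 'a::euclidean_space \<Rightarrow> real \<Rightarrow> 'a \<Rightarrow> real" where
  "ball_bump m y r x = 1 - (1 - exp (- ln 2 / r\<^sup>2 * ((x - y) \<bullet> (x - y))) ^ m) ^ (m * 2 ^ m)"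

lemma ball_bump_bounds: "0 < r \<Longrightarrow> 0 \<le> ball_bump m y r x \<and> ball_bump m y r x \<le> 1"
  unfolding ball_bump_def by (auto intro!: power_le_one zero_le_power simp: power_le_one divide_nonpos_nonneg mult_nonpos_nonneg)

lemma ball_bump_limit:
  assumes "r > 0"
  shows "(\<lambda>m. ball_bump m y r x) \<longlonglongrightarrow> indicator (cball y r) x"
proof -
  let ?u = "exp (- ln 2 / r\<^sup>2 * ((x - y) \<bullet> (x - y)))"
  have "?u \<ge> 1 / 2 \<longleftrightarrow> - ln 2 / r\<^sup>2 * (norm (x - y))\<^sup>2 \<ge> - ln 2"
    by (subst exp_le_cancel_iff[symmetric]) (simp add: exp_minus power2_norm_eq_inner inverse_eq_divide)
  also have "\<dots> \<longleftrightarrow> (norm (x - y))\<^sup>2 \<le> r\<^sup>2"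
  proof -
    have "- ln 2 / r\<^sup>2 * (norm (x - y))\<^sup>2 \<ge> - ln 2 \<longleftrightarrow> ln 2 * ((norm (x - y))\<^sup>2 / r\<^sup>2) \<le> ln 2 * 1"
      by simp
    also have "\<dots> \<longleftrightarrow> (norm (x - y))\<^sup>2 / r\<^sup>2 \<le> 1" by (intro mult_le_cancel_left_pos) auto
    also have "\<dots> \<longleftrightarrow> (norm (x - y))\<^sup>2 \<le> r\<^sup>2" using assms by (simp add: field_simps)
    finally show ?thesis .
  qed
  also have "\<dots> \<longleftrightarrow> x \<in> cball y r"
    using assms by (simp add: dist_norm norm_minus_commute power_mono_iff)
  finally have "(if ?u \<ge> 1 / 2 then 1 else 0 :: real) = indicator (cball y r) x" by (simp add: indicator_def)
  moreover have "?u \<le> 1" by (simp add: divide_nonpos_nonneg mult_nonpos_nonneg)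
  ultimately show ?thesis unfolding ball_bump_def using bump_polynomial_limit[of ?u] by simp
qed

lemma schwartz_one_minus_power:
  assumes "schwartz w"
  shows "schwartz (\<lambda>x. 1 - (1 - w x) ^ n)"
proof (induction n)
  case (Suc n)
  have "schwartz (\<lambda>x. (1 - (1 - w x) ^ n) + (w x - (1 - (1 - w x) ^ n) * w x))"
    by (intro schwartz_add schwartz_diff schwartz_mult Suc assms)
  then show ?case by (simp add: algebra_simps)
qed (simp add: schwartz_zero)

lemma schwartz_ball_bump:
  assumes "r > 0"
  shows "schwartz (\<lambda>x. complex_of_real (ball_bump m y r x))"
proof (cases "m = 0")
  case True
  then show ?thesis by (simp add: ball_bump_def schwartz_zero)
next
  case False
  define c where "c = real m * ln 2 / r\<^sup>2"
  have c: "c > 0" using False assms by (simp add: c_def)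
  have "exp (- ln 2 / r\<^sup>2 * ((x - y) \<bullet> (x - y))) ^ m = exp (- c * (y \<bullet> y)) * exp (- (2 * c) / 2 * (x \<bullet> x) + x \<bullet> ((2 * c) *\<^sub>R y))" for x
    unfolding exp_of_nat_mult[symmetric] exp_add[symmetric]
    by (intro arg_cong[where f = exp]) (simp add: c_def inner_simps inner_commute algebra_simps add_divide_distrib)
  then have "complex_of_real (exp (- ln 2 / r\<^sup>2 * ((x - y) \<bullet> (x - y))) ^ m) =
      complex_of_real (exp (- c * (y \<bullet> y))) * gaussian (2 * c) ((2 * c) *\<^sub>R y) x" for x
    by (simp only: gaussian_eq_of_real of_real_mult)
  then have "schwartz (\<lambda>x. complex_of_real (exp (- ln 2 / r\<^sup>2 * ((x - y) \<bullet> (x - y))) ^ m))"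
    using schwartz_cmult[OF schwartz_gaussian[of "2 * c"]] c by simp
  from schwartz_one_minus_power[OF this, of "m * 2 ^ m"] show ?thesis
    by (simp add: ball_bump_def)
qed

text \<open>The factor \<open>\<phi>\<close> covers the empty product, which corresponds to the
  whole space.\<close>

lemma schwartz_prod_ball_bump:
  assumes "finite F" "\<And>y r. (y, r) \<in> F \<Longrightarrow> r > 0" "schwartz \<phi>"
  shows "schwartz (\<lambda>x. complex_of_real (\<Prod>(y, r)\<in>F. ball_bump m y r x) * \<phi> x)"
  using assms(1,2)
proof (induction F rule: finite_induct)
  case (insert p F)
  obtain y r where p: "p = (y, r)" by (cases p)
  have "schwartz (\<lambda>x. complex_of_real (ball_bump m y r x) * (complex_of_real (\<Prod>(y, r)\<in>F. ball_bump m y r x) * \<phi> x))"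
    using insert.prems p by (intro schwartz_mult[OF schwartz_ball_bump insert.IH]) auto
  then show ?case using insert p by (simp add: mult.assoc)
qed (use assms(3) in simp)

text \<open>An intersection-stable system, as Dynkin's argument requires; \<open>F = {}\<close>
  contributes the whole space.\<close>

definition cball_intersections :: "'a::euclidean_space set set" where
  "cball_intersections = {A. \<exists>F. finite F \<and> (\<forall>(y, r)\<in>F. r > 0) \<and> A = (\<Inter>(y, r)\<in>F. cball y r)}"

text \<open>By Lindelof, an open set is a countable union of closed balls: use those open balls
  whose closures lie inside.\<close>

lemma sets_borel_eq_sigma_cball:
  "sets (borel :: 'a::euclidean_space measure) = sigma_sets UNIV cball_intersections" (is "_ = sigma_sets UNIV ?G")
proof
  show "sigma_sets UNIV ?G \<subseteq> sets borel"
  proof -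
    have "?G \<subseteq> sets borel" by (auto simp: cball_intersections_def intro!: borel_closed closed_INT)
    from sets.sigma_sets_subset[OF this] show ?thesis by simp
  qed
  have cb: "cball y r \<in> ?G" if "r > 0" for y :: 'a and r
    unfolding cball_intersections_def using that by (intro CollectI exI[of _ "{(y, r)}"]) auto
  have "U \<in> sigma_sets UNIV ?G" if U: "open U" for U :: "'a set"
  proof -
    define \<F> where "\<F> = {ball x r | x r. r > 0 \<and> cball x r \<subseteq> U}"
    obtain \<F>' where \<F>': "\<F>' \<subseteq> \<F>" "countable \<F>'" "\<Union>\<F>' = \<Union>\<F>"
      using Lindelof[of \<F>] unfolding \<F>_def by blast
    have UF: "\<Union>\<F> = U"
    proof
      show "\<Union>\<F> \<subseteq> U" unfolding \<F>_def using ball_subset_cball by blast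
      show "U \<subseteq> \<Union>\<F>"
      proof
        fix x assume "x \<in> U"
        then obtain e where e: "e > 0" "cball x e \<subseteq> U" using U open_contains_cball by blast
        then have "ball x e \<in> \<F>" unfolding \<F>_def by blast
        then show "x \<in> \<Union>\<F>" using e(1) centre_in_ball by blast
      qed
    qed
    have "\<forall>B\<in>\<F>'. \<exists>C. C \<in> ?G \<and> B \<subseteq> C \<and> C \<subseteq> U"
    proof
      fix B assume "B \<in> \<F>'"
      then obtain x r where B: "B = ball x r" "r > 0" "cball x r \<subseteq> U" using \<F>'(1) unfolding \<F>_def by blast
      show "\<exists>C. C \<in> ?G \<and> B \<subseteq> C \<and> C \<subseteq> U"
        by (rule exI[of _ "cball x r"], rule conjI, rule cb[OF B(2)], rule conjI) (use B in auto)
    qed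
    from bchoice[OF this] obtain C where C: "\<And>B. B \<in> \<F>' \<Longrightarrow> C B \<in> ?G"
      "\<And>B. B \<in> \<F>' \<Longrightarrow> B \<subseteq> C B" "\<And>B. B \<in> \<F>' \<Longrightarrow> C B \<subseteq> U" by blast
    have "U = (\<Union>B\<in>\<F>'. C B)"
    proof
      have "\<Union>\<F>' \<subseteq> (\<Union>B\<in>\<F>'. C B)" by (rule Union_least, rule order_trans, rule C(2)) (auto intro: UN_upper)
      then show "U \<subseteq> (\<Union>B\<in>\<F>'. C B)" by (simp only: \<F>'(3) UF)
      show "(\<Union>B\<in>\<F>'. C B) \<subseteq> U" by (rule UN_least) (rule C(3))
    qed
    moreover have "(\<Union>B\<in>\<F>'. C B) \<in> sigma_sets UNIV ?G"
      using \<F>'(2) by (intro sigma_sets_UNION) (auto intro: sigma_sets.Basic[OF C(1)])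
    ultimately show ?thesis by simp
  qed
  then have "sigma_sets UNIV {S :: 'a set. open S} \<subseteq> sigma_sets UNIV ?G"
    by (intro sigma_sets_mono) auto
  then show "sets borel \<subseteq> sigma_sets UNIV ?G" by (simp add: sets_borel)
qed

lemma sigma_finite_lebesgue: "sigma_finite_measure (lebesgue :: 'a::euclidean_space measure)"
proof
  show "\<exists>A::'a set set. countable A \<and> A \<subseteq> sets lebesgue \<and> \<Union>A = space lebesgue \<and> (\<forall>a\<in>A. emeasure lebesgue a \<noteq> \<infinity>)"
  proof (intro exI[of _ "range (\<lambda>n. cball 0 (real n))"] conjI ballI)
    show "\<Union>(range (\<lambda>n. cball 0 (real n))) = space (lebesgue :: 'a measure)"
      using real_arch_simple by (auto simp: dist_norm)
    fix a :: "'a set" assume "a \<in> range (\<lambda>n. cball 0 (real n))"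
    then obtain n where "a = cball 0 (real n)" by blast
    then show "emeasure lebesgue a \<noteq> \<infinity>" using emeasure_lborel_cball_finite[of "0::'a" "real n"] by simp
  qed auto
qed

text \<open>\<open>f\<close> itself need not be integrable, but \<open>F\<close>, its product with a
  nowhere vanishing Gaussian, is. The integrals of \<open>F\<close> vanish over finite intersections
  of balls by dominated convergence of bumps, over Borel sets by Dynkin's argument, and over
  Lebesgue sets up to a null set.\<close>

theorem L2_eq_zero_if_orthogonal_to_schwartz:
  fixes f :: "'a::euclidean_space \<Rightarrow> complex"
  assumes f: "f \<in> L2" and orth: "\<And>\<phi>. schwartz \<phi> \<Longrightarrow> (\<integral>x. f x * \<phi> x \<partial>lebesgue) = 0"
  shows "AE x in lebesgue. f x = 0"
proof -
  let ?g = "gaussian 1 (0::'a)"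
  have g: "schwartz ?g" by (rule schwartz_gaussian) simp
  define F where "F x = f x * ?g x" for x
  have intF: "integrable lebesgue F"
    unfolding F_def[abs_def] by (intro L2_product_integrable f schwartz_L2 g)
  have [measurable]: "F \<in> borel_measurable lebesgue" using intF by simp
  have F0: "integral\<^sup>L lebesgue F = 0" unfolding F_def[abs_def] by (rule orth[OF g])
  let ?G = "cball_intersections :: 'a set set"
  have leb: "A \<in> sets lebesgue" if "A \<in> sets borel" for A :: "'a set" using that by simp
  have on_cballs: "(\<integral>x. indicator A x *\<^sub>R F x \<partial>lebesgue) = 0" if A: "A \<in> ?G" for A
  proof -
    obtain P where P: "finite P" "\<forall>(y, r)\<in>P. r > 0" "A = (\<Inter>(y, r)\<in>P. cball y r)"
      using A unfolding cball_intersections_def by blast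
    have bb: "0 \<le> ball_bump m y r x" "ball_bump m y r x \<le> 1" if "(y, r) \<in> P" for m y r x
      using ball_bump_bounds[of r m y x] that P(2) by auto
    have lim: "(\<lambda>m. \<Prod>(y, r)\<in>P. ball_bump m y r x) \<longlonglongrightarrow> indicator A x" for x
    proof -
      have "(\<lambda>m. \<Prod>p\<in>P. ball_bump m (fst p) (snd p) x) \<longlonglongrightarrow> (\<Prod>p\<in>P. indicator (cball (fst p) (snd p)) x)"
        using P(2) by (intro tendsto_prod ball_bump_limit) auto
      moreover have "(\<Prod>p\<in>P. indicator (cball (fst p) (snd p)) x) = (indicator A x :: real)"
        using P(1) unfolding P(3) by (auto simp: indicator_def case_prod_unfold prod_zero_iff)
      ultimately show ?thesis by (simp add: case_prod_unfold)
    qed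
    have zero: "(\<integral>x. (\<Prod>(y, r)\<in>P. ball_bump m y r x) *\<^sub>R F x \<partial>lebesgue) = 0" for m
    proof -
      have "schwartz (\<lambda>x. complex_of_real (\<Prod>(y, r)\<in>P. ball_bump m y r x) * ?g x)"
        using P by (intro schwartz_prod_ball_bump g) auto
      from orth[OF this] show ?thesis by (simp add: F_def scaleR_conv_of_real mult_ac)
    qed
    have pm: "(\<lambda>x. \<Prod>(y, r)\<in>P. ball_bump m y r x) \<in> borel_measurable lebesgue" for m
      unfolding case_prod_unfold ball_bump_def by (intro borel_measurable_prod measurable_completion) measurable
    have "(\<lambda>m. \<integral>x. (\<Prod>(y, r)\<in>P. ball_bump m y r x) *\<^sub>R F x \<partial>lebesgue) \<longlonglongrightarrow> (\<integral>x. indicator A x *\<^sub>R F x \<partial>lebesgue)"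
    proof (rule integral_dominated_convergence[where w = "\<lambda>x. norm (F x)"])
      have "A \<in> sets lebesgue" using P unfolding P(3) by (intro leb borel_closed closed_INT) auto
      then show "(\<lambda>x. indicator A x *\<^sub>R F x) \<in> borel_measurable lebesgue" by measurable
      show "(\<lambda>x. (\<Prod>(y, r)\<in>P. ball_bump m y r x) *\<^sub>R F x) \<in> borel_measurable lebesgue" for m
        using pm by measurable
      show "integrable lebesgue (\<lambda>x. norm (F x))" using intF by simp
      show "AE x in lebesgue. (\<lambda>m. (\<Prod>(y, r)\<in>P. ball_bump m y r x) *\<^sub>R F x) \<longlonglongrightarrow> indicator A x *\<^sub>R F x"
        by (intro AE_I2 tendsto_intros lim)
      show "AE x in lebesgue. norm ((\<Prod>(y, r)\<in>P. ball_bump m y r x) *\<^sub>R F x) \<le> norm (F x)" for m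
      proof (rule AE_I2)
        fix x
        have "\<bar>\<Prod>(y, r)\<in>P. ball_bump m y r x\<bar> \<le> 1"
          using bb by (subst abs_of_nonneg) (auto intro!: prod_nonneg prod_le_1)
        then show "norm ((\<Prod>(y, r)\<in>P. ball_bump m y r x) *\<^sub>R F x) \<le> norm (F x)"
          by (simp add: mult_left_le_one_le)
      qed
    qed
    then show ?thesis unfolding zero by (rule LIMSEQ_unique[OF _ tendsto_const])
  qed
  have borel0: "set_lebesgue_integral lebesgue A F = 0" if "A \<in> sets borel" for A
  proof -
    have "Int_stable ?G"
    proof (rule Int_stableI)
      fix a b assume "a \<in> ?G" "b \<in> ?G"
      then obtain P Q where "finite P" "\<forall>(y, r)\<in>P. r > 0" "a = (\<Inter>(y, r)\<in>P. cball y r)"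
        "finite Q" "\<forall>(y, r)\<in>Q. r > 0" "b = (\<Inter>(y, r)\<in>Q. cball y r)"
        unfolding cball_intersections_def by blast
      then show "a \<inter> b \<in> ?G" unfolding cball_intersections_def by (intro CollectI exI[of _ "P \<union> Q"]) auto
    qed
    moreover have "?G \<subseteq> Pow UNIV" by simp
    moreover have A: "A \<in> sigma_sets UNIV ?G" using that sets_borel_eq_sigma_cball by blast
    ultimately show ?thesis
    proof (induction rule: sigma_sets_induct_disjoint)
      case (basic A)
      show ?case unfolding set_lebesgue_integral_def by (rule on_cballs[OF basic])
    next
      case empty
      then show ?case by (simp add: set_lebesgue_integral_def)
    next
      case (compl A)
      have "A \<in> sets lebesgue" using compl(1) sets_borel_eq_sigma_cball leb by blast
      then have "integrable lebesgue (\<lambda>x. indicat_real A x *\<^sub>R F x)"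
        by (intro integrable_mult_indicator intF)
      then have "(\<integral>x. F x - indicator A x *\<^sub>R F x \<partial>lebesgue) = 0"
        using compl(2) F0 intF by (subst Bochner_Integration.integral_diff) (auto simp: set_lebesgue_integral_def)
      moreover have "F x - indicator A x *\<^sub>R F x = indicator (UNIV - A) x *\<^sub>R F x" for x
        by (simp add: indicator_def)
      ultimately show ?case by (simp add: set_lebesgue_integral_def)
    next
      case (union A)
      have m: "A i \<in> sets lebesgue" for i using union(2) sets_borel_eq_sigma_cball leb by blast
      have "(LINT x:(\<Union>i. A i)|lebesgue. F x) = (\<Sum>i. LINT x:A i|lebesgue. F x)"
      proof (rule lebesgue_integral_countable_add[OF m])
        show "A i \<inter> A j = {}" if "i \<noteq> j" for i j using union(1) that by (auto simp: disjoint_family_on_def)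
        show "set_integrable lebesgue (\<Union>i. A i) F"
          unfolding set_integrable_def using m by (intro integrable_mult_indicator intF) auto
      qed
      then show ?case using union(3) by simp
    qed
  qed
  have "AE x in lebesgue. F x = 0"
  proof (rule sigma_finite_measure.density_zero[OF sigma_finite_lebesgue intF])
    fix A :: "'a set" assume "A \<in> sets lebesgue"
    then obtain S N N' where A: "A = S \<union> N" "N \<subseteq> N'" "N' \<in> null_sets lborel" "S \<in> sets lborel"
      unfolding sets_completion by (elim completionE)
    have "AE x in lebesgue. x \<notin> N'" using A(3) by (intro AE_not_in) (simp add: null_sets_completionI)
    then have "AE x in lebesgue. indicat_real A x *\<^sub>R F x = indicat_real S x *\<^sub>R F x"
      by eventually_elim (use A in \<open>auto simp: indicator_def\<close>)
    moreover have "A \<in> sets lebesgue" "S \<in> sets lebesgue" using \<open>A \<in> sets lebesgue\<close> A(4) by auto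
    ultimately have "set_lebesgue_integral lebesgue A F = set_lebesgue_integral lebesgue S F"
      unfolding set_lebesgue_integral_def using borel_measurable_integrable[OF intF]
      by (intro integral_cong_AE borel_measurable_scaleR borel_measurable_indicator)
    then show "set_lebesgue_integral lebesgue A F = 0" using borel0[of S] A(4) by simp
  qed
  then show ?thesis by eventually_elim (simp add: F_def gaussian_def)
qed

text \<open>A distribution fixes its function only almost everywhere; this makes the L^2 norm well
  defined on distributions.\<close>

lemma regdist_eq_imp_L2_norm_eq:
  assumes "f \<in> L2" "g \<in> L2" "regdist f = regdist g"
  shows "L2_norm f = L2_norm g"
proof -
  have "(\<integral>x. (f x - g x) * \<phi> x \<partial>lebesgue) = 0" if \<phi>: "schwartz \<phi>" for \<phi>
  proof -
    have "(\<integral>x. f x * \<phi> x \<partial>lebesgue) = (\<integral>x. g x * \<phi> x \<partial>lebesgue)"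
      using fun_cong[OF assms(3), of \<phi>] \<phi> by (simp add: regdist_def)
    then show ?thesis
      using L2_product_integrable[OF assms(1) schwartz_L2[OF \<phi>]] L2_product_integrable[OF assms(2) schwartz_L2[OF \<phi>]]
      by (simp add: left_diff_distrib)
  qed
  then have "AE x in lebesgue. f x - g x = 0"
    by (intro L2_eq_zero_if_orthogonal_to_schwartz L2_diff assms(1,2))
  then have ae: "AE x in lebesgue. (norm (f x))\<^sup>2 = (norm (g x))\<^sup>2" by eventually_elim simp
  have [measurable]: "f \<in> borel_measurable lebesgue" "g \<in> borel_measurable lebesgue"
    using assms L2_measurable by auto
  have "(\<integral>x. (norm (f x))\<^sup>2 \<partial>lebesgue) = (\<integral>x. (norm (g x))\<^sup>2 \<partial>lebesgue)"
    by (rule integral_cong_AE[OF _ _ ae]) measurable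
  then show ?thesis by (simp add: L2_norm_def)
qed

section \<open>Hilbert spaces of tempered distributions\<close>

abbreviation dsub :: "(('a \<Rightarrow> complex) \<Rightarrow> complex) \<Rightarrow> (('a \<Rightarrow> complex) \<Rightarrow> complex) \<Rightarrow> ('a \<Rightarrow> complex) \<Rightarrow> complex" where
  "dsub T S \<equiv> dadd T (dscale (-1) S)"

locale hilbert_distributions =
  fixes Hs :: "(('a::euclidean_space \<Rightarrow> complex) \<Rightarrow> complex) set"
    and ip :: "(('a \<Rightarrow> complex) \<Rightarrow> complex) \<Rightarrow> (('a \<Rightarrow> complex) \<Rightarrow> complex) \<Rightarrow> complex"
  assumes hilbert: "hilbert_embedded Hs ip"
begin

section \<open>Geometry of the Hilbert space\<close>

lemma Hs_tempered: "T \<in> Hs \<Longrightarrow> tempered T"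
  and dzero_Hs: "dzero \<in> Hs"
  and dadd_Hs: "T \<in> Hs \<Longrightarrow> S \<in> Hs \<Longrightarrow> dadd T S \<in> Hs"
  and dscale_Hs: "T \<in> Hs \<Longrightarrow> dscale c T \<in> Hs"
  and ip_add_left: "T \<in> Hs \<Longrightarrow> S \<in> Hs \<Longrightarrow> R \<in> Hs \<Longrightarrow> ip (dadd T S) R = ip T R + ip S R"
  and ip_scale_left: "T \<in> Hs \<Longrightarrow> S \<in> Hs \<Longrightarrow> ip (dscale c T) S = c * ip T S"
  and ip_sym: "T \<in> Hs \<Longrightarrow> S \<in> Hs \<Longrightarrow> ip T S = cnj (ip S T)"
  and ip_nonneg: "T \<in> Hs \<Longrightarrow> Re (ip T T) \<ge> 0"
  and ip_definite: "T \<in> Hs \<Longrightarrow> ip T T = 0 \<Longrightarrow> T = dzero"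
  using hilbert unfolding hilbert_embedded_def by blast+

lemma Hs_complete:
  assumes "\<And>n. X n \<in> Hs" "\<And>e. e > 0 \<Longrightarrow> \<exists>N. \<forall>m\<ge>N. \<forall>n\<ge>N. hnorm ip (dsub (X m) (X n)) < e"
  shows "\<exists>T\<in>Hs. (\<lambda>n. hnorm ip (dsub (X n) T)) \<longlonglongrightarrow> 0"
  using hilbert assms unfolding hilbert_embedded_def by blast

lemma Hs_embedded: "schwartz \<phi> \<Longrightarrow> \<exists>K. \<forall>T\<in>Hs. norm (T \<phi>) \<le> K * hnorm ip T"
  using hilbert unfolding hilbert_embedded_def by blast

lemma dsub_Hs: "T \<in> Hs \<Longrightarrow> S \<in> Hs \<Longrightarrow> dsub T S \<in> Hs"
  by (intro dadd_Hs dscale_Hs)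

lemma ip_add_right: "T \<in> Hs \<Longrightarrow> S \<in> Hs \<Longrightarrow> R \<in> Hs \<Longrightarrow> ip R (dadd T S) = ip R T + ip R S"
  using ip_sym[of R "dadd T S"] ip_add_left[of T S R] ip_sym[of R T] ip_sym[of R S] dadd_Hs by simp

lemma ip_scale_right: "T \<in> Hs \<Longrightarrow> S \<in> Hs \<Longrightarrow> ip S (dscale c T) = cnj c * ip S T"
  using ip_sym[of S "dscale c T"] ip_scale_left[of T S c] ip_sym[of S T] dscale_Hs by simp

lemmas ip_simps = ip_add_left ip_add_right ip_scale_left ip_scale_right dadd_Hs dscale_Hs

lemma hnorm_nonneg: "T \<in> Hs \<Longrightarrow> 0 \<le> hnorm ip T"
  using ip_nonneg by (simp add: hnorm_def)

lemma hnorm_square: "T \<in> Hs \<Longrightarrow> (hnorm ip T)\<^sup>2 = Re (ip T T)"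
  using ip_nonneg by (simp add: hnorm_def)

lemma ip_self: "T \<in> Hs \<Longrightarrow> ip T T = of_real ((hnorm ip T)\<^sup>2)"
  using ip_sym[of T T] hnorm_square[of T] by (simp add: complex_eq_iff)

lemma hnorm_eq_0: "T \<in> Hs \<Longrightarrow> hnorm ip T = 0 \<Longrightarrow> T = dzero"
  using ip_self ip_definite by simp

lemma ip_zero_right: "T \<in> Hs \<Longrightarrow> ip T dzero = 0"
  using ip_scale_right[OF dzero_Hs, of T 0] by (simp add: dscale_def dzero_def)

lemma hnorm_dadd_scale_square:
  assumes "T \<in> Hs" "S \<in> Hs"
  shows "(hnorm ip (dadd T (dscale c S)))\<^sup>2 = (hnorm ip T)\<^sup>2 + 2 * Re (c * ip S T) + (norm c)\<^sup>2 * (hnorm ip S)\<^sup>2"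
proof -
  have "ip (dadd T (dscale c S)) (dadd T (dscale c S)) =
      ip T T + cnj c * ip T S + c * ip S T + c * cnj c * ip S S"
    using assms by (simp add: ip_simps algebra_simps)
  moreover have "cnj c * ip T S = cnj (c * ip S T)" using ip_sym[OF assms] by simp
  moreover have "c * cnj c * ip S S = of_real ((norm c)\<^sup>2 * (hnorm ip S)\<^sup>2)"
    unfolding ip_self[OF assms(2)] complex_norm_square[symmetric] by simp
  ultimately have "Re (ip (dadd T (dscale c S)) (dadd T (dscale c S))) =
      Re (ip T T) + 2 * Re (c * ip S T) + (norm c)\<^sup>2 * (hnorm ip S)\<^sup>2"
    by simp
  then show ?thesis using assms by (simp add: hnorm_square dadd_Hs dscale_Hs)
qed

lemma Cauchy_Schwarz:
  assumes "T \<in> Hs" "S \<in> Hs"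
  shows "norm (ip T S) \<le> hnorm ip T * hnorm ip S"
proof (cases "hnorm ip S = 0")
  case True
  then show ?thesis using hnorm_eq_0[OF assms(2)] ip_zero_right[OF assms(1)] by simp
next
  case False
  define a where "a = ip S T"
  define h where "h = (hnorm ip S)\<^sup>2"
  have h: "h > 0" using False by (simp add: h_def)
  \<comment> \<open>The coefficient minimising the norm of \<open>T\<close> plus a multiple of
    \<open>S\<close>.\<close>
  have "0 \<le> (hnorm ip (dadd T (dscale (- cnj a / of_real h) S)))\<^sup>2" by simp
  also have "\<dots> = (hnorm ip T)\<^sup>2 + 2 * Re (- cnj a / of_real h * a) + (norm (- cnj a / of_real h))\<^sup>2 * h"
    unfolding hnorm_dadd_scale_square[OF assms] by (simp add: a_def h_def)
  also have "- cnj a / of_real h * a = of_real (- (norm a)\<^sup>2 / h)"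
    using complex_norm_square[of a] by (simp add: mult.commute)
  also have "(norm (- cnj a / of_real h))\<^sup>2 * h = (norm a)\<^sup>2 / h"
    using h by (simp add: norm_divide power_divide power2_eq_square)
  finally have "(norm a)\<^sup>2 \<le> (hnorm ip T)\<^sup>2 * h" using h by (simp add: field_simps)
  then have "(norm a)\<^sup>2 \<le> (hnorm ip T * hnorm ip S)\<^sup>2" by (simp add: h_def power_mult_distrib)
  then have "norm a \<le> hnorm ip T * hnorm ip S"
    by (rule power2_le_imp_le) (simp add: assms hnorm_nonneg)
  then show ?thesis using ip_sym[OF assms] by (simp add: a_def)
qed

lemma hnorm_triangle:
  assumes "T \<in> Hs" "S \<in> Hs"
  shows "hnorm ip (dadd T (dscale c S)) \<le> hnorm ip T + norm c * hnorm ip S"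
proof (rule power2_le_imp_le)
  have "Re (c * ip S T) \<le> norm c * (hnorm ip T * hnorm ip S)"
    using complex_Re_le_cmod[of "c * ip S T"] mult_left_mono[OF Cauchy_Schwarz[OF assms(2,1)], of "norm c"]
    by (simp add: norm_mult mult.commute)
  then show "(hnorm ip (dadd T (dscale c S)))\<^sup>2 \<le> (hnorm ip T + norm c * hnorm ip S)\<^sup>2"
    unfolding hnorm_dadd_scale_square[OF assms] by (simp add: power2_eq_square algebra_simps)
qed (simp add: assms hnorm_nonneg)

lemma hnorm_dscale: "T \<in> Hs \<Longrightarrow> hnorm ip (dscale c T) = norm c * hnorm ip T"
proof (rule power2_eq_imp_eq)
  assume T: "T \<in> Hs"
  have "ip (dscale c T) (dscale c T) = c * cnj c * ip T T" using T by (simp add: ip_simps)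
  also have "\<dots> = of_real ((norm c)\<^sup>2 * (hnorm ip T)\<^sup>2)"
    unfolding ip_self[OF T] complex_norm_square[symmetric] by simp
  finally show "(hnorm ip (dscale c T))\<^sup>2 = (norm c * hnorm ip T)\<^sup>2"
    using T by (simp add: hnorm_square[OF dscale_Hs] power_mult_distrib)
qed (simp_all add: hnorm_nonneg dscale_Hs)

lemma hnorm_dsub_commute:
  assumes "T \<in> Hs" "S \<in> Hs"
  shows "hnorm ip (dsub T S) = hnorm ip (dsub S T)"
proof -
  have "dsub T S = dscale (-1) (dsub S T)" by (simp add: dadd_def dscale_def)
  then show ?thesis using hnorm_dscale[OF dsub_Hs[OF assms(2,1)], of "-1"] by simp
qed

lemma hnorm_convergent:
  assumes "\<And>n. X n \<in> Hs" "T \<in> Hs" "(\<lambda>n. hnorm ip (dsub (X n) T)) \<longlonglongrightarrow> 0"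
  shows "(\<lambda>n. hnorm ip (X n)) \<longlonglongrightarrow> hnorm ip T"
proof -
  have "norm (hnorm ip (X n) - hnorm ip T) \<le> hnorm ip (dsub (X n) T)" for n
  proof -
    have "X n = dadd (dsub (X n) T) (dscale 1 T)" "T = dadd (X n) (dscale (-1) (dsub (X n) T))"
      by (simp_all add: dadd_def dscale_def)
    then have "hnorm ip (X n) \<le> hnorm ip (dsub (X n) T) + norm (1::complex) * hnorm ip T"
      "hnorm ip T \<le> hnorm ip (X n) + norm (-1::complex) * hnorm ip (dsub (X n) T)"
      using hnorm_triangle[OF dsub_Hs[OF assms(1)[of n] assms(2)] assms(2), of 1]
        hnorm_triangle[OF assms(1)[of n] dsub_Hs[OF assms(1)[of n] assms(2)], of "-1"] by metis+
    then show ?thesis by (simp add: abs_le_iff)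
  qed
  then have "(\<lambda>n. hnorm ip (X n) - hnorm ip T) \<longlonglongrightarrow> 0"
    by (intro tendsto_0_le[OF assms(3), where K = 1]) (auto simp: hnorm_nonneg dsub_Hs assms(1,2))
  then show ?thesis by (simp add: LIM_zero_iff)
qed

lemma convergent_imp_Cauchy:
  assumes X: "\<And>n. X n \<in> Hs" and T: "T \<in> Hs" and lim: "(\<lambda>n. hnorm ip (dsub (X n) T)) \<longlonglongrightarrow> 0" and e: "e > 0"
  shows "\<exists>N. \<forall>m\<ge>N. \<forall>n\<ge>N. hnorm ip (dsub (X m) (X n)) < e"
proof -
  obtain N where N: "\<And>n. n \<ge> N \<Longrightarrow> hnorm ip (dsub (X n) T) < e / 2"
    using order_tendstoD(2)[OF lim, of "e / 2"] e unfolding eventually_sequentially by auto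
  have "hnorm ip (dsub (X m) (X n)) < e" if "m \<ge> N" "n \<ge> N" for m n
  proof -
    have "dsub (X m) (X n) = dadd (dsub (X m) T) (dscale (-1) (dsub (X n) T))"
      by (simp add: dadd_def dscale_def)
    then have "hnorm ip (dsub (X m) (X n)) \<le> hnorm ip (dsub (X m) T) + norm (-1::complex) * hnorm ip (dsub (X n) T)"
      using hnorm_triangle[OF dsub_Hs[OF X[of m] T] dsub_Hs[OF X[of n] T], of "-1"] by metis
    then show ?thesis using N[OF that(1)] N[OF that(2)] by simp
  qed
  then show ?thesis by blast
qed

lemma ip_convergent_right:
  assumes X: "\<And>n. X n \<in> Hs" and T: "T \<in> Hs" and lim: "(\<lambda>n. hnorm ip (dsub (X n) T)) \<longlonglongrightarrow> 0" and S: "S \<in> Hs"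
  shows "(\<lambda>n. ip S (X n)) \<longlonglongrightarrow> ip S T"
proof -
  have "norm (ip S (X n) - ip S T) \<le> norm (hnorm ip (dsub (X n) T)) * hnorm ip S" for n
  proof -
    have "ip S (X n) - ip S T = ip S (dsub (X n) T)" using X T S by (simp add: ip_simps)
    then show ?thesis
      using Cauchy_Schwarz[OF S dsub_Hs[OF X[of n] T]] hnorm_nonneg[OF dsub_Hs[OF X[of n] T]] by (simp add: mult.commute)
  qed
  then have "(\<lambda>n. ip S (X n) - ip S T) \<longlonglongrightarrow> 0"
    by (intro tendsto_0_le[OF lim, where K = "hnorm ip S"]) auto
  then show ?thesis by (simp add: LIM_zero_iff)
qed

lemma Hs_eqI:
  assumes "T \<in> Hs" "S \<in> Hs" "\<And>R. R \<in> Hs \<Longrightarrow> ip R T = ip R S"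
  shows "T = S"
proof -
  have D: "dsub T S \<in> Hs" by (rule dsub_Hs[OF assms(1,2)])
  have "ip (dsub T S) (dsub T S) = 0"
    using assms D assms(3)[OF D] ip_add_right[OF assms(1) dscale_Hs[OF assms(2)] D] ip_scale_right[OF assms(2) D, of "-1"]
    by simp
  then have "dsub T S = dzero" by (rule ip_definite[OF D])
  then show ?thesis by (simp add: fun_eq_iff dadd_def dscale_def dzero_def)
qed

text \<open>The minimising sequence of \<open>\<parallel>m\<parallel>\<^sup>2 - 2 Re (l m)\<close> over a subspace \<open>M\<close> that need not be closed
  is Cauchy by the parallelogram law; its limit represents \<open>l\<close>.\<close>
lemma riesz_representation:
  assumes M: "M \<subseteq> Hs" "dzero \<in> M" "\<And>m n. m \<in> M \<Longrightarrow> n \<in> M \<Longrightarrow> dadd m n \<in> M" "\<And>c m. m \<in> M \<Longrightarrow> dscale c m \<in> M"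
    and l: "\<And>m n. m \<in> M \<Longrightarrow> n \<in> M \<Longrightarrow> l (dadd m n) = l m + l n" "\<And>c m. m \<in> M \<Longrightarrow> l (dscale c m) = c * l m"
    and K: "\<And>m. m \<in> M \<Longrightarrow> norm (l m) \<le> K * hnorm ip m"
  shows "\<exists>R\<in>Hs. \<exists>X. (\<forall>n. X n \<in> M) \<and> (\<lambda>n. hnorm ip (dsub (X n) R)) \<longlonglongrightarrow> 0 \<and> (\<forall>m\<in>M. ip m R = l m)"
proof -
  define J where "J m = (hnorm ip m)\<^sup>2 - 2 * Re (l m)" for m
  have J_bound: "J m \<ge> - K\<^sup>2" if "m \<in> M" for m
  proof -
    have "Re (l m) \<le> K * hnorm ip m" using K[OF that] complex_Re_le_cmod[of "l m"] by simp
    then have "J m + K\<^sup>2 \<ge> (hnorm ip m - K)\<^sup>2" by (simp add: J_def power2_eq_square algebra_simps)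
    then show ?thesis using zero_le_power2[of "hnorm ip m - K"] by linarith
  qed
  have bdd: "bdd_below (J ` M)" using J_bound by (intro bdd_belowI[of _ "- K\<^sup>2"]) auto
  define I where "I = Inf (J ` M)"
  have I: "I \<le> J m" if "m \<in> M" for m unfolding I_def using that bdd by (intro cINF_lower)
  have "\<exists>m\<in>M. J m < I + 1 / real (Suc n)" for n
  proof -
    have "\<exists>x\<in>J ` M. x < I + 1 / real (Suc n)"
      using M(2) by (intro cInf_lessD) (auto simp: I_def)
    then show ?thesis by blast
  qed
  then obtain X where X: "\<And>n. X n \<in> M" "\<And>n. J (X n) < I + 1 / real (Suc n)" by metis
  have XH: "X n \<in> Hs" for n using X(1) M(1) by blast
  have lin: "J (dadd a (dscale c m)) = J a + (norm c)\<^sup>2 * (hnorm ip m)\<^sup>2 + 2 * Re (c * (ip m a - l m))"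
    if "a \<in> M" "m \<in> M" for a m c
    using that M(1) unfolding J_def
    by (subst hnorm_dadd_scale_square) (auto simp: l M(4) ring_distribs)
  have dist: "(hnorm ip (dsub (X m) (X n)))\<^sup>2 \<le> 2 / real (Suc m) + 2 / real (Suc n)" for m n
  proof -
    let ?a = "X m" and ?b = "X n"
    let ?D = "dsub ?b ?a"
    have D: "?D \<in> M" by (intro M X)
    have "J ?b = J (dadd ?a (dscale 1 ?D))" by (simp add: dadd_def dscale_def)
    also have "\<dots> = J ?a + (hnorm ip ?D)\<^sup>2 + 2 * Re (ip ?D ?a - l ?D)" using lin[OF X(1) D, of m 1] by simp
    finally have 1: "J ?b = J ?a + (hnorm ip ?D)\<^sup>2 + 2 * Re (ip ?D ?a - l ?D)" .
    \<comment> \<open>The midpoint of the two members lies in \<open>M\<close>, so its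
      \<open>J\<close> is at least the infimum; this is the parallelogram argument.\<close>
    have "I \<le> J (dadd ?a (dscale (1 / 2) ?D))" by (intro I M X)
    also have "\<dots> = J ?a + (hnorm ip ?D)\<^sup>2 / 4 + Re (ip ?D ?a - l ?D)"
      using lin[OF X(1) D, of m "1 / 2"] by (simp add: power2_eq_square)
    finally have "(hnorm ip ?D)\<^sup>2 \<le> 2 * (J ?a - I) + 2 * (J ?b - I)" using 1 by simp
    also have "\<dots> \<le> 2 / real (Suc m) + 2 / real (Suc n)" using X(2)[of m] X(2)[of n] by simp
    finally show ?thesis using hnorm_dsub_commute[OF XH XH] by simp
  qed
  have "\<exists>N. \<forall>m\<ge>N. \<forall>n\<ge>N. hnorm ip (dsub (X m) (X n)) < e" if e: "e > 0" for e
  proof -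
    obtain N where N: "4 / e\<^sup>2 < real N" using reals_Archimedean2 by blast
    have N0: "real N > 0" using N e by (meson divide_pos_pos less_trans zero_less_numeral zero_less_power)
    have "hnorm ip (dsub (X m) (X n)) < e" if mn: "m \<ge> N" "n \<ge> N" for m n
    proof (rule power2_less_imp_less)
      have "(hnorm ip (dsub (X m) (X n)))\<^sup>2 \<le> 2 / real (Suc m) + 2 / real (Suc n)" by (rule dist)
      also have "\<dots> \<le> 2 / real N + 2 / real N"
        using mn N0 by (intro add_mono divide_left_mono) auto
      also have "\<dots> < e\<^sup>2" using N N0 e by (simp add: field_simps)
      finally show "(hnorm ip (dsub (X m) (X n)))\<^sup>2 < e\<^sup>2" .
    qed (use e in simp)
    then show ?thesis by blast
  qed
  from Hs_complete[OF XH this] obtain R where R: "R \<in> Hs" "(\<lambda>n. hnorm ip (dsub (X n) R)) \<longlonglongrightarrow> 0" by blast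
  have "ip m R = l m" if m: "m \<in> M" for m
  proof -
    have mH: "m \<in> Hs" using m M(1) by blast
    define d where "d = ip m R - l m"
    have pos: "0 \<le> (norm t)\<^sup>2 * (hnorm ip m)\<^sup>2 + 2 * Re (t * d)" for t
    proof -
      have "- (1 / real (Suc n)) \<le> (norm t)\<^sup>2 * (hnorm ip m)\<^sup>2 + 2 * Re (t * (ip m (X n) - l m))" for n
        using I[OF M(3)[OF X(1) M(4)[OF m]], of n t] lin[OF X(1) m, of n t] X(2)[of n] by simp
      moreover have "(\<lambda>n. (norm t)\<^sup>2 * (hnorm ip m)\<^sup>2 + 2 * Re (t * (ip m (X n) - l m))) \<longlonglongrightarrow>
          (norm t)\<^sup>2 * (hnorm ip m)\<^sup>2 + 2 * Re (t * d)"
        unfolding d_def by (intro tendsto_intros ip_convergent_right[OF XH R mH])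
      moreover have "(\<lambda>n. - (1 / real (Suc n))) \<longlonglongrightarrow> - 0"
        by (intro tendsto_minus) (use LIMSEQ_inverse_real_of_nat in \<open>simp add: inverse_eq_divide\<close>)
      ultimately show ?thesis using LIMSEQ_le[of _ "- 0"] by (metis (no_types, lifting) minus_zero)
    qed
    \<comment> \<open>The best \<open>t\<close> is a negative multiple of \<open>cnj d\<close>; the
      summand 1 permits the division even if \<open>m\<close> has norm 0.\<close>
    define h where "h = (hnorm ip m)\<^sup>2 + 1"
    have h: "h > 0" by (simp add: h_def add_nonneg_pos)
    have "0 \<le> (norm (- cnj d / of_real h))\<^sup>2 * (hnorm ip m)\<^sup>2 + 2 * Re (- cnj d / of_real h * d)" by (rule pos)
    also have "- cnj d / of_real h * d = of_real (- (norm d)\<^sup>2 / h)"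
      using complex_norm_square[of d] by (simp add: mult.commute)
    also have "(norm (- cnj d / of_real h))\<^sup>2 = (norm d)\<^sup>2 / h\<^sup>2"
      using h by (simp add: norm_divide power_divide)
    finally have "2 * ((norm d)\<^sup>2 / h) \<le> (norm d)\<^sup>2 / h\<^sup>2 * (hnorm ip m)\<^sup>2" by simp
    also have "\<dots> \<le> (norm d)\<^sup>2 / h\<^sup>2 * h" by (intro mult_left_mono) (auto simp: h_def)
    also have "\<dots> = (norm d)\<^sup>2 / h" using h by (simp add: power2_eq_square)
    finally have "(norm d)\<^sup>2 / h \<le> 0" by simp
    then have "d = 0" using h by (simp add: divide_le_0_iff)
    then show ?thesis by (simp add: d_def)
  qed
  then show ?thesis using R X(1) by blast
qed

lemma schwartz_representative:
  assumes "schwartz \<phi>"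
  shows "\<exists>R\<in>Hs. \<forall>T\<in>Hs. T \<phi> = ip T R"
proof -
  obtain K where "\<And>T. T \<in> Hs \<Longrightarrow> norm (T \<phi>) \<le> K * hnorm ip T" using Hs_embedded[OF assms] by blast
  then have "\<exists>R\<in>Hs. \<exists>X. (\<forall>n. X n \<in> Hs) \<and> (\<lambda>n. hnorm ip (dsub (X n) R)) \<longlonglongrightarrow> 0 \<and> (\<forall>T\<in>Hs. ip T R = T \<phi>)"
    by (intro riesz_representation order_refl dzero_Hs dadd_Hs dscale_Hs) (auto simp: dadd_def dscale_def)
  then show ?thesis by metis
qed

end

section \<open>Unitarization\<close>

lemma modtrans_tf_shift: "schwartz \<phi> \<Longrightarrow> modtrans x \<xi> T \<phi> = T (tf_shift x \<xi> \<phi>)"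
  by (simp add: modtrans_def tf_shift_def[abs_def])

lemma modtrans_dadd: "modtrans x \<xi> (dadd T S) = dadd (modtrans x \<xi> T) (modtrans x \<xi> S)"
  by (auto simp: modtrans_def dadd_def)

lemma modtrans_dscale: "modtrans x \<xi> (dscale c T) = dscale c (modtrans x \<xi> T)"
  by (auto simp: modtrans_def dscale_def)

text \<open>The scalar comes from commuting a translation with a modulation. It is unimodular, so it
  cancels in an inner product of two equally shifted distributions.\<close>

lemma modtrans_modtrans:
  assumes "tempered T"
  shows "modtrans x \<xi> (modtrans y \<eta> T) = dscale (exp (- \<i> * complex_of_real (x \<bullet> \<eta>))) (modtrans (x + y) (\<xi> + \<eta>) T)"
proof
  fix \<phi> :: "'a \<Rightarrow> complex"
  show "modtrans x \<xi> (modtrans y \<eta> T) \<phi> = dscale (exp (- \<i> * complex_of_real (x \<bullet> \<eta>))) (modtrans (x + y) (\<xi> + \<eta>) T) \<phi>"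
  proof (cases "schwartz \<phi>")
    case True
    have "tf_shift y \<eta> (tf_shift x \<xi> \<phi>) = (\<lambda>z. exp (- \<i> * complex_of_real (x \<bullet> \<eta>)) * tf_shift (x + y) (\<xi> + \<eta>) \<phi> z)"
    proof
      fix z
      have "\<i> * complex_of_real ((z + y) \<bullet> \<eta>) + \<i> * complex_of_real ((z + y + x) \<bullet> \<xi>) =
          - \<i> * complex_of_real (x \<bullet> \<eta>) + \<i> * complex_of_real ((z + (x + y)) \<bullet> (\<xi> + \<eta>))"
        by (simp add: inner_simps algebra_simps)
      then show "tf_shift y \<eta> (tf_shift x \<xi> \<phi>) z = exp (- \<i> * complex_of_real (x \<bullet> \<eta>)) * tf_shift (x + y) (\<xi> + \<eta>) \<phi> z"
        unfolding tf_shift_def mult.assoc[symmetric] exp_add[symmetric] by (simp add: add_ac)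
    qed
    then show ?thesis
      using True assms by (simp add: modtrans_tf_shift schwartz_tf_shift dscale_def tempered_cmult)
  qed (simp add: modtrans_def dscale_def)
qed

lemma modtrans_0:
  assumes "tempered T"
  shows "modtrans 0 0 T = T"
  using assms by (auto simp: modtrans_def tempered_def)

text \<open>Lists and not finite sets, because points \<open>z + j g\<close> may coincide and must
  count with multiplicity.\<close>

definition list_average :: "'v list \<Rightarrow> ('v \<Rightarrow> complex) \<Rightarrow> complex" where
  "list_average zs F = (\<Sum>z\<leftarrow>zs. F z) / of_nat (length zs)"

lemma norm_list_average_le:
  assumes "zs \<noteq> []" "\<And>z. norm (F z) \<le> b"
  shows "norm (list_average zs F) \<le> b"
proof -
  have "norm (\<Sum>z\<leftarrow>zs. F z) \<le> real (length zs) * b"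
  proof (induction zs)
    case (Cons z zs)
    then show ?case using norm_triangle_mono[OF assms(2)[of z] Cons] by (simp add: algebra_simps)
  qed simp
  then show ?thesis using assms(1) by (simp add: list_average_def norm_divide field_simps)
qed

lemma list_average_add: "list_average zs (\<lambda>z. F z + G z) = list_average zs F + list_average zs G"
  by (simp add: list_average_def sum_list_addf add_divide_distrib)

lemma list_average_cmult: "list_average zs (\<lambda>z. c * F z) = c * list_average zs F"
  by (simp add: list_average_def sum_list_const_mult)

lemma list_average_cnj: "list_average zs (\<lambda>z. cnj (F z)) = cnj (list_average zs F)"
proof -
  have "(\<Sum>z\<leftarrow>zs. cnj (F z)) = cnj (\<Sum>z\<leftarrow>zs. F z)" by (induction zs) auto
  then show ?thesis by (simp add: list_average_def)
qed

lemma Re_list_average: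
  assumes "zs \<noteq> []" "\<And>z. a \<le> Re (F z)" "\<And>z. Re (F z) \<le> b"
  shows "a \<le> Re (list_average zs F)" "Re (list_average zs F) \<le> b"
proof -
  have "real (length zs) * a \<le> Re (\<Sum>z\<leftarrow>zs. F z) \<and> Re (\<Sum>z\<leftarrow>zs. F z) \<le> real (length zs) * b"
  proof (induction zs)
    case (Cons z zs)
    then show ?case using assms(2,3)[of z] by (simp add: algebra_simps)
  qed simp
  then show "a \<le> Re (list_average zs F)" "Re (list_average zs F) \<le> b"
    using assms(1) by (auto simp: list_average_def field_simps Re_divide_of_nat)
qed

lemma list_average_product:
  assumes "N > 0"
  shows "list_average (concat (map (\<lambda>j. map (\<lambda>z. z + f j) zs) [0..<N])) F =
         (\<Sum>j<N. list_average zs (\<lambda>z. F (z + f j))) / of_nat N"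
proof -
  have len: "length (concat (map (\<lambda>j. map (\<lambda>z. z + f j) zs) [0..<N])) = N * length zs"
    by (simp add: length_concat o_def sum_list_triv)
  have "(\<Sum>z\<leftarrow>concat (map (\<lambda>j. map (\<lambda>z. z + f j) zs) [0..<N]). F z) = (\<Sum>j<N. \<Sum>z\<leftarrow>zs. F (z + f j))"
    by (induction N) (auto simp: o_def)
  then show ?thesis
    unfolding list_average_def len by (simp add: sum_divide_distrib[symmetric])
qed

text \<open>Foelner lists: averaging over \<open>z + j g\<close>, \<open>j < N\<close>, gains invariance under \<open>g\<close> and keeps the
  approximate invariance already achieved, because the latter holds for all bounded functions.\<close>
lemma almost_invariant_lists:
  fixes G :: "'v::real_vector set"
  assumes "finite G" "N > 0"
  shows "\<exists>zs. zs \<noteq> [] \<and> (\<forall>F b. (\<forall>z. norm (F z) \<le> b) \<longrightarrow>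
    (\<forall>g\<in>G. norm (list_average zs (\<lambda>z. F (z + g)) - list_average zs F) \<le> 2 * b / real N))"
  using assms(1)
proof (induction G rule: finite_induct)
  case empty
  show ?case by (intro exI[of _ "[0]"]) auto
next
  case (insert g G)
  then obtain zs where zs: "zs \<noteq> []" "\<And>F b h. (\<And>z. norm (F z) \<le> b) \<Longrightarrow> h \<in> G \<Longrightarrow>
      norm (list_average zs (\<lambda>z. F (z + h)) - list_average zs F) \<le> 2 * b / real N" by blast
  define f where "f j = real j *\<^sub>R g" for j
  define zs' where "zs' = concat (map (\<lambda>j. map (\<lambda>z. z + f j) zs) [0..<N])"
  have avg: "list_average zs' F = (\<Sum>j<N. list_average zs (\<lambda>z. F (z + f j))) / of_nat N" for F
    unfolding zs'_def by (rule list_average_product[OF assms(2)])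
  have "norm (list_average zs' (\<lambda>z. F (z + h)) - list_average zs' F) \<le> 2 * b / real N"
    if F: "\<And>z. norm (F z) \<le> b" and h: "h \<in> insert g G" for F b h
  proof (cases "h = g")
    case True
    \<comment> \<open>Shifting by \<open>g\<close> raises \<open>j\<close> by one, so the difference
      telescopes to two end terms of norm at most \<open>b\<close>.\<close>
    have "(\<Sum>j<N. list_average zs (\<lambda>z. F (z + f j + g))) - (\<Sum>j<N. list_average zs (\<lambda>z. F (z + f j))) =
        (\<Sum>j<N. list_average zs (\<lambda>z. F (z + f (Suc j))) - list_average zs (\<lambda>z. F (z + f j)))"
      by (simp add: sum_subtractf f_def algebra_simps)
    also have "\<dots> = list_average zs (\<lambda>z. F (z + f N)) - list_average zs (\<lambda>z. F (z + f 0))"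
      by (rule sum_lessThan_telescope)
    finally have "list_average zs' (\<lambda>z. F (z + h)) - list_average zs' F =
        (list_average zs (\<lambda>z. F (z + f N)) - list_average zs (\<lambda>z. F (z + f 0))) / of_nat N"
      unfolding avg True diff_divide_distrib[symmetric] by (rule arg_cong)
    moreover have "norm (list_average zs (\<lambda>z. F (z + f N)) - list_average zs (\<lambda>z. F (z + f 0))) \<le> b + b"
      by (intro order_trans[OF norm_triangle_ineq4] add_mono norm_list_average_le zs(1) F)
    ultimately show ?thesis using assms(2) by (simp add: norm_divide divide_right_mono)
  next
    case False
    then have hG: "h \<in> G" using h by simp
    have "list_average zs' (\<lambda>z. F (z + h)) - list_average zs' F =
        (\<Sum>j<N. list_average zs (\<lambda>z. F (z + h + f j)) - list_average zs (\<lambda>z. F (z + f j))) / of_nat N"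
      unfolding avg by (simp add: sum_subtractf diff_divide_distrib add_ac)
    moreover have "norm (\<Sum>j<N. list_average zs (\<lambda>z. F (z + h + f j)) - list_average zs (\<lambda>z. F (z + f j))) \<le> (\<Sum>j<N. 2 * b / real N)"
      by (intro sum_norm_le zs(2)[of "\<lambda>z. F (z + f _)"] F hG)
    ultimately have "norm (list_average zs' (\<lambda>z. F (z + h)) - list_average zs' F) \<le> (\<Sum>j<N. 2 * b / real N) / real N"
      by (simp only: norm_divide norm_of_nat divide_right_mono of_nat_0_le_iff)
    then show ?thesis using assms(2) by simp
  qed
  moreover have "zs' \<noteq> []" using zs(1) assms(2) by (auto simp: zs'_def)
  ultimately show ?case by blast
qed

lemma closed_Collect_ball:
  "(\<And>x. x \<in> A \<Longrightarrow> closed {p. P x p}) \<Longrightarrow> closed {p. \<forall>x\<in>A. P x p}"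
  by (simp add: Collect_ball_eq closed_INT)

lemma compact_Pi_cball:
  fixes r :: "'i \<Rightarrow> real"
  shows "compact {p :: 'i \<Rightarrow> complex. \<forall>i. p i \<in> cball 0 (r i)}"
proof -
  have "compactin (product_topology (\<lambda>i. euclidean) UNIV) (PiE UNIV (\<lambda>i. cball (0::complex) (r i)))"
    by (subst compactin_PiE) auto
  moreover have "PiE UNIV (\<lambda>i. cball (0::complex) (r i)) = {p. \<forall>i. p i \<in> cball 0 (r i)}"
    by (auto simp: PiE_def)
  ultimately show ?thesis by (simp add: euclidean_product_topology)
qed

text \<open>The new inner product is a point of a compact product of discs, indexed by pairs of
  distributions. The axioms, the norm bounds (\<open>Good\<close>) and approximate invariance
  (\<open>E\<close>) are closed conditions; any finitely many of them hold for the average over one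
  Foelner list, and compactness yields all at once.\<close>

theorem unitarization:
  fixes Hs :: "(('a::euclidean_space \<Rightarrow> complex) \<Rightarrow> complex) set"
  assumes H: "hilbert_embedded Hs ip" and C0: "C0 \<ge> 1"
    and inv: "\<forall>T\<in>Hs. \<forall>x \<xi>. modtrans x \<xi> T \<in> Hs \<and> hnorm ip (modtrans x \<xi> T) \<le> C0 * hnorm ip T"
  shows "\<exists>ip'. hilbert_embedded Hs ip' \<and>
    (\<forall>T\<in>Hs. \<forall>S\<in>Hs. \<forall>x \<xi>. ip' (modtrans x \<xi> T) (modtrans x \<xi> S) = ip' T S) \<and>
    (\<forall>T\<in>Hs. hnorm ip T \<le> C0 * hnorm ip' T \<and> hnorm ip' T \<le> C0 * hnorm ip T)"
proof -
  interpret hilbert_distributions Hs ip by unfold_locales (rule H)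
  define mt where "mt z = modtrans (fst z) (snd z :: 'a)" for z
  have mtH: "mt z T \<in> Hs" and mt_le: "hnorm ip (mt z T) \<le> C0 * hnorm ip T" if "T \<in> Hs" for z T
    using inv that by (auto simp: mt_def)
  have mt_mt: "\<exists>c. norm c = 1 \<and> (\<forall>T\<in>Hs. mt z (mt g T) = dscale c (mt (z + g) T))" for z g
    using modtrans_modtrans[OF Hs_tempered, of _ "fst z" "snd z" "fst g" "snd g"]
    by (intro exI[of _ "exp (- \<i> * complex_of_real (fst z \<bullet> snd g))"]) (auto simp: mt_def)
  \<comment> \<open>Undo the shift by its inverse, which also costs \<open>C0\<close>.\<close>
  have mt_ge: "hnorm ip T \<le> C0 * hnorm ip (mt z T)" if T: "T \<in> Hs" for z T
  proof -
    obtain c where c: "norm c = 1" "mt (- z) (mt z T) = dscale c (mt (- z + z) T)" using mt_mt[of "- z" z] T by blast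
    have "mt (- z + z) T = T" using modtrans_0[OF Hs_tempered[OF T]] by (simp add: mt_def)
    then have "hnorm ip T = hnorm ip (mt (- z) (mt z T))" using c T by (simp add: hnorm_dscale)
    then show ?thesis using mt_le[OF mtH[OF T]] by simp
  qed
  define F where "F T S z = ip (mt z T) (mt z S)" for T S z
  define b where "b T S = C0\<^sup>2 * (hnorm ip T * hnorm ip S)" for T S
  have Fb: "norm (F T S z) \<le> b T S" if "T \<in> Hs" "S \<in> Hs" for T S z
  proof -
    have "norm (F T S z) \<le> hnorm ip (mt z T) * hnorm ip (mt z S)"
      unfolding F_def by (intro Cauchy_Schwarz mtH that)
    also have "\<dots> \<le> (C0 * hnorm ip T) * (C0 * hnorm ip S)"
      using C0 that by (intro mult_mono mt_le) (auto simp: hnorm_nonneg mtH)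
    finally show ?thesis by (simp add: b_def power2_eq_square mult_ac)
  qed
  have Fshift: "F (mt g T) (mt g S) z = F T S (z + g)" if "T \<in> Hs" "S \<in> Hs" for g T S z
  proof -
    obtain c where c: "norm c = 1" "\<forall>T\<in>Hs. mt z (mt g T) = dscale c (mt (z + g) T)" using mt_mt by blast
    have "cnj c * c = 1" using c(1) complex_norm_square[of c] by (simp add: mult.commute)
    then show ?thesis unfolding F_def using c(2) that mtH
      by (simp add: ip_scale_left ip_scale_right dscale_Hs mult.assoc[symmetric])
  qed
  \<comment> \<open>Pairs outside \<open>Hs\<close> get radius 0, so that every coordinate ranges
    over a compact disc.\<close>
  define r where "r = (\<lambda>(T, S). if T \<in> Hs \<and> S \<in> Hs then b T S else 0)"
  define P where "P = {p. \<forall>i. p i \<in> cball (0::complex) (r i)}"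
  \<comment> \<open>The quantifier over scalars is written \<open>c\<in>UNIV\<close> so that
    \<open>closed_Collect_ball\<close> applies to it.\<close>
  define Good where "Good = {p :: _ \<Rightarrow> complex. (\<forall>T\<in>Hs. \<forall>S\<in>Hs. \<forall>R\<in>Hs. p (dadd T S, R) = p (T, R) + p (S, R)) \<and>
      (\<forall>c\<in>UNIV. \<forall>T\<in>Hs. \<forall>S\<in>Hs. p (dscale c T, S) = c * p (T, S)) \<and>
      (\<forall>T\<in>Hs. \<forall>S\<in>Hs. p (T, S) = cnj (p (S, T))) \<and>
      (\<forall>T\<in>Hs. (hnorm ip T / C0)\<^sup>2 \<le> Re (p (T, T)) \<and> Re (p (T, T)) \<le> (C0 * hnorm ip T)\<^sup>2)}"
  \<comment> \<open>One list achieves only a tolerance for finitely many \<open>g\<close>; exact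
    invariance arises from intersecting over all \<open>n\<close>.\<close>
  define E where "E = (\<lambda>(g, n). {p :: _ \<Rightarrow> complex. \<forall>T\<in>Hs. \<forall>S\<in>Hs. norm (p (mt g T, mt g S) - p (T, S)) \<le> 2 * b T S / real (Suc n)})"
  have cG: "closed Good"
    unfolding Good_def
    by (intro closed_Collect_conj closed_Collect_ball closed_Collect_eq closed_Collect_le continuous_intros continuous_on_product_coordinates)
  have cE: "closed (E gn)" for gn
    unfolding E_def by (cases gn, simp only: prod.case)
       (intro closed_Collect_ball closed_Collect_le continuous_intros continuous_on_product_coordinates)
  have fip: "P \<inter> \<Inter>\<F> \<noteq> {}" if \<F>: "finite \<F>" "\<F> \<subseteq> insert Good (range E)" for \<F>
  proof -
    obtain Q where Q: "finite Q" "\<F> \<subseteq> insert Good (E ` Q)"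
    proof -
      have "finite (\<F> - {Good})" "\<F> - {Good} \<subseteq> range E" using \<F> by auto
      then obtain Q where "finite Q" "\<F> - {Good} = E ` Q" using finite_subset_image[of "\<F> - {Good}" E UNIV] by blast
      then show ?thesis using that by blast
    qed
    \<comment> \<open>Large enough to meet the strictest tolerance among the finitely many
      conditions in \<open>Q\<close>.\<close>
    define N where "N = Suc (Max (insert 0 (snd ` Q)))"
    have N: "N > 0" "\<And>g n. (g, n) \<in> Q \<Longrightarrow> Suc n \<le> N"
      unfolding N_def using Q(1) by (auto intro!: Max_ge) (metis Max_ge finite_imageI finite_insert insertCI imageI snd_conv)
    obtain zs where zs: "zs \<noteq> []" "\<And>F b g. (\<And>z. norm (F z) \<le> b) \<Longrightarrow> g \<in> fst ` Q \<Longrightarrow>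
        norm (list_average zs (\<lambda>z. F (z + g)) - list_average zs F) \<le> 2 * b / real N"
      using almost_invariant_lists[of "fst ` Q" N] Q(1) N(1) by blast
    define p where "p = (\<lambda>(T, S). if T \<in> Hs \<and> S \<in> Hs then list_average zs (F T S) else 0)"
    have pHs: "p (T, S) = list_average zs (F T S)" if "T \<in> Hs" "S \<in> Hs" for T S
      using that by (simp add: p_def)
    have "p \<in> P"
      unfolding P_def p_def r_def by (auto intro!: norm_list_average_le zs(1) Fb)
    moreover have "p \<in> Good"
      unfolding Good_def
    proof (intro CollectI conjI ballI)
      fix T S R assume TSR: "T \<in> Hs" "S \<in> Hs" "R \<in> Hs"
      have "F (dadd T S) R = (\<lambda>z. F T R z + F S R z)"
        using TSR mtH by (simp add: F_def[abs_def] mt_def modtrans_dadd ip_add_left)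
      then show "p (dadd T S, R) = p (T, R) + p (S, R)"
        using TSR by (simp add: pHs dadd_Hs list_average_add)
    next
      fix c T S assume TS: "T \<in> Hs" "S \<in> Hs"
      have "F (dscale c T) S = (\<lambda>z. c * F T S z)"
        using TS mtH by (simp add: F_def[abs_def] mt_def modtrans_dscale ip_scale_left)
      then show "p (dscale c T, S) = c * p (T, S)"
        using TS by (simp add: pHs dscale_Hs list_average_cmult)
    next
      fix T S assume TS: "T \<in> Hs" "S \<in> Hs"
      have "F T S = (\<lambda>z. cnj (F S T z))"
        unfolding F_def by (intro ext ip_sym mtH TS)
      then show "p (T, S) = cnj (p (S, T))" using TS by (simp add: pHs list_average_cnj)
    next
      fix T assume T: "T \<in> Hs"
      have FR: "Re (F T T z) = (hnorm ip (mt z T))\<^sup>2" for z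
        using T by (simp add: F_def hnorm_square mtH)
      have lo: "(hnorm ip T / C0)\<^sup>2 \<le> Re (F T T z)" for z
        unfolding FR using mt_ge[OF T, of z] C0 T by (intro power_mono) (auto simp: field_simps hnorm_nonneg)
      have hi: "Re (F T T z) \<le> (C0 * hnorm ip T)\<^sup>2" for z
        unfolding FR using mt_le[OF T, of z] T by (intro power_mono) (auto simp: hnorm_nonneg mtH)
      show "(hnorm ip T / C0)\<^sup>2 \<le> Re (p (T, T))" "Re (p (T, T)) \<le> (C0 * hnorm ip T)\<^sup>2"
        unfolding pHs[OF T T] by (rule Re_list_average[OF zs(1) lo hi])+
    qed
    moreover have "p \<in> E gn" if "gn \<in> Q" for gn
    proof -
      obtain g n where gn: "gn = (g, n)" by (cases gn)
      have g: "g \<in> fst ` Q" using that gn by force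
      have "norm (p (mt g T, mt g S) - p (T, S)) \<le> 2 * b T S / real (Suc n)" if TS: "T \<in> Hs" "S \<in> Hs" for T S
      proof -
        have b0: "0 \<le> b T S" using Fb[OF TS, of 0] norm_ge_zero order_trans by blast
        have "norm (p (mt g T, mt g S) - p (T, S)) \<le> 2 * b T S / real N"
        proof -
          have "F (mt g T) (mt g S) = (\<lambda>z. F T S (z + g))" by (intro ext Fshift TS)
          then show ?thesis using zs(2)[OF Fb[OF TS] g] TS by (simp add: pHs mtH)
        qed
        also have "\<dots> \<le> 2 * b T S / real (Suc n)"
          using N(2)[of g n] \<open>gn \<in> Q\<close> gn b0 by (intro divide_left_mono) auto
        finally show ?thesis .
      qed
      then show ?thesis by (simp add: E_def gn)
    qed
    ultimately show ?thesis using Q(2) by blast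
  qed
  have "compact P" unfolding P_def by (rule compact_Pi_cball)
  then have "P \<inter> \<Inter>(insert Good (range E)) \<noteq> {}"
  proof (rule compact_imp_fip)
    show "closed W" if "W \<in> insert Good (range E)" for W using that cG cE by blast
  qed (rule fip)
  then obtain p where "p \<in> P \<inter> \<Inter>(insert Good (range E))" by (meson all_not_in_conv)
  then have p: "p \<in> Good" "p \<in> E gn" for gn by (simp, cases gn, auto)
  define ip' where "ip' T S = p (T, S)" for T S
  \<comment> \<open>The tolerances \<open>2 * b T S / real (Suc n)\<close> tend to 0.\<close>
  have eq0: "x = 0" if "\<And>n. norm x \<le> 2 * y / real (Suc n)" for x :: complex and y
  proof -
    have "(\<lambda>n. 2 * y * (1 / real (Suc n))) \<longlonglongrightarrow> 2 * y * 0"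
      by (intro tendsto_mult tendsto_const) (use LIMSEQ_inverse_real_of_nat in \<open>simp add: inverse_eq_divide\<close>)
    then have "norm x \<le> 2 * y * 0" using that by (intro LIMSEQ_le_const) auto
    then show ?thesis by simp
  qed
  have ip'_inv: "ip' (modtrans x \<xi> T) (modtrans x \<xi> S) = ip' T S" if "T \<in> Hs" "S \<in> Hs" for T S x \<xi>
  proof -
    have "norm (p (mt (x, \<xi>) T, mt (x, \<xi>) S) - p (T, S)) \<le> 2 * b T S / real (Suc n)" for n
      using p(2)[of "((x, \<xi>), n)"] that by (simp add: E_def)
    from eq0[OF this] show ?thesis by (simp add: ip'_def mt_def)
  qed
  have g1: "ip' (dadd T S) R = ip' T R + ip' S R" if "T \<in> Hs" "S \<in> Hs" "R \<in> Hs" for T S R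
    using p(1) that unfolding Good_def ip'_def by blast
  have g2: "ip' (dscale c T) S = c * ip' T S" if "T \<in> Hs" "S \<in> Hs" for c T S
    using p(1) that unfolding Good_def ip'_def by blast
  have g3: "ip' T S = cnj (ip' S T)" if "T \<in> Hs" "S \<in> Hs" for T S
    using p(1) that unfolding Good_def ip'_def by blast
  have g4: "(hnorm ip T / C0)\<^sup>2 \<le> Re (ip' T T)" "Re (ip' T T) \<le> (C0 * hnorm ip T)\<^sup>2" if "T \<in> Hs" for T
    using p(1) that unfolding Good_def ip'_def by blast+
  have pos: "Re (ip' T T) \<ge> 0" if "T \<in> Hs" for T
    using g4(1)[OF that] zero_le_power2[of "hnorm ip T / C0"] by linarith
  have up: "hnorm ip' T \<le> C0 * hnorm ip T" if "T \<in> Hs" for T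
    unfolding hnorm_def[of ip'] using g4(2)[OF that] C0 that by (intro real_le_lsqrt) (auto simp: hnorm_nonneg)
  have low: "hnorm ip T \<le> C0 * hnorm ip' T" if "T \<in> Hs" for T
  proof -
    have "hnorm ip T / C0 \<le> hnorm ip' T"
      unfolding hnorm_def[of ip'] using g4(1)[OF that] by (rule real_le_rsqrt)
    then show ?thesis using C0 by (simp add: field_simps)
  qed
  have "hilbert_embedded Hs ip'"
    unfolding hilbert_embedded_def
  proof (intro conjI ballI allI impI)
    show "Hs \<subseteq> {T. tempered T}" using Hs_tempered by blast
    show "T = dzero" if "T \<in> Hs" "ip' T T = 0" for T
      using low[OF that(1)] that hnorm_nonneg[OF that(1)] by (intro hnorm_eq_0) (auto simp: hnorm_def[of ip'])
    show "\<exists>K. \<forall>T\<in>Hs. norm (T \<phi>) \<le> K * hnorm ip' T" if \<phi>: "schwartz \<phi>" for \<phi>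
    proof -
      obtain K where K: "\<And>T. T \<in> Hs \<Longrightarrow> norm (T \<phi>) \<le> K * hnorm ip T" using Hs_embedded[OF \<phi>] by blast
      have "norm (T \<phi>) \<le> (\<bar>K\<bar> * C0) * hnorm ip' T" if T: "T \<in> Hs" for T
      proof -
        have "norm (T \<phi>) \<le> \<bar>K\<bar> * hnorm ip T"
          using K[OF T] mult_right_mono[OF abs_ge_self[of K] hnorm_nonneg[OF T]] by linarith
        also have "\<dots> \<le> \<bar>K\<bar> * (C0 * hnorm ip' T)" by (intro mult_left_mono low T) auto
        finally show ?thesis by (simp add: mult.assoc)
      qed
      then show ?thesis by blast
    qed
    fix X :: "nat \<Rightarrow> _" assume X: "(\<forall>n. X n \<in> Hs) \<and> (\<forall>e>0. \<exists>N. \<forall>m\<ge>N. \<forall>n\<ge>N. hnorm ip' (dsub (X m) (X n)) < e)"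
    have "\<exists>T\<in>Hs. (\<lambda>n. hnorm ip (dsub (X n) T)) \<longlonglongrightarrow> 0"
    proof (rule Hs_complete)
      show "X n \<in> Hs" for n using X by blast
      fix e :: real assume e: "e > 0"
      then have "e / C0 > 0" using C0 by simp
      then obtain N where N: "\<And>m n. m \<ge> N \<Longrightarrow> n \<ge> N \<Longrightarrow> hnorm ip' (dsub (X m) (X n)) < e / C0" using X by blast
      have "hnorm ip (dsub (X m) (X n)) < e" if "m \<ge> N" "n \<ge> N" for m n
        using low[OF dsub_Hs, of "X m" "X n"] N[OF that] X C0 by (simp add: field_simps)
      then show "\<exists>N. \<forall>m\<ge>N. \<forall>n\<ge>N. hnorm ip (dsub (X m) (X n)) < e" by blast
    qed
    then obtain T where T: "T \<in> Hs" "(\<lambda>n. hnorm ip (dsub (X n) T)) \<longlonglongrightarrow> 0" by blast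
    have "(\<lambda>n. hnorm ip' (dsub (X n) T)) \<longlonglongrightarrow> 0"
    proof (rule tendsto_0_le[OF T(2), where K = C0])
      have "hnorm ip' (dsub (X n) T) \<le> C0 * hnorm ip (dsub (X n) T)" "0 \<le> hnorm ip' (dsub (X n) T)"
        "0 \<le> hnorm ip (dsub (X n) T)" for n
        using up[OF dsub_Hs] pos[OF dsub_Hs] X T(1) hnorm_nonneg[OF dsub_Hs] by (auto simp: hnorm_def[of ip'])
      then show "\<forall>\<^sub>F n in sequentially. norm (hnorm ip' (dsub (X n) T)) \<le> norm (hnorm ip (dsub (X n) T)) * C0"
        by (auto simp: mult.commute)
    qed
    then show "\<exists>T\<in>Hs. (\<lambda>n. hnorm ip' (dsub (X n) T)) \<longlonglongrightarrow> 0" using T(1) by blast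
  qed (auto simp: dzero_Hs dadd_Hs dscale_Hs g1 g2 pos intro: g3)
  then show ?thesis using ip'_inv low up by blast
qed

section \<open>Unitarily invariant Hilbert spaces of distributions\<close>

locale invariant_hilbert_distributions = hilbert_distributions +
  assumes modtrans_Hs: "T \<in> Hs \<Longrightarrow> modtrans x \<xi> T \<in> Hs"
    and ip_modtrans: "T \<in> Hs \<Longrightarrow> S \<in> Hs \<Longrightarrow> ip (modtrans x \<xi> T) (modtrans x \<xi> S) = ip T S"
    and nontrivial: "Hs \<noteq> {dzero}"
begin

text \<open>The Riesz representative of evaluation at \<open>\<phi>\<close>, unique by
  \<open>Hs_eqI\<close>. It depends conjugate-linearly on \<open>\<phi>\<close>, which explains the
  conjugations below.\<close>

definition rep :: "('a \<Rightarrow> complex) \<Rightarrow> ('a \<Rightarrow> complex) \<Rightarrow> complex" where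
  "rep \<phi> = (SOME R. R \<in> Hs \<and> (\<forall>T\<in>Hs. T \<phi> = ip T R))"

lemma rep_Hs: "schwartz \<phi> \<Longrightarrow> rep \<phi> \<in> Hs"
  and ip_rep: "schwartz \<phi> \<Longrightarrow> T \<in> Hs \<Longrightarrow> ip T (rep \<phi>) = T \<phi>"
proof -
  assume "schwartz \<phi>"
  then have "\<exists>R. R \<in> Hs \<and> (\<forall>T\<in>Hs. T \<phi> = ip T R)" using schwartz_representative by blast
  from someI_ex[OF this] have R: "rep \<phi> \<in> Hs" "\<forall>T\<in>Hs. T \<phi> = ip T (rep \<phi>)" unfolding rep_def by blast+
  then show "rep \<phi> \<in> Hs" by blast
  show "ip T (rep \<phi>) = T \<phi>" if "T \<in> Hs" using R(2) that by simp
qed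

lemma rep_eqI: "schwartz \<phi> \<Longrightarrow> R \<in> Hs \<Longrightarrow> (\<And>T. T \<in> Hs \<Longrightarrow> ip T R = T \<phi>) \<Longrightarrow> rep \<phi> = R"
  using ip_rep rep_Hs by (intro Hs_eqI) auto

lemma modtrans_surj:
  assumes "S \<in> Hs"
  shows "\<exists>S'\<in>Hs. modtrans x \<xi> S' = S"
proof -
  define c where "c = exp (- \<i> * complex_of_real (x \<bullet> - \<xi>))"
  have eq: "modtrans x \<xi> (modtrans (- x) (- \<xi>) S) = dscale c S"
    using modtrans_modtrans[OF Hs_tempered[OF assms], of x \<xi> "- x" "- \<xi>"] modtrans_0[OF Hs_tempered[OF assms]]
    by (simp add: c_def)
  have "modtrans x \<xi> (dscale (1 / c) (modtrans (- x) (- \<xi>) S)) = S"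
    unfolding modtrans_dscale eq by (simp add: dscale_def c_def)
  then show ?thesis using assms by (intro bexI[of _ "dscale (1 / c) (modtrans (- x) (- \<xi>) S)"] dscale_Hs modtrans_Hs)
qed

text \<open>A unitary map carries representatives of functionals to representatives. The defining
  property must be tested on every member of \<open>Hs\<close>, hence the appeal to surjectivity of
  the shift.\<close>

lemma modtrans_rep:
  assumes "schwartz \<psi>"
  shows "modtrans x \<xi> (rep (tf_shift x \<xi> \<psi>)) = rep \<psi>"
proof (rule rep_eqI[OF assms, symmetric])
  have M: "schwartz (tf_shift x \<xi> \<psi>)" by (rule schwartz_tf_shift[OF assms])
  show "modtrans x \<xi> (rep (tf_shift x \<xi> \<psi>)) \<in> Hs" by (intro modtrans_Hs rep_Hs M)
  fix S assume "S \<in> Hs"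
  then obtain S' where S': "S' \<in> Hs" "modtrans x \<xi> S' = S" using modtrans_surj by blast
  have "ip (modtrans x \<xi> S') (modtrans x \<xi> (rep (tf_shift x \<xi> \<psi>))) = S' (tf_shift x \<xi> \<psi>)"
    using S'(1) M by (simp add: ip_modtrans rep_Hs ip_rep)
  then show "ip S (modtrans x \<xi> (rep (tf_shift x \<xi> \<psi>))) = S \<psi>"
    using S'(2) modtrans_tf_shift[OF assms, of x \<xi> S'] by simp
qed

text \<open>\<open>rep \<psi> \<phi>\<close> equals \<open>ip (rep \<psi>) (rep \<phi>)\<close>,
  which gives hermitian symmetry; invariance is \<open>modtrans_rep\<close> evaluated at
  \<open>\<phi>\<close>.\<close>

lemma invariant_form_rep: "invariant_form (\<lambda>\<phi> \<psi>. rep \<psi> \<phi>)"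
proof
  fix \<phi> \<psi> :: "'a \<Rightarrow> complex" and x \<xi>
  show "tempered (\<lambda>\<phi>. rep \<psi> \<phi>)" if "schwartz \<psi>" using Hs_tempered[OF rep_Hs[OF that]] .
  assume S: "schwartz \<phi>" "schwartz \<psi>"
  show "rep \<psi> \<phi> = cnj (rep \<phi> \<psi>)"
    using ip_sym[OF rep_Hs[OF S(2)] rep_Hs[OF S(1)]] ip_rep[OF S(1) rep_Hs[OF S(2)]] ip_rep[OF S(2) rep_Hs[OF S(1)]] by simp
  show "rep (tf_shift x \<xi> \<psi>) (tf_shift x \<xi> \<phi>) = rep \<psi> \<phi>"
    using fun_cong[OF modtrans_rep[OF S(2), of x \<xi>], of \<phi>] modtrans_tf_shift[OF S(1)] by simp
qed

text \<open>The squared norm of \<open>rep \<phi>\<close> is \<open>c\<close> times that of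
  \<open>\<phi>\<close>. If \<open>c\<close> were not positive all representatives would vanish, and
  with them every evaluation of every member of \<open>Hs\<close>.\<close>

lemma rep_l2_form:
  obtains c where "c > 0" "\<And>\<phi> \<psi>. schwartz \<phi> \<Longrightarrow> schwartz \<psi> \<Longrightarrow> rep \<psi> \<phi> = of_real c * l2_form \<phi> \<psi>"
proof -
  obtain c where c: "\<And>\<phi> \<psi>. schwartz \<phi> \<Longrightarrow> schwartz \<psi> \<Longrightarrow> rep \<psi> \<phi> = of_real c * l2_form \<phi> \<psi>"
    using invariant_form_eq_l2_form[OF invariant_form_rep] by blast
  have sq: "(hnorm ip (rep \<phi>))\<^sup>2 = c * (L2_norm \<phi>)\<^sup>2" if "schwartz \<phi>" for \<phi>
    using hnorm_square[OF rep_Hs[OF that]] ip_rep[OF that rep_Hs[OF that]] c[OF that that] l2_form_self[OF that] by simp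
  have "c > 0"
  proof (rule ccontr)
    assume "\<not> c > 0"
    then have "(hnorm ip (rep \<phi>))\<^sup>2 \<le> 0" if "schwartz \<phi>" for \<phi>
      unfolding sq[OF that] by (simp add: mult_nonpos_nonneg)
    then have r0: "rep \<phi> = dzero" if "schwartz \<phi>" for \<phi>
      using that by (intro hnorm_eq_0 rep_Hs) auto
    have "T = dzero" if T: "T \<in> Hs" for T
    proof
      fix \<phi>
      show "T \<phi> = dzero \<phi>"
      proof (cases "schwartz \<phi>")
        case True
        then show ?thesis using ip_rep[OF True T] r0[OF True] ip_zero_right[OF T] by (simp add: dzero_def)
      next
        case False
        then show ?thesis using Hs_tempered[OF T] by (simp add: tempered_def dzero_def)
      qed
    qed
    then show False using nontrivial dzero_Hs by blast
  qed
  then show ?thesis using c that by blast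
qed

text \<open>On the space \<open>M\<close> of representatives both norms are explicit:
  \<open>rep \<psi>\<close> has norm \<open>sqrt c * L2_norm \<psi>\<close>, while the function
  representing it has L^2 norm \<open>c * L2_norm \<psi>\<close>. Their ratio
  \<open>1 / sqrt c\<close> then passes to limits.\<close>

theorem Hs_eq_L2:
  "\<exists>c>0. regdist ` L2 = Hs \<and> (\<forall>f\<in>L2. hnorm ip (regdist f) = c * L2_norm f)"
proof -
  obtain c where c: "c > 0" and rep: "\<And>\<phi> \<psi>. schwartz \<phi> \<Longrightarrow> schwartz \<psi> \<Longrightarrow> rep \<psi> \<phi> = of_real c * l2_form \<phi> \<psi>"
    using rep_l2_form by blast
  have off: "T \<phi> = 0" if "T \<in> Hs" "\<not> schwartz \<phi>" for T \<phi>
    using Hs_tempered[OF that(1)] that(2) by (simp add: tempered_def)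
  have norm_rep: "hnorm ip (rep \<phi>) = sqrt c * L2_norm \<phi>" if "schwartz \<phi>" for \<phi>
  proof (rule power2_eq_imp_eq)
    show "(hnorm ip (rep \<phi>))\<^sup>2 = (sqrt c * L2_norm \<phi>)\<^sup>2"
      using hnorm_square[OF rep_Hs[OF that]] ip_rep[OF that rep_Hs[OF that]] rep[OF that that] l2_form_self[OF that] c
      by (simp add: power_mult_distrib)
  qed (use c in \<open>auto simp: hnorm_nonneg rep_Hs that L2_norm_nonneg\<close>)
  have rep_add: "rep (\<lambda>x. \<phi> x + \<psi> x) = dadd (rep \<phi>) (rep \<psi>)" if "schwartz \<phi>" "schwartz \<psi>" for \<phi> \<psi>
    using that by (intro rep_eqI schwartz_add dadd_Hs rep_Hs)
      (simp_all add: ip_add_right rep_Hs ip_rep tempered_add[OF Hs_tempered])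
  have rep_cmult: "rep (\<lambda>x. a * \<phi> x) = dscale (cnj a) (rep \<phi>)" if "schwartz \<phi>" for a \<phi>
    using that by (intro rep_eqI schwartz_cmult dscale_Hs rep_Hs)
      (simp_all add: ip_scale_right rep_Hs ip_rep tempered_cmult[OF Hs_tempered])
  have rep_diff: "rep (\<lambda>x. \<phi> x - \<psi> x) = dsub (rep \<phi>) (rep \<psi>)" if "schwartz \<phi>" "schwartz \<psi>" for \<phi> \<psi>
    using rep_add[OF that(1) schwartz_cmult[OF that(2), of "-1"]] rep_cmult[OF that(2), of "-1"] by simp
  define M where "M = rep ` {\<phi>. schwartz \<phi>}"
  have M: "M \<subseteq> Hs" "dzero \<in> M" "\<And>m n. m \<in> M \<Longrightarrow> n \<in> M \<Longrightarrow> dadd m n \<in> M" "\<And>a m. m \<in> M \<Longrightarrow> dscale a m \<in> M"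
  proof -
    show "M \<subseteq> Hs" unfolding M_def using rep_Hs by blast
    have "rep (\<lambda>x. 0) = dzero" using rep_cmult[OF schwartz_zero, of 0] by (simp add: dscale_def dzero_def)
    then show "dzero \<in> M" unfolding M_def using schwartz_zero by (metis imageI mem_Collect_eq)
    show "dadd m n \<in> M" if mn: "m \<in> M" "n \<in> M" for m n
    proof -
      obtain \<phi> \<psi> where "m = rep \<phi>" "n = rep \<psi>" "schwartz \<phi>" "schwartz \<psi>" using mn unfolding M_def by blast
      then show ?thesis unfolding M_def using rep_add[of \<phi> \<psi>] schwartz_add[of \<phi> \<psi>] by (metis imageI mem_Collect_eq)
    qed
    show "dscale a m \<in> M" if m: "m \<in> M" for a m
    proof -
      obtain \<phi> where "m = rep \<phi>" "schwartz \<phi>" using m unfolding M_def by blast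
      then show ?thesis unfolding M_def using rep_cmult[of \<phi> "cnj a"] schwartz_cmult[of \<phi> "cnj a"]
        by (metis complex_cnj_cnj imageI mem_Collect_eq)
    qed
  qed
  have ip_rep_left: "ip (rep \<phi>) T = cnj (T \<phi>)" if "schwartz \<phi>" "T \<in> Hs" for \<phi> T
    using ip_sym[OF rep_Hs[OF that(1)] that(2)] ip_rep[OF that] by simp
  have rep_regdist: "rep \<psi> = regdist (\<lambda>x. of_real c * cnj (\<psi> x))" if \<psi>: "schwartz \<psi>" for \<psi>
  proof
    fix \<phi>
    show "rep \<psi> \<phi> = regdist (\<lambda>x. of_real c * cnj (\<psi> x)) \<phi>"
    proof (cases "schwartz \<phi>")
      case True
      have "(\<lambda>x. \<phi> x * cnj (\<psi> x)) \<in> borel_measurable lborel"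
        using schwartz_borel_measurable[OF schwartz_mult[OF True schwartz_cnj[OF \<psi>]]] by simp
      from integral_completion[OF this] show ?thesis
        using True rep[OF True \<psi>] by (simp add: regdist_def l2_form_def mult.assoc mult.commute[of "cnj _"])
    next
      case False
      then show ?thesis using off[OF rep_Hs[OF \<psi>]] by (simp add: regdist_def)
    qed
  qed
  have Hs_L2: "\<exists>f\<in>L2. T = regdist f \<and> hnorm ip T = L2_norm f / sqrt c" if T: "T \<in> Hs" for T
  proof -
    \<comment> \<open>Density of \<open>M\<close>: representing the functional of \<open>T\<close>
      over \<open>M\<close> gives a limit \<open>R\<close> of members of \<open>M\<close>, and
      \<open>R = T\<close> because pairings with \<open>M\<close> are evaluations at Schwartz
      functions.\<close>
    have "\<exists>R\<in>Hs. \<exists>X. (\<forall>n. X n \<in> M) \<and> (\<lambda>n. hnorm ip (dsub (X n) R)) \<longlonglongrightarrow> 0 \<and> (\<forall>m\<in>M. ip m R = ip m T)"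
      using M(1) T Cauchy_Schwarz[OF _ T]
      by (intro riesz_representation[where K = "hnorm ip T"] M) (auto simp: ip_add_left ip_scale_left subset_iff mult.commute)
    then obtain R X where R: "R \<in> Hs" and X: "\<And>n. X n \<in> M" and lim: "(\<lambda>n. hnorm ip (dsub (X n) R)) \<longlonglongrightarrow> 0"
      and RT: "\<And>m. m \<in> M \<Longrightarrow> ip m R = ip m T" by blast
    have "R = T"
    proof
      fix \<phi>
      show "R \<phi> = T \<phi>"
      proof (cases "schwartz \<phi>")
        case True
        then have "ip (rep \<phi>) R = ip (rep \<phi>) T" by (intro RT) (simp add: M_def)
        then show ?thesis using ip_rep_left[OF True R] ip_rep_left[OF True T] by simp
      qed (simp add: off R T)
    qed
    note lim = lim[unfolded this]
    have "\<forall>n. \<exists>\<phi>. schwartz \<phi> \<and> X n = rep \<phi>" using X unfolding M_def by blast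
    then obtain \<Phi> where \<Phi>: "\<And>n. schwartz (\<Phi> n)" "\<And>n. X n = rep (\<Phi> n)" by metis
    define g where "g n = (\<lambda>x. of_real c * cnj (\<Phi> n x))" for n
    have gL: "g n \<in> L2" for n unfolding g_def by (intro L2_cmult schwartz_L2 schwartz_cnj \<Phi>)
    have XH: "X n \<in> Hs" for n using X M(1) by blast
    have L2cnj: "L2_norm (\<lambda>x. of_real c * cnj (\<phi> x)) = c * L2_norm \<phi>" for \<phi>
      unfolding L2_norm_cmult using c by (simp add: L2_norm_def)
    have Xn: "hnorm ip (X n) = L2_norm (g n) / sqrt c" for n
      using c unfolding \<Phi>(2) norm_rep[OF \<Phi>(1)] g_def L2cnj by (simp add: real_div_sqrt field_simps)
    have gdiff: "L2_norm (\<lambda>x. g m x - g n x) = sqrt c * hnorm ip (dsub (X m) (X n))" for m n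
    proof -
      have "(\<lambda>x. g m x - g n x) = (\<lambda>x. of_real c * cnj (\<Phi> m x - \<Phi> n x))" by (simp add: g_def algebra_simps)
      then have "L2_norm (\<lambda>x. g m x - g n x) = c * L2_norm (\<lambda>x. \<Phi> m x - \<Phi> n x)" by (simp only: L2cnj)
      moreover have "hnorm ip (dsub (X m) (X n)) = sqrt c * L2_norm (\<lambda>x. \<Phi> m x - \<Phi> n x)"
        unfolding \<Phi>(2) rep_diff[OF \<Phi>(1) \<Phi>(1), symmetric] by (intro norm_rep schwartz_diff \<Phi>)
      ultimately show ?thesis using c by (simp add: mult.assoc[symmetric])
    qed
    have "\<exists>f\<in>L2. (\<lambda>n. L2_norm (\<lambda>x. g n x - f x)) \<longlonglongrightarrow> 0"
    proof (rule L2_complete[OF gL])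
      fix e :: real assume "e > 0"
      then have "e / sqrt c > 0" using c by simp
      from convergent_imp_Cauchy[OF XH T lim this] obtain N where
        "\<forall>m\<ge>N. \<forall>n\<ge>N. hnorm ip (dsub (X m) (X n)) < e / sqrt c" by blast
      then show "\<exists>N. \<forall>m\<ge>N. \<forall>n\<ge>N. L2_norm (\<lambda>x. g m x - g n x) < e"
        using c unfolding gdiff by (intro exI[of _ N]) (simp add: field_simps)
    qed
    then obtain f where f: "f \<in> L2" "(\<lambda>n. L2_norm (\<lambda>x. g n x - f x)) \<longlonglongrightarrow> 0" by blast
    have "T = regdist f"
    proof
      fix \<phi>
      show "T \<phi> = regdist f \<phi>"
      proof (cases "schwartz \<phi>")
        case True
        have "(\<lambda>n. ip (rep \<phi>) (X n)) \<longlonglongrightarrow> ip (rep \<phi>) T"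
          by (intro ip_convergent_right XH T lim rep_Hs True)
        then have "(\<lambda>n. cnj (X n \<phi>)) \<longlonglongrightarrow> cnj (T \<phi>)"
          unfolding ip_rep_left[OF True XH] ip_rep_left[OF True T] .
        then have l1: "(\<lambda>n. X n \<phi>) \<longlonglongrightarrow> T \<phi>" by (simp add: lim_cnj)
        have "(\<lambda>n. X n \<phi> - regdist f \<phi>) \<longlonglongrightarrow> 0"
        proof (rule tendsto_0_le[OF f(2), where K = "L2_norm \<phi>"], rule always_eventually, rule allI)
          fix n
          have "X n \<phi> - regdist f \<phi> = (\<integral>x. (g n x - f x) * \<phi> x \<partial>lebesgue)"
            using True L2_product_integrable[OF gL schwartz_L2[OF True]] L2_product_integrable[OF f(1) schwartz_L2[OF True]]
            unfolding \<Phi>(2) rep_regdist[OF \<Phi>(1)] by (simp add: regdist_def g_def[symmetric] left_diff_distrib)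
          then show "norm (X n \<phi> - regdist f \<phi>) \<le> norm (L2_norm (\<lambda>x. g n x - f x)) * L2_norm \<phi>"
            using L2_Cauchy_Schwarz[OF L2_diff[OF gL f(1)] schwartz_L2[OF True]] by (simp add: L2_norm_nonneg)
        qed
        then have "(\<lambda>n. X n \<phi>) \<longlonglongrightarrow> regdist f \<phi>" by (simp add: LIM_zero_iff)
        then show ?thesis using l1 LIMSEQ_unique by blast
      qed (simp add: off T regdist_def)
    qed
    moreover have "hnorm ip T = L2_norm f / sqrt c"
    proof -
      have "(\<lambda>n. L2_norm (g n) / sqrt c) \<longlonglongrightarrow> L2_norm f / sqrt c"
        using c by (intro tendsto_divide L2_norm_convergent gL f tendsto_const) auto
      moreover have "(\<lambda>n. hnorm ip (X n)) \<longlonglongrightarrow> hnorm ip T" by (rule hnorm_convergent[OF XH T lim])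
      ultimately show ?thesis unfolding Xn by (rule LIMSEQ_unique[rotated])
    qed
    ultimately show ?thesis using f(1) by blast
  qed
  have L2_Hs: "regdist f \<in> Hs" if f: "f \<in> L2" for f
  proof -
    \<comment> \<open>The conjugate makes \<open>l\<close> linear, as \<open>rep\<close> is
      conjugate-linear. The Riesz representative of \<open>l\<close> turns out to be
      \<open>regdist f\<close>.\<close>
    define l where "l m = cnj (regdist f (SOME \<phi>. schwartz \<phi> \<and> rep \<phi> = m))" for m
    have reg: "regdist f \<phi> = (\<integral>x. f x * \<phi> x \<partial>lebesgue)" if "schwartz \<phi>" for \<phi> using that by (simp add: regdist_def)
    have int: "integrable lebesgue (\<lambda>x. f x * \<phi> x)" if "schwartz \<phi>" for \<phi>
      by (intro L2_product_integrable f schwartz_L2 that)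
    have bound: "norm (regdist f \<phi>) \<le> (L2_norm f / sqrt c) * hnorm ip (rep \<phi>)" if "schwartz \<phi>" for \<phi>
      using L2_Cauchy_Schwarz[OF f schwartz_L2[OF that]] c unfolding reg[OF that] norm_rep[OF that] by simp
    have reg_diff: "regdist f (\<lambda>x. \<phi> x - \<psi> x) = regdist f \<phi> - regdist f \<psi>" if "schwartz \<phi>" "schwartz \<psi>" for \<phi> \<psi>
      using int[OF that(1)] int[OF that(2)] that by (simp add: reg schwartz_diff right_diff_distrib)
    have reg_add: "regdist f (\<lambda>x. \<phi> x + \<psi> x) = regdist f \<phi> + regdist f \<psi>" if "schwartz \<phi>" "schwartz \<psi>" for \<phi> \<psi>
      using int[OF that(1)] int[OF that(2)] that by (simp add: reg schwartz_add distrib_left)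
    have reg_cmult: "regdist f (\<lambda>x. a * \<phi> x) = a * regdist f \<phi>" if "schwartz \<phi>" for a \<phi>
      using that by (simp add: reg schwartz_cmult mult.left_commute)
    have l_rep: "l (rep \<phi>) = cnj (regdist f \<phi>)" if \<phi>: "schwartz \<phi>" for \<phi>
    proof -
      define \<psi> where "\<psi> = (SOME \<psi>. schwartz \<psi> \<and> rep \<psi> = rep \<phi>)"
      have "\<exists>\<psi>. schwartz \<psi> \<and> rep \<psi> = rep \<phi>" using \<phi> by blast
      from someI_ex[OF this] have \<psi>: "schwartz \<psi>" "rep \<psi> = rep \<phi>" unfolding \<psi>_def by blast+
      \<comment> \<open>Independence of the choice: functions with equal representatives differ by
        one whose representative has norm 0, and by \<open>bound\<close> the pairing with
        \<open>f\<close> vanishes on it.\<close>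
      have "rep (\<lambda>x. \<psi> x - \<phi> x) = dzero"
        unfolding rep_diff[OF \<psi>(1) \<phi>] \<psi>(2) by (simp add: dadd_def dscale_def dzero_def)
      moreover have "hnorm ip dzero = 0" using ip_zero_right[OF dzero_Hs] by (simp add: hnorm_def)
      ultimately have "regdist f (\<lambda>x. \<psi> x - \<phi> x) = 0" using bound[OF schwartz_diff[OF \<psi>(1) \<phi>]] by simp
      then have "regdist f \<psi> = regdist f \<phi>" using reg_diff[OF \<psi>(1) \<phi>] by simp
      then show ?thesis by (simp add: l_def \<psi>_def)
    qed
    have "\<exists>R\<in>Hs. \<exists>X. (\<forall>n. X n \<in> M) \<and> (\<lambda>n. hnorm ip (dsub (X n) R)) \<longlonglongrightarrow> 0 \<and> (\<forall>m\<in>M. ip m R = l m)"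
    proof (rule riesz_representation[OF M, where K = "L2_norm f / sqrt c"])
      fix m assume "m \<in> M"
      then obtain \<phi> where m: "m = rep \<phi>" and \<phi>: "schwartz \<phi>" unfolding M_def by blast
      show "norm (l m) \<le> (L2_norm f / sqrt c) * hnorm ip m" using bound[OF \<phi>] unfolding m l_rep[OF \<phi>] by simp
      show "l (dscale a m) = a * l m" for a
        using l_rep[OF schwartz_cmult[OF \<phi>], of "cnj a"] rep_cmult[OF \<phi>, of "cnj a"] reg_cmult[OF \<phi>, of "cnj a"]
        unfolding m l_rep[OF \<phi>] by simp
      fix n assume "n \<in> M"
      then obtain \<psi> where n: "n = rep \<psi>" and \<psi>: "schwartz \<psi>" unfolding M_def by blast
      show "l (dadd m n) = l m + l n"
        using l_rep[OF schwartz_add[OF \<phi> \<psi>]] rep_add[OF \<phi> \<psi>] reg_add[OF \<phi> \<psi>]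
        unfolding m n l_rep[OF \<phi>] l_rep[OF \<psi>] by simp
    qed
    then obtain R where R: "R \<in> Hs" "\<And>m. m \<in> M \<Longrightarrow> ip m R = l m" by blast
    have "R = regdist f"
    proof
      fix \<phi>
      show "R \<phi> = regdist f \<phi>"
      proof (cases "schwartz \<phi>")
        case True
        then have "ip (rep \<phi>) R = l (rep \<phi>)" by (intro R) (simp add: M_def)
        then show ?thesis using ip_rep_left[OF True R(1)] l_rep[OF True] by simp
      qed (simp add: off R regdist_def)
    qed
    then show ?thesis using R(1) by simp
  qed
  have "hnorm ip (regdist f) = (1 / sqrt c) * L2_norm f" if f: "f \<in> L2" for f
  proof -
    obtain g where "g \<in> L2" "regdist f = regdist g" "hnorm ip (regdist f) = L2_norm g / sqrt c"
      using Hs_L2[OF L2_Hs[OF f]] by blast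
    then show ?thesis using regdist_eq_imp_L2_norm_eq[OF f] by simp
  qed
  moreover have "regdist ` L2 = Hs" using Hs_L2 L2_Hs by blast
  moreover have "1 / sqrt c > 0" using c by simp
  ultimately show ?thesis by blast
qed

end

theorem theorem1p3:
  fixes Hs :: "(('a::euclidean_space \<Rightarrow> complex) \<Rightarrow> complex) set"
    and ip :: "(('a \<Rightarrow> complex) \<Rightarrow> complex) \<Rightarrow> (('a \<Rightarrow> complex) \<Rightarrow> complex) \<Rightarrow> complex"
    and C0 :: real
  assumes H: "hilbert_embedded Hs ip"
    and C0: "C0 \<ge> 1"
    and inv: "\<forall>T\<in>Hs. \<forall>x \<xi>. modtrans x \<xi> T \<in> Hs \<and> hnorm ip (modtrans x \<xi> T) \<le> C0 * hnorm ip T"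
    and nontriv: "Hs \<noteq> {dzero}"
  shows "Hs = regdist ` L2 \<and>
         (\<exists>C>0. \<forall>f\<in>L2. C / C0 * L2_norm f \<le> hnorm ip (regdist f) \<and>
                          hnorm ip (regdist f) \<le> C0 * C * L2_norm f)"
proof -
  obtain ip' where H': "hilbert_embedded Hs ip'"
    and inv': "\<forall>T\<in>Hs. \<forall>S\<in>Hs. \<forall>x \<xi>. ip' (modtrans x \<xi> T) (modtrans x \<xi> S) = ip' T S"
    and equiv: "\<forall>T\<in>Hs. hnorm ip T \<le> C0 * hnorm ip' T \<and> hnorm ip' T \<le> C0 * hnorm ip T"
    using unitarization[OF H C0 inv] by blast
  interpret invariant_hilbert_distributions Hs ip'
    by unfold_locales (use H' inv inv' nontriv in auto)
  obtain c where c: "c > 0" and Hs: "regdist ` L2 = Hs"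
    and norm: "\<And>f. f \<in> L2 \<Longrightarrow> hnorm ip' (regdist f) = c * L2_norm f"
    using Hs_eq_L2 by blast
  \<comment> \<open>The constant of the statement is the factor \<open>c\<close> for the invariant
    norm; each of the two comparisons in \<open>equiv\<close> contributes one
    \<open>C0\<close>.\<close>
  have "c / C0 * L2_norm f \<le> hnorm ip (regdist f) \<and> hnorm ip (regdist f) \<le> C0 * c * L2_norm f"
    if "f \<in> L2" for f
  proof -
    have "regdist f \<in> Hs" using Hs that by blast
    then show ?thesis using equiv norm[OF that] C0 by (auto simp: field_simps)
  qed
  then show ?thesis using c Hs by blast
qed

end
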